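(* Let $G$ be a finite-dimensional Lie group with a left-invariant Riemannian metric, and let $\gamma(t)$ be a geodesic in $G$ whose left-translated velocity $u(t)=DL_{\gamma(t)^{-1}}\gamma'(t)\in\mathfrak{g}$ is nonconstant. If right multiplication by $\gamma(\tau)\gamma(0)^{-1}$ is an isometry of the left-invariant metric for some $\tau>0$, then $\gamma(\tau)$ is conjugate to $\gamma(0)$ along $\gamma$. In particular this applies if $\gamma(\tau)=\gamma(0)$.
   Context: $\mathfrak{g}$ is the Lie algebra of $G$ and $L_g$ denotes left translation by $g\in G$. "$\gamma(\tau)$ is conjugate to $\gamma(0)$" means there is a nontrivial Jacobi field along $\gamma$ vanishing at $t=0$ and $t=\tau$.
   Formalization: The isometry hypothesis is on right multiplication by γ(0)^{-1}γ(τ) instead of γ(τ)γ(0)^{-1}; these agree when γ(0) is the identity, and as printed the claim fails for general γ(0), e.g. for translated geodesics in SL(2,R) with metric tr(A^T B). *)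

theory Defs
  imports "HOL-Analysis.Analysis" "HOL-Algebra.Group" "HOL-Library.Function_Algebras"
begin

section \<open>Smooth manifolds\<close>

text \<open>\<open>Ck_on n f S\<close> is meant for open \<open>S\<close>: all partial derivatives of order at most \<open>n\<close> exist and
  are continuous on \<open>S\<close>.\<close>

primrec Ck_on :: "nat \<Rightarrow> ('e::euclidean_space \<Rightarrow> 'f::euclidean_space) \<Rightarrow> 'e set \<Rightarrow> bool" where
  "Ck_on 0 f S \<longleftrightarrow> continuous_on S f"
| "Ck_on (Suc n) f S \<longleftrightarrow>
     (\<forall>x\<in>S. f differentiable (at x)) \<and> (\<forall>v. Ck_on n (\<lambda>x. frechet_derivative f (at x) v) S)"

definition smooth_on :: "('e::euclidean_space \<Rightarrow> 'f::euclidean_space) \<Rightarrow> 'e set \<Rightarrow> bool" where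
  "smooth_on f S \<longleftrightarrow> (\<forall>n. Ck_on n f S)"

text \<open>A chart is a pair of its domain and its coordinate map, whose values off the domain are
  irrelevant. A manifold is an open subset of a (Hausdorff, second countable) ambient space, namely
  the union of the chart domains of a smooth atlas. The atlas need not be maximal.\<close>

type_synonym ('a, 'e) chart = "'a set \<times> ('a \<Rightarrow> 'e)"
type_synonym ('a, 'e) atlas = "('a, 'e) chart set"

definition chart_inv :: "('a, 'e) chart \<Rightarrow> 'e \<Rightarrow> 'a" where
  "chart_inv c = inv_into (fst c) (snd c)"

definition chart_image :: "('a, 'e) chart \<Rightarrow> 'e set" where
  "chart_image c = snd c ` fst c"

definition manifold_carrier :: "('a, 'e) atlas \<Rightarrow> 'a set" where
  "manifold_carrier A = (\<Union>c\<in>A. fst c)"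

definition charts_at :: "('a, 'e) atlas \<Rightarrow> 'a \<Rightarrow> ('a, 'e) chart set" where
  "charts_at A p = {c \<in> A. p \<in> fst c}"

definition smooth_atlas ::
  "('a::{t2_space, second_countable_topology}, 'e::euclidean_space) atlas \<Rightarrow> bool" where
  "smooth_atlas A \<longleftrightarrow>
     (\<forall>c\<in>A. open (fst c) \<and> open (chart_image c) \<and>
        homeomorphism (fst c) (chart_image c) (snd c) (chart_inv c)) \<and>
     (\<forall>c\<in>A. \<forall>d\<in>A. smooth_on (snd d \<circ> chart_inv c) (snd c ` (fst c \<inter> fst d)))"

definition smooth_map ::
  "('a::topological_space, 'e::euclidean_space) atlas \<Rightarrow>
   ('b::topological_space, 'f::euclidean_space) atlas \<Rightarrow> ('a \<Rightarrow> 'b) \<Rightarrow> bool" where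
  "smooth_map A B f \<longleftrightarrow>
     continuous_on (manifold_carrier A) f \<and> f ` manifold_carrier A \<subseteq> manifold_carrier B \<and>
     (\<forall>c\<in>A. \<forall>d\<in>B. smooth_on (snd d \<circ> f \<circ> chart_inv c) (snd c ` (fst c \<inter> f -` fst d)))"

definition prod_atlas :: "('a, 'e) atlas \<Rightarrow> ('b, 'f) atlas \<Rightarrow> ('a \<times> 'b, 'e \<times> 'f) atlas" where
  "prod_atlas A B = {(fst c \<times> fst d, map_prod (snd c) (snd d)) | c d. c \<in> A \<and> d \<in> B}"


section \<open>Tangent vectors\<close>

text \<open>A tangent vector at \<open>p\<close> is the family of its coordinates in all charts around \<open>p\<close>, related by
  the Jacobians of the coordinate changes; it is set to \<open>0\<close> on the other charts, so that
  \<open>tangent_space A p\<close> is a vector space under the pointwise operations.\<close>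

type_synonym ('a, 'e) tangent = "('a, 'e) chart \<Rightarrow> 'e"

definition coord_change ::
  "('a, 'e::euclidean_space) chart \<Rightarrow> ('a, 'e) chart \<Rightarrow> 'a \<Rightarrow> 'e \<Rightarrow> 'e" where
  "coord_change c d p = frechet_derivative (snd d \<circ> chart_inv c) (at (snd c p))"

definition tangent_space ::
  "('a, 'e::euclidean_space) atlas \<Rightarrow> 'a \<Rightarrow> ('a, 'e) tangent set" where
  "tangent_space A p = {v.
     (\<forall>c. c \<notin> charts_at A p \<longrightarrow> v c = 0) \<and>
     (\<forall>c\<in>charts_at A p. \<forall>d\<in>charts_at A p. v d = coord_change c d p (v c))}"

definition tangent_of_coords ::
  "('a, 'e::euclidean_space) atlas \<Rightarrow> ('a, 'e) chart \<Rightarrow> 'a \<Rightarrow> 'e \<Rightarrow> ('a, 'e) tangent" where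
  "tangent_of_coords A c p x = (\<lambda>d. if d \<in> charts_at A p then coord_change c d p x else 0)"

definition tangent_map ::
  "('a, 'e::euclidean_space) atlas \<Rightarrow> ('b, 'f::euclidean_space) atlas \<Rightarrow> ('a \<Rightarrow> 'b) \<Rightarrow> 'a \<Rightarrow>
   ('a, 'e) tangent \<Rightarrow> ('b, 'f) tangent" where
  "tangent_map A B f p v = (\<lambda>d. if d \<in> charts_at B (f p)
     then (let c = (SOME c. c \<in> charts_at A p) in
             frechet_derivative (snd d \<circ> f \<circ> chart_inv c) (at (snd c p)) (v c))
     else 0)"


section \<open>Riemannian metrics and their Levi-Civita connections\<close>

type_synonym ('a, 'e) metric = "'a \<Rightarrow> ('a, 'e) tangent \<Rightarrow> ('a, 'e) tangent \<Rightarrow> real"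

definition metric_coords ::
  "('a, 'e::euclidean_space) atlas \<Rightarrow> ('a, 'e) metric \<Rightarrow> ('a, 'e) chart \<Rightarrow> 'e \<Rightarrow> 'e \<Rightarrow> 'e \<Rightarrow> real" where
  "metric_coords A g c x v w = (let p = chart_inv c x in
     g p (tangent_of_coords A c p v) (tangent_of_coords A c p w))"

definition riemannian_metric ::
  "('a, 'e::euclidean_space) atlas \<Rightarrow> ('a, 'e) metric \<Rightarrow> bool" where
  "riemannian_metric A g \<longleftrightarrow>
     (\<forall>c\<in>A. \<forall>x\<in>chart_image c.
        bilinear (metric_coords A g c x) \<and>
        (\<forall>v w. metric_coords A g c x v w = metric_coords A g c x w v) \<and>
        (\<forall>v. v \<noteq> 0 \<longrightarrow> metric_coords A g c x v v > 0)) \<and>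
     (\<forall>c\<in>A. \<forall>v w. smooth_on (\<lambda>x. metric_coords A g c x v w) (chart_image c))"

definition riemannian_isometry ::
  "('a::topological_space, 'e::euclidean_space) atlas \<Rightarrow> ('a, 'e) metric \<Rightarrow> ('a \<Rightarrow> 'a) \<Rightarrow> bool" where
  "riemannian_isometry A g f \<longleftrightarrow>
     bij_betw f (manifold_carrier A) (manifold_carrier A) \<and>
     smooth_map A A f \<and> smooth_map A A (inv_into (manifold_carrier A) f) \<and>
     (\<forall>p\<in>manifold_carrier A. \<forall>v\<in>tangent_space A p. \<forall>w\<in>tangent_space A p.
        g (f p) (tangent_map A A f p v) (tangent_map A A f p w) = g p v w)"

text \<open>The Christoffel symbols of the Levi-Civita connection in the chart \<open>c\<close>: with
  \<open>v = \<partial>\<^sub>i\<close>, \<open>w = \<partial>\<^sub>j\<close>, \<open>z = \<partial>\<^sub>l\<close> the defining equation reads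
  \<open>g\<^sub>k\<^sub>l \<Gamma>\<^sup>k\<^sub>i\<^sub>j = (\<partial>\<^sub>i g\<^sub>j\<^sub>l + \<partial>\<^sub>j g\<^sub>i\<^sub>l - \<partial>\<^sub>l g\<^sub>i\<^sub>j) / 2\<close>.\<close>

definition christoffel ::
  "('a, 'e::euclidean_space) atlas \<Rightarrow> ('a, 'e) metric \<Rightarrow> ('a, 'e) chart \<Rightarrow> 'e \<Rightarrow> 'e \<Rightarrow> 'e \<Rightarrow> 'e" where
  "christoffel A g c x v w = (THE y. \<forall>z. metric_coords A g c x y z =
     (frechet_derivative (\<lambda>x. metric_coords A g c x w z) (at x) v
      + frechet_derivative (\<lambda>x. metric_coords A g c x v z) (at x) w
      - frechet_derivative (\<lambda>x. metric_coords A g c x v w) (at x) z) / 2)"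

text \<open>The curvature tensor \<open>R(X,Y)Z = \<nabla>\<^sub>X\<nabla>\<^sub>Y Z - \<nabla>\<^sub>Y\<nabla>\<^sub>X Z - \<nabla>\<^sub>[\<^sub>X\<^sub>,\<^sub>Y\<^sub>]Z\<close>, evaluated on coordinate
  vector fields.\<close>

definition curvature_coords ::
  "('a, 'e::euclidean_space) atlas \<Rightarrow> ('a, 'e) metric \<Rightarrow> ('a, 'e) chart \<Rightarrow> 'e \<Rightarrow> 'e \<Rightarrow> 'e \<Rightarrow> 'e \<Rightarrow> 'e" where
  "curvature_coords A g c x v w z =
     frechet_derivative (\<lambda>x. christoffel A g c x w z) (at x) v
     - frechet_derivative (\<lambda>x. christoffel A g c x v z) (at x) w
     + christoffel A g c x v (christoffel A g c x w z)
     - christoffel A g c x w (christoffel A g c x v z)"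

definition curvature ::
  "('a, 'e::euclidean_space) atlas \<Rightarrow> ('a, 'e) metric \<Rightarrow> 'a \<Rightarrow>
   ('a, 'e) tangent \<Rightarrow> ('a, 'e) tangent \<Rightarrow> ('a, 'e) tangent \<Rightarrow> ('a, 'e) tangent" where
  "curvature A g p u v w = (\<lambda>c. if c \<in> charts_at A p
     then curvature_coords A g c (snd c p) (u c) (v c) (w c) else 0)"


section \<open>Curves, geodesics, Jacobi fields\<close>

text \<open>Curves are parametrised by a nondegenerate interval \<open>I\<close> of any kind; derivatives are taken
  within \<open>I\<close>, so they are one-sided at those endpoints of \<open>I\<close> that belong to it.\<close>

definition differentiable_curve ::
  "('a::topological_space, 'e::euclidean_space) atlas \<Rightarrow> real set \<Rightarrow> (real \<Rightarrow> 'a) \<Rightarrow> bool" where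
  "differentiable_curve A I \<gamma> \<longleftrightarrow>
     continuous_on I \<gamma> \<and> \<gamma> ` I \<subseteq> manifold_carrier A \<and>
     (\<forall>t\<in>I. \<forall>c\<in>charts_at A (\<gamma> t). (\<lambda>s. snd c (\<gamma> s)) differentiable (at t within I))"

definition velocity ::
  "('a, 'e::euclidean_space) atlas \<Rightarrow> real set \<Rightarrow> (real \<Rightarrow> 'a) \<Rightarrow> real \<Rightarrow> ('a, 'e) tangent" where
  "velocity A I \<gamma> t = (\<lambda>c. if c \<in> charts_at A (\<gamma> t)
     then vector_derivative (\<lambda>s. snd c (\<gamma> s)) (at t within I) else 0)"

definition differentiable_field_along ::
  "('a, 'e::euclidean_space) atlas \<Rightarrow> real set \<Rightarrow> (real \<Rightarrow> 'a) \<Rightarrow> (real \<Rightarrow> ('a, 'e) tangent) \<Rightarrow> bool" where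
  "differentiable_field_along A I \<gamma> V \<longleftrightarrow>
     (\<forall>t\<in>I. V t \<in> tangent_space A (\<gamma> t) \<and>
        (\<forall>c\<in>charts_at A (\<gamma> t). (\<lambda>s. V s c) differentiable (at t within I)))"

definition covariant_derivative ::
  "('a, 'e::euclidean_space) atlas \<Rightarrow> ('a, 'e) metric \<Rightarrow> real set \<Rightarrow> (real \<Rightarrow> 'a) \<Rightarrow>
   (real \<Rightarrow> ('a, 'e) tangent) \<Rightarrow> real \<Rightarrow> ('a, 'e) tangent" where
  "covariant_derivative A g I \<gamma> V t = (\<lambda>c. if c \<in> charts_at A (\<gamma> t)
     then vector_derivative (\<lambda>s. V s c) (at t within I)
          + christoffel A g c (snd c (\<gamma> t)) (velocity A I \<gamma> t c) (V t c)
     else 0)"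

text \<open>Only the differentiability needed to write down the equations is demanded of geodesics and
  Jacobi fields; as solutions of smooth second-order ODEs they are then smooth.\<close>

definition geodesic ::
  "('a::topological_space, 'e::euclidean_space) atlas \<Rightarrow> ('a, 'e) metric \<Rightarrow> real set \<Rightarrow>
   (real \<Rightarrow> 'a) \<Rightarrow> bool" where
  "geodesic A g I \<gamma> \<longleftrightarrow>
     differentiable_curve A I \<gamma> \<and> differentiable_field_along A I \<gamma> (velocity A I \<gamma>) \<and>
     (\<forall>t\<in>I. covariant_derivative A g I \<gamma> (velocity A I \<gamma>) t = 0)"

definition jacobi_field ::
  "('a, 'e::euclidean_space) atlas \<Rightarrow> ('a, 'e) metric \<Rightarrow> real set \<Rightarrow> (real \<Rightarrow> 'a) \<Rightarrow>
   (real \<Rightarrow> ('a, 'e) tangent) \<Rightarrow> bool" where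
  "jacobi_field A g I \<gamma> J \<longleftrightarrow>
     differentiable_field_along A I \<gamma> J \<and>
     differentiable_field_along A I \<gamma> (covariant_derivative A g I \<gamma> J) \<and>
     (\<forall>t\<in>I. covariant_derivative A g I \<gamma> (covariant_derivative A g I \<gamma> J) t
        + curvature A g (\<gamma> t) (J t) (velocity A I \<gamma> t) (velocity A I \<gamma> t) = 0)"

definition conjugate_along ::
  "('a, 'e::euclidean_space) atlas \<Rightarrow> ('a, 'e) metric \<Rightarrow> real set \<Rightarrow> (real \<Rightarrow> 'a) \<Rightarrow>
   real \<Rightarrow> real \<Rightarrow> bool" where
  "conjugate_along A g I \<gamma> a b \<longleftrightarrow>
     (\<exists>J. jacobi_field A g I \<gamma> J \<and> (\<exists>t\<in>I. J t \<noteq> 0) \<and> J a = 0 \<and> J b = 0)"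


section \<open>Lie groups with a left-invariant metric\<close>

definition lie_group ::
  "'a::{t2_space, second_countable_topology} monoid \<Rightarrow> ('a, 'e::euclidean_space) atlas \<Rightarrow> bool" where
  "lie_group G A \<longleftrightarrow>
     group G \<and> smooth_atlas A \<and> carrier G = manifold_carrier A \<and>
     smooth_map (prod_atlas A A) A (\<lambda>(x, y). x \<otimes>\<^bsub>G\<^esub> y) \<and>
     smooth_map A A (\<lambda>x. inv\<^bsub>G\<^esub> x)"

definition left_translation :: "'a monoid \<Rightarrow> 'a \<Rightarrow> 'a \<Rightarrow> 'a" where
  "left_translation G h = (\<lambda>x. h \<otimes>\<^bsub>G\<^esub> x)"

text \<open>The right translation carrying \<open>p\<close> to \<open>q\<close> is \<open>R\<^sub>q \<circ> R\<^sub>p\<^sup>-\<^sup>1\<close>, i.e. \<open>right_translation G h\<close> with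
  \<open>h = p\<^sup>-\<^sup>1q\<close>. Right translation by \<open>q p\<^sup>-\<^sup>1\<close> is the same map if \<open>p\<close> is the identity, but in general it
  is a different one, and being an isometry of a given left-invariant metric is not
  invariant under passing from \<open>h\<close> to its conjugate \<open>p h p\<^sup>-\<^sup>1 = q p\<^sup>-\<^sup>1\<close>.\<close>

definition right_translation :: "'a monoid \<Rightarrow> 'a \<Rightarrow> 'a \<Rightarrow> 'a" where
  "right_translation G h = (\<lambda>x. x \<otimes>\<^bsub>G\<^esub> h)"

definition left_invariant_metric ::
  "'a::topological_space monoid \<Rightarrow> ('a, 'e::euclidean_space) atlas \<Rightarrow> ('a, 'e) metric \<Rightarrow> bool" where
  "left_invariant_metric G A g \<longleftrightarrow>
     riemannian_metric A g \<and> (\<forall>h\<in>carrier G. riemannian_isometry A g (left_translation G h))"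

text \<open>The Lie algebra is the tangent space at the identity; \<open>left_velocity G A I \<gamma> t\<close> lies in it.\<close>

definition left_velocity ::
  "'a monoid \<Rightarrow> ('a, 'e::euclidean_space) atlas \<Rightarrow> real set \<Rightarrow> (real \<Rightarrow> 'a) \<Rightarrow> real \<Rightarrow> ('a, 'e) tangent"
  where
  "left_velocity G A I \<gamma> t =
     tangent_map A A (left_translation G (inv\<^bsub>G\<^esub> (\<gamma> t))) (\<gamma> t) (velocity A I \<gamma> t)"

end

theory Submission
  imports Defs
begin

text \<open>Let \<open>K\<close> be the right-invariant vector field with \<open>K (\<gamma> 0) = \<gamma>' 0\<close>. Its flow consists of left
  translations, so \<open>K\<close> is a Killing field and \<open>J = \<gamma>' - K \<circ> \<gamma>\<close> is a Jacobi field vanishing at \<open>0\<close>.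
  For every right-invariant field \<open>X\<close> the momentum \<open>g(\<gamma>', X)\<close> is conserved along \<open>\<gamma>\<close>. If right
  translation by \<open>\<gamma>(0)\<^sup>-\<^sup>1\<gamma>(\<tau>)\<close> is an isometry, it carries \<open>K (\<gamma> 0)\<close> and \<open>X (\<gamma> 0)\<close> to \<open>K (\<gamma> \<tau>)\<close> and
  \<open>X (\<gamma> \<tau>)\<close>, so \<open>\<gamma>' \<tau>\<close> and \<open>K (\<gamma> \<tau>)\<close> have the same inner product with every \<open>X (\<gamma> \<tau>)\<close> and hence
  \<open>J \<tau> = 0\<close>. If \<open>J\<close> vanished identically, \<open>\<gamma>\<close> would be an integral curve of \<open>K\<close>; then
  \<open>s \<mapsto> \<gamma>(s)\<^sup>-\<^sup>1\<gamma>(s + k)\<close> has zero velocity, and its constancy makes the left velocity constant.\<close>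

section \<open>Calculus\<close>

text \<open>No flow of K is constructed. Differentiating the relation "left translations are
  isometries" in the translating element gives the Killing equation L_K g = 0 in coordinates.
  Differentiating once more and inserting the result into the Koszul formula gives L_K \<Gamma> = 0,
  a second-order equation for K whose restriction to a geodesic is the Jacobi equation. The field
  \<gamma>' contributes nothing, being parallel with R(\<gamma>', \<gamma>')\<gamma>' = 0. Momentum
  conservation is half of the Killing equation evaluated on (\<gamma>', \<gamma>'). Two features
  shape the rest. Tangent vectors are families over all charts, so local formulas must be compatible
  with coordinate changes; the inhomogeneous Hessian terms cancel because second derivatives are
  symmetric. And I may be any interval, so derivatives are one-sided at its endpoints and \<gamma>(s
  + k) exists only for some s and k; velocities are therefore taken relative to a set, and the
  constancy argument runs on subintervals.\<close>

abbreviation fderiv :: "('e::euclidean_space \<Rightarrow> 'f::euclidean_space) \<Rightarrow> 'e \<Rightarrow> 'e \<Rightarrow> 'f" where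
  "fderiv f x \<equiv> frechet_derivative f (at x)"

lemma fderiv_eqI: "(f has_derivative f') (at x) \<Longrightarrow> fderiv f x = f'"
  using frechet_derivative_at by metis

lemma Ck_on_cong:
  assumes "open S" "\<And>x. x \<in> S \<Longrightarrow> f x = g x"
  shows "Ck_on n f S \<longleftrightarrow> Ck_on n g S"
  using assms(2)
proof (induction n arbitrary: f g)
  case 0
  then show ?case by (simp cong: continuous_on_cong)
next
  case (Suc n)
  have d: "f differentiable (at x) \<longleftrightarrow> g differentiable (at x)" if "x \<in> S" for x
    unfolding differentiable_def
    using that Suc.prems assms(1) has_derivative_transform_within_open
    by (metis (no_types, lifting))
  have e: "fderiv f x = fderiv g x" if "x \<in> S" for x
  proof (cases "f differentiable (at x)")
    case True
    then show ?thesis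
      using that Suc.prems assms(1) frechet_derivative_transform_within_open by blast
  next
    case False
    \<comment> \<open>\<open>frechet_derivative\<close> is a choice among all derivatives. Where
      none exists, f and g still have the same candidates, so the choice returns the same
      function.\<close>
    have "(f has_derivative F) (at x) \<longleftrightarrow> (g has_derivative F) (at x)" for F
      using that Suc.prems assms(1) has_derivative_transform_within_open
      by (metis (no_types, lifting))
    then show ?thesis unfolding frechet_derivative_def by simp
  qed
  have "Ck_on n (\<lambda>x. fderiv f x v) S \<longleftrightarrow> Ck_on n (\<lambda>x. fderiv g x v) S" for v
    by (rule Suc.IH) (simp add: e)
  then show ?case using d by auto
qed

lemma Ck_on_subset: "Ck_on n f S \<Longrightarrow> T \<subseteq> S \<Longrightarrow> Ck_on n f T"
  by (induction n arbitrary: f) (auto intro: continuous_on_subset)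

lemma smooth_on_cong:
  "open S \<Longrightarrow> (\<And>x. x \<in> S \<Longrightarrow> f x = g x) \<Longrightarrow> smooth_on f S \<longleftrightarrow> smooth_on g S"
  unfolding smooth_on_def using Ck_on_cong by blast

lemma smooth_on_subset: "smooth_on f S \<Longrightarrow> T \<subseteq> S \<Longrightarrow> smooth_on f T"
  unfolding smooth_on_def using Ck_on_subset by blast

lemma smooth_on_continuous: "smooth_on f S \<Longrightarrow> continuous_on S f"
  unfolding smooth_on_def by (metis Ck_on.simps(1))

lemma smooth_on_fderiv: "smooth_on f S \<Longrightarrow> smooth_on (\<lambda>x. fderiv f x v) S"
  unfolding smooth_on_def by (metis Ck_on.simps(2))

lemma smooth_on_has_derivative:
  "smooth_on f S \<Longrightarrow> x \<in> S \<Longrightarrow> (f has_derivative fderiv f x) (at x)"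
  unfolding smooth_on_def by (metis Ck_on.simps(2) frechet_derivative_works)

lemma smooth_on_linear_fderiv: "smooth_on f S \<Longrightarrow> x \<in> S \<Longrightarrow> linear (fderiv f x)"
  by (meson has_derivative_linear smooth_on_has_derivative)

lemma smooth_on_isCont: "smooth_on f S \<Longrightarrow> x \<in> S \<Longrightarrow> isCont f x"
  by (meson has_derivative_continuous smooth_on_has_derivative)

text \<open>The slice map is affine, so no general chain rule for \<open>Ck_on\<close> is needed.\<close>

lemma smooth_on_slice:
  fixes f :: "'e::euclidean_space \<times> 'f::euclidean_space \<Rightarrow> 'g::euclidean_space"
  assumes "smooth_on f W" "\<And>z. z \<in> S \<Longrightarrow> (y, z) \<in> W" "open S"
  shows "smooth_on (\<lambda>z. f (y, z)) S"
proof -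
  have "Ck_on n (\<lambda>z. f (y, z)) S" if "smooth_on f W" for n
    using that
  proof (induction n arbitrary: f)
    case 0
    have "continuous_on ((\<lambda>z. (y, z)) ` S) f"
      by (rule continuous_on_subset[OF smooth_on_continuous[OF 0]]) (use assms(2) in auto)
    then have "continuous_on S (f \<circ> (\<lambda>z. (y, z)))"
      by (intro continuous_on_compose) (auto intro!: continuous_intros)
    then show ?case by (simp add: o_def)
  next
    case (Suc n)
    have d: "((\<lambda>z. f (y, z)) has_derivative (\<lambda>v. fderiv f (y, z) (0, v))) (at z)"
      if "z \<in> S" for z
      by (rule has_derivative_compose[of "\<lambda>z. (y, z)" "\<lambda>v. (0, v)" z UNIV f,
            OF _ smooth_on_has_derivative[OF Suc.prems assms(2)[OF that]]])
         (auto intro!: derivative_eq_intros)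
    have "Ck_on n (\<lambda>z. fderiv f (y, z) (0, v)) S" for v
      by (rule Suc.IH) (rule smooth_on_fderiv[OF Suc.prems])
    then have "Ck_on n (\<lambda>z. fderiv (\<lambda>z. f (y, z)) z v) S" for v
      by (subst Ck_on_cong[OF assms(3)]) (auto simp: fderiv_eqI[OF d])
    then show ?case using d by (auto simp: differentiable_def)
  qed
  then show ?thesis using assms(1) unfolding smooth_on_def by blast
qed

text \<open>The one-variable mean value theorem is applied twice: to s with the increment
  \<open>h *\<^sub>R w\<close> frozen, then to t in the resulting derivative. Pairing with b makes
  the functions real-valued, as that theorem requires, so the intermediate point depends on
  b.\<close>

lemma mixed_difference_MVT:
  fixes f :: "'e::euclidean_space \<Rightarrow> 'f::euclidean_space"
  assumes f: "smooth_on f (ball x r)" and h: "0 < h" "h * (norm v + norm w) < r"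
  shows "\<exists>y. dist x y \<le> h * (norm v + norm w) \<and>
    (f (x + h *\<^sub>R v + h *\<^sub>R w) - f (x + h *\<^sub>R v) - (f (x + h *\<^sub>R w) - f x)) \<bullet> b
      = h * h * (fderiv (\<lambda>x. fderiv f x v) y w \<bullet> b)"
proof -
  have n: "norm (s *\<^sub>R v + t *\<^sub>R w) \<le> h * (norm v + norm w)"
    if "0 \<le> s" "s \<le> h" "0 \<le> t" "t \<le> h" for s t
  proof -
    have "norm (s *\<^sub>R v + t *\<^sub>R w) \<le> s * norm v + t * norm w"
      using that norm_triangle_ineq[of "s *\<^sub>R v" "t *\<^sub>R w"] by simp
    also have "\<dots> \<le> h * norm v + h * norm w"
      using that by (intro add_mono mult_right_mono) auto
    finally show ?thesis by (simp add: distrib_left)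
  qed
  have d: "dist x (x + s *\<^sub>R v + t *\<^sub>R w) \<le> h * (norm v + norm w)"
    if "0 \<le> s" "s \<le> h" "0 \<le> t" "t \<le> h" for s t
    using n[OF that] by (metis add.assoc add_diff_cancel_left' dist_commute dist_norm)
  have inb: "x + s *\<^sub>R v + t *\<^sub>R w \<in> ball x r"
    if "0 \<le> s" "s \<le> h" "0 \<le> t" "t \<le> h" for s t
    using d[OF that] h by auto
  let ?\<phi> = "\<lambda>s. (f (x + s *\<^sub>R v + h *\<^sub>R w) - f (x + s *\<^sub>R v)) \<bullet> b"
  let ?\<phi>' = "\<lambda>s. (fderiv f (x + s *\<^sub>R v + h *\<^sub>R w) v - fderiv f (x + s *\<^sub>R v) v) \<bullet> b"
  have D1: "((\<lambda>s. f (x + s *\<^sub>R v + t *\<^sub>R w)) has_derivative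
      (\<lambda>k. k *\<^sub>R fderiv f (x + s *\<^sub>R v + t *\<^sub>R w) v)) (at s)"
    if "0 \<le> s" "s \<le> h" "0 \<le> t" "t \<le> h" for s t
  proof -
    have "((\<lambda>s. f (x + s *\<^sub>R v + t *\<^sub>R w)) has_derivative
      (\<lambda>k. fderiv f (x + s *\<^sub>R v + t *\<^sub>R w) (k *\<^sub>R v))) (at s)"
      by (rule has_derivative_compose[where f = "\<lambda>s. x + s *\<^sub>R v + t *\<^sub>R w",
            OF _ smooth_on_has_derivative[OF f inb[OF that]]])
         (auto intro!: derivative_eq_intros)
    then show ?thesis
      using linear_cmul[OF smooth_on_linear_fderiv[OF f inb[OF that]]] by simp
  qed
  have "DERIV ?\<phi> s :> ?\<phi>' s" if "0 \<le> s" "s \<le> h" for s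
    unfolding has_field_derivative_def
    using D1[of s h] D1[of s 0] that h(1)
    by (auto intro!: derivative_eq_intros simp: inner_diff_left algebra_simps fun_eq_iff)
  then obtain s where s: "0 < s" "s < h" "?\<phi> h - ?\<phi> 0 = h * ?\<phi>' s"
    using MVT2[of 0 h ?\<phi> ?\<phi>'] h(1) by auto
  let ?\<psi> = "\<lambda>t. fderiv f (x + s *\<^sub>R v + t *\<^sub>R w) v \<bullet> b"
  let ?\<psi>' = "\<lambda>t. fderiv (\<lambda>x. fderiv f x v) (x + s *\<^sub>R v + t *\<^sub>R w) w \<bullet> b"
  note f2 = smooth_on_fderiv[OF f, of v]
  have "DERIV ?\<psi> t :> ?\<psi>' t" if "0 \<le> t" "t \<le> h" for t
  proof -
    have i: "x + s *\<^sub>R v + t *\<^sub>R w \<in> ball x r" using inb[of s t] that s by simp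
    have "((\<lambda>t. fderiv f (x + s *\<^sub>R v + t *\<^sub>R w) v) has_derivative
      (\<lambda>k. fderiv (\<lambda>x. fderiv f x v) (x + s *\<^sub>R v + t *\<^sub>R w) (k *\<^sub>R w))) (at t)"
      by (rule has_derivative_compose[where f = "\<lambda>t. x + s *\<^sub>R v + t *\<^sub>R w",
            OF _ smooth_on_has_derivative[OF f2 i]])
         (auto intro!: derivative_eq_intros)
    then have "(?\<psi> has_derivative
      (\<lambda>k. fderiv (\<lambda>x. fderiv f x v) (x + s *\<^sub>R v + t *\<^sub>R w) (k *\<^sub>R w) \<bullet> b)) (at t)"
      by (rule has_derivative_inner_left)
    then show ?thesis
      unfolding has_field_derivative_def
      using linear_cmul[OF smooth_on_linear_fderiv[OF f2 i]]
      by (simp add: mult_commute_abs)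
  qed
  then obtain t where t: "0 < t" "t < h" "?\<psi> h - ?\<psi> 0 = h * ?\<psi>' t"
    using MVT2[of 0 h ?\<psi> ?\<psi>'] h(1) by auto
  have "?\<phi> h - ?\<phi> 0 = h * (h * ?\<psi>' t)"
    using s(3) t(3) by (simp add: inner_diff_left)
  moreover have "dist x (x + s *\<^sub>R v + t *\<^sub>R w) \<le> h * (norm v + norm w)"
    using d s t by simp
  ultimately show ?thesis
    by (intro exI[of _ "x + s *\<^sub>R v + t *\<^sub>R w"]) (simp add: inner_diff_left)
qed

lemma isCont_eventually_mem:
  "isCont f x \<Longrightarrow> open X \<Longrightarrow> f x \<in> X \<Longrightarrow> \<forall>\<^sub>F y in nhds x. f y \<in> X"
  unfolding continuous_at tendsto_at_iff_tendsto_nhds by (rule topological_tendstoD)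

text \<open>The mixed second difference is unchanged when v and w are swapped, and it equals h * h
  times either mixed derivative at a point close to x. If the two derivatives differed at x,
  continuity would keep them in disjoint open sets X and Y at all points within r of x, and they
  could not share a value.\<close>

theorem fderiv_fderiv_commute:
  fixes f :: "'e::euclidean_space \<Rightarrow> 'f::euclidean_space"
  assumes f: "smooth_on f S" and S: "open S" "x \<in> S"
  shows "fderiv (\<lambda>x. fderiv f x v) x w = fderiv (\<lambda>x. fderiv f x w) x v"
proof (rule euclidean_eqI, rule ccontr)
  fix b :: 'f
  let ?A = "\<lambda>v w y. fderiv (\<lambda>x. fderiv f x v) y w \<bullet> b"
  assume "?A v w x \<noteq> ?A w v x"
  then obtain X Y where XY: "open X" "open Y" "?A v w x \<in> X" "?A w v x \<in> Y" "X \<inter> Y = {}"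
    using hausdorff by metis
  have c: "isCont (?A v w) x" for v w
    using smooth_on_isCont[OF smooth_on_fderiv[OF smooth_on_fderiv[OF f]] S(2)]
    by (intro isCont_inner) auto
  have "\<forall>\<^sub>F y in nhds x. ?A v w y \<in> X" "\<forall>\<^sub>F y in nhds x. ?A w v y \<in> Y"
    by (rule isCont_eventually_mem[OF c] XY)+
  moreover have "\<forall>\<^sub>F y in nhds x. y \<in> S" using S by (simp add: eventually_nhds_in_open)
  ultimately have "\<forall>\<^sub>F y in nhds x. ?A v w y \<in> X \<and> ?A w v y \<in> Y \<and> y \<in> S"
    by eventually_elim auto
  then obtain r where r: "r > 0"
    "\<And>y. dist y x < r \<Longrightarrow> ?A v w y \<in> X \<and> ?A w v y \<in> Y \<and> y \<in> S"
    unfolding eventually_nhds_metric by auto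
  \<comment> \<open>The summand 1 keeps N positive when v = w = 0; with h = r / (2 * N) the
    intermediate points lie within r / 2 of x.\<close>
  define N where "N = norm v + norm w + 1"
  have N: "N > 0" unfolding N_def by (simp add: add_nonneg_pos)
  define h where "h = r / (2 * N)"
  have h: "h > 0" "h * (norm v + norm w) < r"
  proof -
    show "h > 0" using r N by (simp add: h_def)
    have "h * (norm v + norm w) \<le> h * N" using \<open>h > 0\<close> by (simp add: N_def)
    also have "\<dots> = r / 2" using N by (simp add: h_def)
    finally show "h * (norm v + norm w) < r" using r by simp
  qed
  have fb: "smooth_on f (ball x r)"
    using f r(2) by (auto intro: smooth_on_subset simp: dist_commute)
  let ?F = "(f (x + h *\<^sub>R v + h *\<^sub>R w) - f (x + h *\<^sub>R v) - (f (x + h *\<^sub>R w) - f x)) \<bullet> b"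
  obtain y where y: "dist x y \<le> h * (norm v + norm w)" "?F = h * h * ?A v w y"
    using mixed_difference_MVT[OF fb h] by blast
  have "h * (norm w + norm v) < r" using h by (simp add: add.commute)
  from mixed_difference_MVT[OF fb h(1) this, of b]
  obtain z where z: "dist x z \<le> h * (norm w + norm v)" "(f (x + h *\<^sub>R w + h *\<^sub>R v)
      - f (x + h *\<^sub>R w) - (f (x + h *\<^sub>R v) - f x)) \<bullet> b = h * h * ?A w v z"
    by blast
  have "?F = h * h * ?A w v z"
    unfolding z(2)[symmetric] by (simp add: inner_diff_left add.commute add.left_commute)
  with y h have "?A v w y = ?A w v z" by simp
  moreover have "dist y x < r" "dist z x < r"
    using y(1) z(1) h(2) by (simp_all add: dist_commute add.commute)
  ultimately show False using r(2)[of y] r(2)[of z] XY(5) by auto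
qed

section \<open>Product rules for bilinear expressions with a moving base point\<close>

lemma bilinear_basis_expansion:
  fixes B :: "'a::euclidean_space \<Rightarrow> 'b::euclidean_space \<Rightarrow> 'c::real_vector"
  assumes "bilinear B"
  shows "B v w = (\<Sum>i\<in>Basis. \<Sum>j\<in>Basis. ((v \<bullet> i) * (w \<bullet> j)) *\<^sub>R B i j)"
proof -
  have "B v w = B (\<Sum>i\<in>Basis. (v \<bullet> i) *\<^sub>R i) (\<Sum>j\<in>Basis. (w \<bullet> j) *\<^sub>R j)"
    by (simp add: euclidean_representation)
  also have "\<dots> = (\<Sum>(i,j)\<in>Basis \<times> Basis. B ((v \<bullet> i) *\<^sub>R i) ((w \<bullet> j) *\<^sub>R j))"
    using bilinear_sum[OF assms] by (metis finite_Basis)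
  also have "\<dots> = (\<Sum>i\<in>Basis. \<Sum>j\<in>Basis. ((v \<bullet> i) * (w \<bullet> j)) *\<^sub>R B i j)"
    by (simp add: sum.cartesian_product bilinear_lmul[OF assms] bilinear_rmul[OF assms]
        mult.commute)
  finally show ?thesis .
qed

lemma bilinear_family_fderiv:
  fixes B :: "'x::euclidean_space \<Rightarrow> 'a::euclidean_space \<Rightarrow> 'b::euclidean_space \<Rightarrow> 'c::euclidean_space"
  assumes S: "open S" "x \<in> S" and B: "\<And>y. y \<in> S \<Longrightarrow> bilinear (B y)"
    and d: "\<And>v w. (\<lambda>y. B y v w) differentiable (at x)"
  shows "bilinear (\<lambda>v w. fderiv (\<lambda>y. B y v w) x h)"
proof -
  have D: "((\<lambda>y. B y v w) has_derivative fderiv (\<lambda>y. B y v w) x) (at x)" for v w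
    using d frechet_derivative_works by blast
  have T: "fderiv (\<lambda>y. B y v w) x h = F h"
    if "(f has_derivative F) (at x)" "\<And>y. y \<in> S \<Longrightarrow> f y = B y v w" for f F v w
    using has_derivative_transform_within_open[OF that(1) S that(2)] fderiv_eqI by metis
  show ?thesis
    unfolding bilinear_def
  proof (intro conjI allI linearI)
    fix v w1 w2 show "fderiv (\<lambda>y. B y v (w1 + w2)) x h
      = fderiv (\<lambda>y. B y v w1) x h + fderiv (\<lambda>y. B y v w2) x h"
      by (rule T[OF has_derivative_add[OF D D]]) (simp add: bilinear_radd[OF B])
  next
    fix w v1 v2 show "fderiv (\<lambda>y. B y (v1 + v2) w) x h
      = fderiv (\<lambda>y. B y v1 w) x h + fderiv (\<lambda>y. B y v2 w) x h"
      by (rule T[OF has_derivative_add[OF D D]]) (simp add: bilinear_ladd[OF B])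
  next
    fix r v w show "fderiv (\<lambda>y. B y v (r *\<^sub>R w)) x h = r *\<^sub>R fderiv (\<lambda>y. B y v w) x h"
      by (rule T[OF has_derivative_scaleR_right[OF D]]) (simp add: bilinear_rmul[OF B])
  next
    fix r v w show "fderiv (\<lambda>y. B y (r *\<^sub>R v) w) x h = r *\<^sub>R fderiv (\<lambda>y. B y v w) x h"
      by (rule T[OF has_derivative_scaleR_right[OF D]]) (simp add: bilinear_lmul[OF B])
  qed
qed

text \<open>B is known to be differentiable in its base point only for fixed vectors v and w.
  Expanding a s and b s in the basis gives a finite sum of products of real functions with the
  curves B (p s) i j, to which the ordinary product rule applies, so this separate differentiability
  suffices.\<close>

lemma has_derivative_bilinear_family:
  fixes B :: "'x::euclidean_space \<Rightarrow> 'a::euclidean_space \<Rightarrow> 'b::euclidean_space \<Rightarrow> 'c::euclidean_space"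
    and t :: "'t::real_normed_vector"
  assumes S: "open S" "p t \<in> S" and t: "t \<in> T" and B: "\<And>y. y \<in> S \<Longrightarrow> bilinear (B y)"
    and d: "\<And>v w. (\<lambda>y. B y v w) differentiable (at (p t))"
    and p: "(p has_derivative p') (at t within T)"
    and a: "(a has_derivative a') (at t within T)"
    and b: "(b has_derivative b') (at t within T)"
  shows "((\<lambda>s. B (p s) (a s) (b s)) has_derivative
    (\<lambda>h. fderiv (\<lambda>y. B y (a t) (b t)) (p t) (p' h) + B (p t) (a' h) (b t) + B (p t) (a t) (b' h)))
    (at t within T)"
proof -
  let ?E = "\<lambda>s. \<Sum>i\<in>Basis. \<Sum>j\<in>Basis. ((a s \<bullet> i) * (b s \<bullet> j)) *\<^sub>R B (p s) i j"
  have D: "((\<lambda>s. B (p s) v w) has_derivative (\<lambda>h. fderiv (\<lambda>y. B y v w) (p t) (p' h)))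
      (at t within T)" for v w
    using has_derivative_compose[OF p] d frechet_derivative_works by blast
  have F: "fderiv (\<lambda>y. B y (a t) (b t)) (p t) h = (\<Sum>i\<in>Basis. \<Sum>j\<in>Basis.
      ((a t \<bullet> i) * (b t \<bullet> j)) *\<^sub>R fderiv (\<lambda>y. B y i j) (p t) h)" for h
    by (rule bilinear_basis_expansion[OF bilinear_family_fderiv[OF S B d]])
  have "(?E has_derivative (\<lambda>h. \<Sum>i\<in>Basis. \<Sum>j\<in>Basis.
     ((a t \<bullet> i) * (b t \<bullet> j)) *\<^sub>R fderiv (\<lambda>y. B y i j) (p t) (p' h)
     + ((a t \<bullet> i) * (b' h \<bullet> j) + (a' h \<bullet> i) * (b t \<bullet> j)) *\<^sub>R B (p t) i j)) (at t within T)"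
    by (intro has_derivative_sum has_derivative_scaleR has_derivative_mult
        has_derivative_inner_left a b D)
  also have "(\<lambda>h. \<Sum>i\<in>Basis. \<Sum>j\<in>Basis.
     ((a t \<bullet> i) * (b t \<bullet> j)) *\<^sub>R fderiv (\<lambda>y. B y i j) (p t) (p' h)
     + ((a t \<bullet> i) * (b' h \<bullet> j) + (a' h \<bullet> i) * (b t \<bullet> j)) *\<^sub>R B (p t) i j)
    = (\<lambda>h. fderiv (\<lambda>y. B y (a t) (b t)) (p t) (p' h) + B (p t) (a' h) (b t) + B (p t) (a t) (b' h))"
    unfolding F bilinear_basis_expansion[OF B[OF S(2)], of "a _" "b' _"]
      bilinear_basis_expansion[OF B[OF S(2)], of "a' _" "b _"]
    by (rule ext) (simp add: sum.distrib scaleR_add_left)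
  finally have E: "(?E has_derivative
    (\<lambda>h. fderiv (\<lambda>y. B y (a t) (b t)) (p t) (p' h) + B (p t) (a' h) (b t) + B (p t) (a t) (b' h)))
    (at t within T)" .
  have ev: "\<forall>\<^sub>F s in at t within T. p s \<in> S"
    using has_derivative_continuous[OF p] S
    by (simp add: continuous_within topological_tendstoD)
  have "\<forall>\<^sub>F s in at t within T. ?E s = B (p s) (a s) (b s)"
    using ev by eventually_elim (rule bilinear_basis_expansion[OF B, symmetric])
  moreover have "?E t = B (p t) (a t) (b t)"
    by (rule bilinear_basis_expansion[OF B[OF S(2)], symmetric])
  ultimately show ?thesis
    by (rule has_derivative_transform_eventually[OF E _ _ t])
qed

section \<open>Metrics, Christoffel symbols and Killing fields in a coordinate domain\<close>

text \<open>Reduced to the bilinear rule by adjoining a real factor: L becomes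
  \<open>\<lambda>v r. r *\<^sub>R L y v\<close>, and the second argument is held at 1.\<close>

lemma has_derivative_linear_family:
  fixes L :: "'x::euclidean_space \<Rightarrow> 'a::euclidean_space \<Rightarrow> 'c::euclidean_space"
    and t :: "'t::real_normed_vector"
  assumes S: "open S" "p t \<in> S" and t: "t \<in> T" and L: "\<And>y. y \<in> S \<Longrightarrow> linear (L y)"
    and d: "\<And>v. (\<lambda>y. L y v) differentiable (at (p t))"
    and p: "(p has_derivative p') (at t within T)"
    and a: "(a has_derivative a') (at t within T)"
  shows "((\<lambda>s. L (p s) (a s)) has_derivative
    (\<lambda>h. fderiv (\<lambda>y. L y (a t)) (p t) (p' h) + L (p t) (a' h))) (at t within T)"
proof -
  have B: "bilinear (\<lambda>v (r::real). r *\<^sub>R L y v)" if "y \<in> S" for y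
    using L[OF that] unfolding bilinear_def
    by (auto intro!: linearI simp: linear_add linear_cmul scaleR_add_left algebra_simps)
  have "((\<lambda>s. (1::real) *\<^sub>R L (p s) (a s)) has_derivative
    (\<lambda>h. fderiv (\<lambda>y. 1 *\<^sub>R L y (a t)) (p t) (p' h) + 1 *\<^sub>R L (p t) (a' h) + 0 *\<^sub>R L (p t) (a t)))
    (at t within T)"
    by (rule has_derivative_bilinear_family[OF S t B _ p a has_derivative_const])
       (auto intro!: d derivative_intros)
  then show ?thesis by simp
qed

text \<open>Positivity makes y \<mapsto> B y injective, hence surjective onto the linear forms by
  finite dimension. \<open>T y\<close> is the vector representing the form B y in the Euclidean
  inner product.\<close>

lemma bilinear_form_riesz:
  fixes B :: "'e::euclidean_space \<Rightarrow> 'e \<Rightarrow> real"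
  assumes B: "bilinear B" and pos: "\<And>v. v \<noteq> 0 \<Longrightarrow> B v v > 0" and f: "linear f"
  shows "\<exists>y. \<forall>z. B y z = f z"
proof -
  define T where "T y = (\<Sum>b\<in>Basis. B y b *\<^sub>R b)" for y
  have lin: "linear (\<lambda>z. B y z)" for y using B by (simp add: bilinear_def)
  have rep: "h z = (\<Sum>b\<in>Basis. h b *\<^sub>R b) \<bullet> z" if "linear h" for h :: "'e \<Rightarrow> real" and z
  proof -
    have "h z = h (\<Sum>b\<in>Basis. (z \<bullet> b) *\<^sub>R b)" by (simp add: euclidean_representation)
    also have "\<dots> = (\<Sum>b\<in>Basis. (z \<bullet> b) * h b)"
      using that by (simp add: linear_sum linear_cmul)
    also have "\<dots> = (\<Sum>b\<in>Basis. h b *\<^sub>R b) \<bullet> z"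
      by (simp add: inner_sum_left inner_commute[of z] mult.commute)
    finally show ?thesis .
  qed
  have T: "T y \<bullet> z = B y z" for y z
    unfolding T_def by (rule rep[OF lin, symmetric])
  have "linear T"
    by (rule linearI; rule euclidean_eqI)
       (simp_all add: T inner_add_left bilinear_ladd[OF B] bilinear_lmul[OF B])
  moreover have "inj T"
    unfolding linear_injective_0[OF \<open>linear T\<close>]
    using T pos by (metis inner_zero_left less_irrefl)
  ultimately have "surj T" by (rule linear_inj_imp_surj)
  then obtain y where "T y = (\<Sum>b\<in>Basis. f b *\<^sub>R b)" by (metis surjD)
  then show ?thesis using T rep[OF f] by metis
qed

section \<open>Levi-Civita symbols of a metric in coordinates\<close>

abbreviation hess :: "('e::euclidean_space \<Rightarrow> 'f::euclidean_space) \<Rightarrow> 'e \<Rightarrow> 'e \<Rightarrow> 'e \<Rightarrow> 'f" where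
  "hess f x v w \<equiv> fderiv (\<lambda>x. fderiv f x v) x w"

text \<open>The formula of \<open>christoffel\<close> for an arbitrary metric on an open set, so
  that the local theory mentions neither charts nor atlases; \<open>christoffel_levi_civita\<close>
  identifies the two.\<close>

definition levi_civita ::
  "('e::euclidean_space \<Rightarrow> 'e \<Rightarrow> 'e \<Rightarrow> real) \<Rightarrow> 'e \<Rightarrow> 'e \<Rightarrow> 'e \<Rightarrow> 'e" where
  "levi_civita g x v w = (THE y. \<forall>z. g x y z =
     (fderiv (\<lambda>x. g x w z) x v + fderiv (\<lambda>x. g x v z) x w - fderiv (\<lambda>x. g x v w) x z) / 2)"

locale coord_metric =
  fixes U :: "'e::euclidean_space set" and g :: "'e \<Rightarrow> 'e \<Rightarrow> 'e \<Rightarrow> real"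
  assumes open_U: "open U"
    and bil: "x \<in> U \<Longrightarrow> bilinear (g x)"
    and sym: "x \<in> U \<Longrightarrow> g x v w = g x w v"
    and pos: "x \<in> U \<Longrightarrow> v \<noteq> 0 \<Longrightarrow> g x v v > 0"
    and smooth: "smooth_on (\<lambda>x. g x v w) U"
begin

abbreviation dg :: "'e \<Rightarrow> 'e \<Rightarrow> 'e \<Rightarrow> 'e \<Rightarrow> real" where
  "dg x h v w \<equiv> fderiv (\<lambda>x. g x v w) x h"

abbreviation \<Gamma> where "\<Gamma> \<equiv> levi_civita g"

lemma g_differentiable: "x \<in> U \<Longrightarrow> (\<lambda>x. g x v w) differentiable (at x)"
  using smooth_on_has_derivative[OF smooth] differentiableI by blast

lemma dg_differentiable: "x \<in> U \<Longrightarrow> (\<lambda>x. dg x h v w) differentiable (at x)"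
  using smooth_on_has_derivative[OF smooth_on_fderiv[OF smooth]] differentiableI by blast

lemma dg_linear: "x \<in> U \<Longrightarrow> linear (\<lambda>h. dg x h v w)"
  by (rule smooth_on_linear_fderiv[OF smooth])

lemma dg_bilinear: "x \<in> U \<Longrightarrow> bilinear (\<lambda>v w. dg x h v w)"
  by (rule bilinear_family_fderiv[OF open_U _ bil g_differentiable])

lemma dg_sym: "x \<in> U \<Longrightarrow> dg x h v w = dg x h w v"
  using frechet_derivative_transform_within_open[OF g_differentiable open_U _ sym] by metis

lemma g_nondegenerate:
  assumes "x \<in> U" "\<And>z. g x y z = g x y' z"
  shows "y = y'"
proof (rule ccontr)
  assume "y \<noteq> y'"
  then have "g x (y - y') (y - y') > 0" using pos[OF assms(1)] by simp
  moreover have "g x (y - y') (y - y') = 0"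
    using assms(2) by (simp add: bilinear_lsub[OF bil[OF assms(1)]])
  ultimately show False by simp
qed

lemmas g_simps = bilinear_ladd[OF bil] bilinear_lmul[OF bil] bilinear_radd[OF bil]
  bilinear_rmul[OF bil] bilinear_lsub[OF bil] bilinear_rsub[OF bil] bilinear_lneg[OF bil]
  bilinear_rneg[OF bil] bilinear_lzero[OF bil] bilinear_rzero[OF bil]

lemmas dg_simps = bilinear_ladd[OF dg_bilinear] bilinear_lmul[OF dg_bilinear]
  bilinear_radd[OF dg_bilinear] bilinear_rmul[OF dg_bilinear]
  linear_add[OF dg_linear] linear_cmul[OF dg_linear]

text \<open>For fixed v and w the right-hand side is linear in z, so it is represented by some
  vector, and nondegeneracy makes that vector unique. This gives meaning to the \<open>THE\<close>
  in \<open>levi_civita\<close>.\<close>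

lemma koszul:
  assumes x: "x \<in> U"
  shows "g x (\<Gamma> x v w) z = (dg x v w z + dg x w v z - dg x z v w) / 2"
proof -
  let ?f = "\<lambda>z. (dg x v w z + dg x w v z - dg x z v w) / 2"
  have "linear ?f"
    by (rule linearI) (simp_all add: dg_simps[OF x] field_simps)
  then obtain y where y: "\<forall>z. g x y z = ?f z"
    using bilinear_form_riesz[OF bil[OF x] pos[OF x]] by blast
  have "\<forall>z. g x (\<Gamma> x v w) z = ?f z"
    unfolding levi_civita_def
  proof (rule theI[where P = "\<lambda>y. \<forall>z. g x y z = ?f z", OF y])
    fix y' assume y': "\<forall>z. g x y' z = ?f z"
    show "y' = y"
      by (rule g_nondegenerate[OF x]) (simp only: y[rule_format] y'[rule_format])
  qed
  then show ?thesis by (rule spec)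
qed

lemma \<Gamma>_eqI:
  assumes "x \<in> U" "\<And>z. g x y z = (dg x v w z + dg x w v z - dg x z v w) / 2"
  shows "\<Gamma> x v w = y"
  by (rule g_nondegenerate[OF assms(1)]) (simp only: koszul[OF assms(1)] assms(2))

lemma \<Gamma>_sym: "x \<in> U \<Longrightarrow> \<Gamma> x v w = \<Gamma> x w v"
  by (rule \<Gamma>_eqI) (simp_all add: koszul dg_sym[where v = v and w = w])

lemma \<Gamma>_bilinear:
  assumes x: "x \<in> U"
  shows "bilinear (\<Gamma> x)"
  unfolding bilinear_def
proof (intro conjI allI linearI)
  show "\<Gamma> x v (w1 + w2) = \<Gamma> x v w1 + \<Gamma> x v w2" for v w1 w2
    by (rule \<Gamma>_eqI[OF x]) (simp add: koszul[OF x] g_simps[OF x] dg_simps[OF x] field_simps)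
  show "\<Gamma> x (v1 + v2) w = \<Gamma> x v1 w + \<Gamma> x v2 w" for w v1 v2
    by (rule \<Gamma>_eqI[OF x]) (simp add: koszul[OF x] g_simps[OF x] dg_simps[OF x] field_simps)
  show "\<Gamma> x v (r *\<^sub>R w) = r *\<^sub>R \<Gamma> x v w" for r v w
    by (rule \<Gamma>_eqI[OF x]) (simp add: koszul[OF x] g_simps[OF x] dg_simps[OF x] field_simps)
  show "\<Gamma> x (r *\<^sub>R v) w = r *\<^sub>R \<Gamma> x v w" for r v w
    by (rule \<Gamma>_eqI[OF x]) (simp add: koszul[OF x] g_simps[OF x] dg_simps[OF x] field_simps)
qed

lemmas \<Gamma>_simps = bilinear_ladd[OF \<Gamma>_bilinear] bilinear_lmul[OF \<Gamma>_bilinear]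
  bilinear_radd[OF \<Gamma>_bilinear] bilinear_rmul[OF \<Gamma>_bilinear] bilinear_lneg[OF \<Gamma>_bilinear]
  bilinear_rneg[OF \<Gamma>_bilinear] bilinear_lsub[OF \<Gamma>_bilinear] bilinear_rsub[OF \<Gamma>_bilinear]

text \<open>Implicit function argument: \<open>(x, y) \<mapsto> (x, g x y)\<close> has an invertible derivative.\<close>

lemma riesz_solution_differentiable:
  fixes q :: "'e \<Rightarrow> 'e \<Rightarrow> real"
  assumes x: "x \<in> U" and y: "\<And>x z. x \<in> U \<Longrightarrow> g x (y x) z = q x z"
    and q: "\<And>z. (\<lambda>x. q x z) differentiable (at x)"
  shows "y differentiable (at x)"
proof -
  define T where "T x y = (\<Sum>b\<in>Basis. g x y b *\<^sub>R b)" for x y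
  have T: "T x y \<bullet> b = g x y b" if "b \<in> Basis" for x y b
    unfolding T_def using that by (simp add: inner_sum_left inner_Basis if_distrib sum.delta' cong: if_cong)
  have T_inj: "v = w" if "z \<in> U" "T z v = T z w" for z v w
  proof (rule g_nondegenerate[OF that(1)])
    fix u
    have b: "g z v b = g z w b" if "b \<in> Basis" for b using T[OF that] \<open>T z v = T z w\<close> by metis
    have "g z a u = (\<Sum>b\<in>Basis. (u \<bullet> b) * g z a b)" for a
    proof -
      have l: "linear (g z a)" using bil[OF that(1)] by (simp add: bilinear_def)
      have "g z a u = g z a (\<Sum>b\<in>Basis. (u \<bullet> b) *\<^sub>R b)" by (simp add: euclidean_representation)
      then show ?thesis using l by (simp add: linear_sum linear_cmul)
    qed
    then show "g z v u = g z w u" using b by simp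
  qed
  have T_lin: "linear (T x)"
    by (rule linearI; rule euclidean_eqI) (simp_all add: T inner_add_left g_simps[OF x])
  have "inj (T x)" using T_inj[OF x] by (rule injI)
  with T_lin have "surj (T x)" by (rule linear_inj_imp_surj)
  then obtain R where R: "\<And>k. T x (R k) = k" unfolding surj_def by metis
  let ?\<Phi> = "\<lambda>(x, y). (x, T x y)"
  \<comment> \<open>On the image of \<open>?\<Phi>\<close> over U the chosen y is unique by
    \<open>T_inj\<close>, so there \<Psi> inverts \<open>?\<Phi>\<close>; elsewhere its value is
    arbitrary.\<close>
  define \<Psi> where "\<Psi> u = (fst u, SOME y. T (fst u) y = snd u)" for u
  let ?D = "\<lambda>h. \<Sum>b\<in>Basis. dg x h (y x) b *\<^sub>R b"
  let ?\<Phi>' = "\<lambda>(h, l). (h, ?D h + T x l)"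
  \<comment> \<open>Obtained by solving k = \<open>?D h + T x l\<close> for l, with R a right
    inverse of \<open>T x\<close>.\<close>
  let ?\<Psi>' = "\<lambda>(h, k). (h, R (k - ?D h))"
  have \<Phi>_der: "(?\<Phi> has_derivative
      (\<lambda>(h, l). (h, \<Sum>b\<in>Basis. (dg (fst u) h (snd u) b + g (fst u) l b) *\<^sub>R b))) (at u)"
    if u: "u \<in> U \<times> UNIV" for u
  proof -
    have "((\<lambda>u. g (fst u) (snd u) b) has_derivative
      (\<lambda>h. dg (fst u) (fst h) (snd u) b + g (fst u) (snd h) b + g (fst u) (snd u) 0)) (at u)" for b
      by (rule has_derivative_bilinear_family[OF open_U _ _ bil g_differentiable])
         (use u in \<open>auto intro!: derivative_eq_intros\<close>)
    then have "((\<lambda>u. g (fst u) (snd u) b) has_derivative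
      (\<lambda>h. dg (fst u) (fst h) (snd u) b + g (fst u) (snd h) b)) (at u)" for b
      using u by (auto simp: g_simps)
    then have "((\<lambda>u. (fst u, \<Sum>b\<in>Basis. g (fst u) (snd u) b *\<^sub>R b)) has_derivative
      (\<lambda>h. (fst h, \<Sum>b\<in>Basis. (dg (fst u) (fst h) (snd u) b + g (fst u) (snd h) b) *\<^sub>R b))) (at u)"
      by (intro has_derivative_Pair has_derivative_sum has_derivative_scaleR_left
          has_derivative_fst has_derivative_ident) auto
    then show ?thesis by (simp add: case_prod_unfold T_def)
  qed
  have \<Psi>\<Phi>: "\<Psi> (?\<Phi> u) = u" if uU: "u \<in> U \<times> UNIV" for u
  proof -
    obtain z v where u: "u = (z, v)" "z \<in> U" using uU by auto
    have "(SOME y. T z y = T z v) = v" by (rule some_equality) (use T_inj[OF u(2)] in blast)+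
    then show ?thesis by (simp add: \<Psi>_def u(1))
  qed
  have "(\<Psi> has_derivative ?\<Psi>') (at (?\<Phi> (x, y x)))"
  proof (rule has_derivative_inverse_strong[where f = ?\<Phi> and x = "(x, y x)"
        and S = "U \<times> UNIV" and f' = ?\<Phi>'])
    show "open (U \<times> UNIV :: ('e \<times> 'e) set)" by (simp add: open_Times open_U)
    show "(x, y x) \<in> U \<times> UNIV" using x by simp
    show "continuous_on (U \<times> UNIV) ?\<Phi>"
      by (rule continuous_at_imp_continuous_on) (blast intro: has_derivative_continuous[OF \<Phi>_der])
    show "\<And>u. u \<in> U \<times> UNIV \<Longrightarrow> \<Psi> (?\<Phi> u) = u" by (rule \<Psi>\<Phi>)
    show "(?\<Phi> has_derivative ?\<Phi>') (at (x, y x))"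
      using \<Phi>_der[of "(x, y x)"] x
      by (simp add: scaleR_add_left sum.distrib T_def[symmetric])
    show "?\<Phi>' \<circ> ?\<Psi>' = id"
      by (auto simp: fun_eq_iff R)
  qed
  then have \<Psi>_der: "(\<Psi> has_derivative ?\<Psi>') (at (x, T x (y x)))" by simp
  have Ty: "T z (y z) = (\<Sum>b\<in>Basis. q z b *\<^sub>R b)" if "z \<in> U" for z
    unfolding T_def using y[OF that] by simp
  have "((\<lambda>z. \<Sum>b\<in>Basis. q z b *\<^sub>R b) has_derivative
      (\<lambda>h. \<Sum>b\<in>Basis. fderiv (\<lambda>z. q z b) x h *\<^sub>R b)) (at x)"
    by (intro has_derivative_sum has_derivative_scaleR_left iffD1[OF frechet_derivative_works] q)
  then have "((\<lambda>z. T z (y z)) has_derivative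
      (\<lambda>h. \<Sum>b\<in>Basis. fderiv (\<lambda>z. q z b) x h *\<^sub>R b)) (at x)"
    by (rule has_derivative_transform_within_open[OF _ open_U x]) (simp add: Ty)
  from has_derivative_snd[OF has_derivative_compose[OF has_derivative_Pair[OF has_derivative_ident this] \<Psi>_der]]
  have "(\<lambda>z. snd (\<Psi> (z, T z (y z)))) differentiable (at x)" by (rule differentiableI)
  moreover have "snd (\<Psi> (z, T z (y z))) = y z" if "z \<in> U" for z
    using \<Psi>\<Phi>[of "(z, y z)"] that by simp
  ultimately show ?thesis
    unfolding differentiable_def using has_derivative_transform_within_open[OF _ open_U x] by blast
qed

text \<open>By \<open>koszul\<close>, \<Gamma> solves a Riesz problem whose right-hand side consists
  of first derivatives of g, and these are differentiable again. The curvature tensor involves this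
  derivative of \<Gamma>.\<close>

lemma \<Gamma>_differentiable:
  assumes x: "x \<in> U"
  shows "(\<lambda>x. \<Gamma> x v w) differentiable (at x)"
proof (rule riesz_solution_differentiable[where q = "\<lambda>x z. (dg x v w z + dg x w v z - dg x z v w) / 2",
      OF x koszul])
  show "(\<lambda>x. (dg x v w z + dg x w v z - dg x z v w) / 2) differentiable (at x)" for z
    by (intro differentiable_divide differentiable_add differentiable_diff dg_differentiable x
        differentiable_const) simp
qed

end

lemma smooth_on_differentiable: "smooth_on f S \<Longrightarrow> x \<in> S \<Longrightarrow> f differentiable (at x)"
  by (meson differentiableI smooth_on_has_derivative)

lemma smooth_on_hess_linear: "smooth_on f S \<Longrightarrow> x \<in> S \<Longrightarrow> linear (hess f x v)"
  by (rule smooth_on_linear_fderiv[OF smooth_on_fderiv])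

lemma smooth_on_fderiv_along:
  fixes f :: "'e::euclidean_space \<Rightarrow> 'f::euclidean_space" and t :: "'t::real_normed_vector"
  assumes f: "smooth_on f S" and S: "open S" "p t \<in> S" and t: "t \<in> T"
    and p: "(p has_derivative p') (at t within T)" and a: "(a has_derivative a') (at t within T)"
  shows "((\<lambda>s. fderiv f (p s) (a s)) has_derivative
    (\<lambda>h. hess f (p t) (a t) (p' h) + fderiv f (p t) (a' h))) (at t within T)"
  by (rule has_derivative_linear_family[OF S t smooth_on_linear_fderiv[OF f] _ p a])
     (auto intro: smooth_on_differentiable[OF smooth_on_fderiv[OF f] S(2)])

section \<open>Derivatives along curves and change of coordinates\<close>

context coord_metric begin

lemma coord_metric_subset: "open V \<Longrightarrow> V \<subseteq> U \<Longrightarrow> coord_metric V g"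
  using bil sym pos smooth smooth_on_subset[OF smooth]
  by (intro coord_metric.intro) (blast+)

lemma has_derivative_metric:
  fixes t :: "'t::real_normed_vector"
  assumes "p t \<in> U" "t \<in> T" "(p has_derivative p') (at t within T)"
    "(a has_derivative a') (at t within T)" "(b has_derivative b') (at t within T)"
  shows "((\<lambda>s. g (p s) (a s) (b s)) has_derivative
    (\<lambda>h. dg (p t) (p' h) (a t) (b t) + g (p t) (a' h) (b t) + g (p t) (a t) (b' h))) (at t within T)"
  by (rule has_derivative_bilinear_family[OF open_U assms(1,2) bil g_differentiable[OF assms(1)] assms(3-)])

lemma has_derivative_\<Gamma>:
  fixes t :: "'t::real_normed_vector"
  assumes "p t \<in> U" "t \<in> T" "(p has_derivative p') (at t within T)"
    "(a has_derivative a') (at t within T)" "(b has_derivative b') (at t within T)"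
  shows "((\<lambda>s. \<Gamma> (p s) (a s) (b s)) has_derivative
    (\<lambda>h. fderiv (\<lambda>y. \<Gamma> y (a t) (b t)) (p t) (p' h) + \<Gamma> (p t) (a' h) (b t) + \<Gamma> (p t) (a t) (b' h)))
    (at t within T)"
  by (rule has_derivative_bilinear_family[OF open_U assms(1,2) \<Gamma>_bilinear \<Gamma>_differentiable[OF assms(1)] assms(3-)])

text \<open>Inserting g as the pullback of g' into the Koszul formula produces six Hessian terms. By
  symmetry of g' and of the Hessian four of them cancel in pairs, and the two with
  \<open>hess \<phi> x v w\<close> add up. Surjectivity of the differential lets every test vector
  be written as \<open>?D z\<close>, so that nondegeneracy of g' applies.\<close>

lemma \<Gamma>_transform:
  assumes g': "coord_metric V g'" and \<phi>: "smooth_on \<phi> U" "\<And>x. x \<in> U \<Longrightarrow> \<phi> x \<in> V"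
    and iso: "\<And>x v w. x \<in> U \<Longrightarrow> g x v w = g' (\<phi> x) (fderiv \<phi> x v) (fderiv \<phi> x w)"
    and x: "x \<in> U" and surj: "surj (fderiv \<phi> x)"
  shows "fderiv \<phi> x (\<Gamma> x v w) = levi_civita g' (\<phi> x) (fderiv \<phi> x v) (fderiv \<phi> x w) + hess \<phi> x v w"
proof -
  interpret V: coord_metric V g' by (rule g')
  let ?D = "fderiv \<phi> x" and ?y = "\<phi> x"
  have dg: "dg x z v w = V.dg ?y (?D z) (?D v) (?D w)
      + g' ?y (hess \<phi> x v z) (?D w) + g' ?y (?D v) (hess \<phi> x w z)" for v w z
  proof -
    have "((\<lambda>x. g' (\<phi> x) (fderiv \<phi> x v) (fderiv \<phi> x w)) has_derivative
       (\<lambda>z. V.dg ?y (?D z) (?D v) (?D w) + g' ?y (hess \<phi> x v z) (?D w) + g' ?y (?D v) (hess \<phi> x w z)))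
       (at x)"
      by (rule V.has_derivative_metric)
         (auto intro!: \<phi>(2) x smooth_on_has_derivative[OF \<phi>(1)]
            smooth_on_has_derivative[OF smooth_on_fderiv[OF \<phi>(1)]])
    then have "((\<lambda>x. g x v w) has_derivative
       (\<lambda>z. V.dg ?y (?D z) (?D v) (?D w) + g' ?y (hess \<phi> x v z) (?D w) + g' ?y (?D v) (hess \<phi> x w z)))
       (at x)"
      by (rule has_derivative_transform_within_open[OF _ open_U x]) (simp add: iso)
    from fderiv_eqI[OF this] show ?thesis by (rule fun_cong)
  qed
  have yV: "?y \<in> V" by (rule \<phi>(2)[OF x])
  have hess_sym: "hess \<phi> x v w = hess \<phi> x w v" for v w
    by (rule fderiv_fderiv_commute[OF \<phi>(1) open_U x])
  have main: "g' ?y (?D (\<Gamma> x v w)) (?D z) = g' ?y (V.\<Gamma> ?y (?D v) (?D w) + hess \<phi> x v w) (?D z)" for z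
  proof -
    have "g' ?y (?D (\<Gamma> x v w)) (?D z) = (dg x v w z + dg x w v z - dg x z v w) / 2"
      by (simp only: iso[OF x, symmetric] koszul[OF x])
    also have "\<dots> = g' ?y (V.\<Gamma> ?y (?D v) (?D w)) (?D z) + g' ?y (hess \<phi> x v w) (?D z)"
      unfolding dg V.koszul[OF yV] hess_sym[of z v] hess_sym[of z w] hess_sym[of w v]
        V.sym[OF yV, of "?D _" "hess \<phi> x _ _"]
      by (simp add: field_simps)
    finally show ?thesis by (simp add: V.g_simps[OF yV])
  qed
  show ?thesis
  proof (rule V.g_nondegenerate[OF yV])
    fix u
    obtain z where "u = ?D z" using surj by (rule surjE)
    with main show "g' ?y (?D (\<Gamma> x v w)) u = g' ?y (V.\<Gamma> ?y (?D v) (?D w) + hess \<phi> x v w) u"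
      by simp
  qed
qed

end

text \<open>The assumption \<open>killing\<close> is L_K g = 0 evaluated on constant coordinate
  fields v and w, for which the Lie bracket [K, v] is minus the derivative of K in direction
  v.\<close>

locale killing_field = coord_metric +
  fixes K :: "'a::euclidean_space \<Rightarrow> 'a"
  assumes K_smooth: "smooth_on K U"
    and killing: "x \<in> U \<Longrightarrow> dg x (K x) v w + g x (fderiv K x v) w + g x v (fderiv K x w) = 0"
begin

abbreviation DK where "DK \<equiv> fderiv K"

lemma killing_derivative:
  assumes x: "x \<in> U"
  shows "fderiv (\<lambda>x. dg x (K x) v w) x z = - (g x (hess K x v z) w + g x v (hess K x w z)
    + dg x z (DK x v) w + dg x z v (DK x w))"
proof -
  have D: "(\<lambda>x. DK x v) differentiable (at x)" for v
    by (rule smooth_on_differentiable[OF smooth_on_fderiv[OF K_smooth] x])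
  have "((\<lambda>x. - (g x (DK x v) w + g x v (DK x w))) has_derivative
     (\<lambda>z. - ((dg x z (DK x v) w + g x (hess K x v z) w + g x (DK x v) 0)
       + (dg x z v (DK x w) + g x 0 (DK x w) + g x v (hess K x w z))))) (at x)"
    by (intro has_derivative_minus has_derivative_add has_derivative_metric has_derivative_ident
        has_derivative_const x UNIV_I iffD1[OF frechet_derivative_works] D)
  then have "((\<lambda>x. dg x (K x) v w) has_derivative
     (\<lambda>z. - ((dg x z (DK x v) w + g x (hess K x v z) w + g x (DK x v) 0)
       + (dg x z v (DK x w) + g x 0 (DK x w) + g x v (hess K x w z))))) (at x)"
    by (rule has_derivative_transform_within_open[OF _ open_U x]) (use killing[of _ v w] in force)
  from fderiv_eqI[OF this] show ?thesis by (simp add: g_simps[OF x])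
qed

text \<open>\<open>killing_derivative\<close> and the chain rule give two expressions for the
  z-derivative of \<open>dg x (K x) v w\<close>. Commuting the second derivatives of g turns one of
  them into the derivative along K of the first derivatives of g, which is what differentiating the
  Koszul formula along K calls for.\<close>

lemma killing_second_order:
  assumes x: "x \<in> U"
  shows "fderiv (\<lambda>x. dg x z v w) x (K x) + dg x (DK x z) v w = - (g x (hess K x v z) w + g x v (hess K x w z)
    + dg x z (DK x v) w + dg x z v (DK x w))"
proof -
  have "((\<lambda>x. dg x (K x) v w) has_derivative
     (\<lambda>z. hess (\<lambda>x. g x v w) x (K x) z + dg x (DK x z) v w)) (at x)"
    by (rule smooth_on_fderiv_along[where p = "\<lambda>x. x", OF smooth open_U x])
       (auto intro!: smooth_on_has_derivative[OF K_smooth x])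
  from fderiv_eqI[OF this] killing_derivative[OF x, of v w z]
  show ?thesis by (simp add: fderiv_fderiv_commute[OF smooth open_U x, where v = z])
qed

text \<open>This is L_K \<Gamma> = 0: an infinitesimal isometry preserves the Levi-Civita
  connection. After pairing with z, both sides of the Koszul formula are differentiated along K;
  \<open>killing\<close> eliminates the derivative of g, and three index permutations of
  \<open>killing_second_order\<close> eliminate the derivatives of \<open>dg\<close>.\<close>

lemma killing_affine:
  assumes x: "x \<in> U"
  shows "fderiv (\<lambda>x. \<Gamma> x v w) x (K x) =
    DK x (\<Gamma> x v w) - hess K x v w - \<Gamma> x (DK x v) w - \<Gamma> x v (DK x w)"
proof (rule g_nondegenerate[OF x])
  fix z
  note d = smooth_on_differentiable[OF smooth_on_fderiv[OF smooth] x]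
  have "((\<lambda>x. g x (\<Gamma> x v w) z) has_derivative (\<lambda>h. dg x h (\<Gamma> x v w) z
      + g x (fderiv (\<lambda>x. \<Gamma> x v w) x h) z + g x (\<Gamma> x v w) 0)) (at x)"
    by (rule has_derivative_metric)
       (auto intro!: x iffD1[OF frechet_derivative_works] \<Gamma>_differentiable)
  moreover have "((\<lambda>x. g x (\<Gamma> x v w) z) has_derivative
      (\<lambda>h. (hess (\<lambda>x. g x w z) x v h + hess (\<lambda>x. g x v z) x w h - hess (\<lambda>x. g x v w) x z h) / 2)) (at x)"
  proof (rule has_derivative_transform_within_open[OF _ open_U x])
    show "((\<lambda>x. (dg x v w z + dg x w v z - dg x z v w) / 2) has_derivative
      (\<lambda>h. (hess (\<lambda>x. g x w z) x v h + hess (\<lambda>x. g x v z) x w h - hess (\<lambda>x. g x v w) x z h) / 2)) (at x)"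
      unfolding divide_inverse
      by (intro has_derivative_mult_left has_derivative_add has_derivative_diff
          iffD1[OF frechet_derivative_works] d)
  qed (simp add: koszul)
  ultimately have "dg x (K x) (\<Gamma> x v w) z + g x (fderiv (\<lambda>x. \<Gamma> x v w) x (K x)) z + g x (\<Gamma> x v w) 0
    = (hess (\<lambda>x. g x w z) x v (K x) + hess (\<lambda>x. g x v z) x w (K x) - hess (\<lambda>x. g x v w) x z (K x)) / 2"
    using has_derivative_unique by (metis (no_types, lifting))
  moreover have "g x (\<Gamma> x v w) 0 = 0" by (rule g_simps[OF x])
  ultimately have 1: "g x (fderiv (\<lambda>x. \<Gamma> x v w) x (K x)) z =
      (hess (\<lambda>x. g x w z) x v (K x) + hess (\<lambda>x. g x v z) x w (K x) - hess (\<lambda>x. g x v w) x z (K x)) / 2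
      + g x (DK x (\<Gamma> x v w)) z + g x (\<Gamma> x v w) (DK x z)"
    using killing[OF x, of "\<Gamma> x v w" z] by linarith
  have hess_sym: "hess K x v w = hess K x w v" for v w
    by (rule fderiv_fderiv_commute[OF K_smooth open_U x])
  show "g x (fderiv (\<lambda>x. \<Gamma> x v w) x (K x)) z =
    g x (DK x (\<Gamma> x v w) - hess K x v w - \<Gamma> x (DK x v) w - \<Gamma> x v (DK x w)) z"
    unfolding 1 g_simps[OF x] koszul[OF x]
    using killing_second_order[OF x, where z = z and v = v and w = w]
      killing_second_order[OF x, where z = v and v = w and w = z]
      killing_second_order[OF x, where z = w and v = v and w = z]
      sym[OF x, of w "hess K x z v"] hess_sym[of z v] hess_sym[of z w] hess_sym[of w v]
    by (simp add: field_simps)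
qed

text \<open>With v = q t, the Koszul formula makes g(\<Gamma>(v, v), K) equal to \<open>dg\<close>
  in direction v on (v, K) minus half of \<open>dg\<close> in direction K on (v, v). The derivative
  of the momentum is therefore half of the left-hand side of \<open>killing\<close> on the pair (v,
  v).\<close>

lemma geodesic_momentum_derivative:
  assumes t: "p t \<in> U" "t \<in> T" and p: "(p has_vector_derivative q t) (at t within T)"
    and q: "(q has_vector_derivative - \<Gamma> (p t) (q t) (q t)) (at t within T)"
  shows "((\<lambda>s. g (p s) (q s) (K (p s))) has_vector_derivative 0) (at t within T)"
proof -
  let ?x = "p t" and ?v = "q t"
  note x = t(1)
  note Kp = has_derivative_compose[OF p[unfolded has_vector_derivative_def]
      smooth_on_has_derivative[OF K_smooth x]]
  have "((\<lambda>s. g (p s) (q s) (K (p s))) has_derivative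
    (\<lambda>h. dg ?x (h *\<^sub>R ?v) ?v (K ?x) + g ?x (h *\<^sub>R (- \<Gamma> ?x ?v ?v)) (K ?x) + g ?x ?v (DK ?x (h *\<^sub>R ?v))))
    (at t within T)"
    by (rule has_derivative_metric[where p = p and t = t and T = T, OF t]) (use p q Kp in \<open>simp_all add: has_vector_derivative_def\<close>)
  moreover have "dg ?x (h *\<^sub>R ?v) ?v (K ?x) + g ?x (h *\<^sub>R (- \<Gamma> ?x ?v ?v)) (K ?x) + g ?x ?v (DK ?x (h *\<^sub>R ?v)) = 0"
    for h
  proof -
    have "dg ?x (h *\<^sub>R ?v) ?v (K ?x) + g ?x (h *\<^sub>R (- \<Gamma> ?x ?v ?v)) (K ?x) + g ?x ?v (DK ?x (h *\<^sub>R ?v))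
      = h * (dg ?x ?v ?v (K ?x) - g ?x (\<Gamma> ?x ?v ?v) (K ?x) + g ?x ?v (DK ?x ?v))"
      using linear_cmul[OF smooth_on_linear_fderiv[OF K_smooth x], of h ?v]
      by (simp add: g_simps[OF x] linear_cmul[OF dg_linear[OF x]] algebra_simps)
    moreover have "dg ?x ?v ?v (K ?x) - g ?x (\<Gamma> ?x ?v ?v) (K ?x) + g ?x ?v (DK ?x ?v) = 0"
      unfolding koszul[OF x]
      using killing[OF x, of ?v ?v] sym[OF x, of ?v "DK ?x ?v"] by (simp add: field_simps)
    ultimately show ?thesis by simp
  qed
  ultimately show ?thesis by (simp add: has_vector_derivative_def)
qed

lemma killing_along_curve:
  assumes "p t \<in> U" "(p has_vector_derivative q) (at t within T)"
  shows "((\<lambda>s. K (p s)) has_vector_derivative DK (p t) q) (at t within T)"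
  using has_derivative_compose[OF assms(2)[unfolded has_vector_derivative_def]
      smooth_on_has_derivative[OF K_smooth assms(1)]]
    linear_cmul[OF smooth_on_linear_fderiv[OF K_smooth assms(1)]]
  by (simp add: has_vector_derivative_def)

text \<open>W is the covariant derivative of K along p, and the bracket after
  \<open>\<Gamma> (p t) (q t) (W t)\<close> is R(K, q)q in the convention of
  \<open>curvature_coords\<close>; so the covariant derivative of W is - R(K, q)q. Differentiating W
  produces the Hessian of K, which \<open>killing_affine\<close> trades for the derivative of
  \<Gamma> along K.\<close>

lemma killing_jacobi:
  assumes t: "p t \<in> U" "t \<in> T" and p: "(p has_vector_derivative q t) (at t within T)"
    and q: "(q has_vector_derivative - \<Gamma> (p t) (q t) (q t)) (at t within T)"
  defines "W \<equiv> \<lambda>s. DK (p s) (q s) + \<Gamma> (p s) (q s) (K (p s))"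
  shows "(W has_vector_derivative - (\<Gamma> (p t) (q t) (W t)
    + (fderiv (\<lambda>x. \<Gamma> x (q t) (q t)) (p t) (K (p t)) - fderiv (\<lambda>x. \<Gamma> x (K (p t)) (q t)) (p t) (q t)
     + \<Gamma> (p t) (K (p t)) (\<Gamma> (p t) (q t) (q t)) - \<Gamma> (p t) (q t) (\<Gamma> (p t) (K (p t)) (q t)))))
    (at t within T)"
proof -
  let ?x = "p t" and ?v = "q t" and ?k = "K (p t)"
  note x = t(1)
  note p' = p[unfolded has_vector_derivative_def] and q' = q[unfolded has_vector_derivative_def]
  note Kp = killing_along_curve[OF x p, unfolded has_vector_derivative_def]
  have "(W has_derivative (\<lambda>h. hess K ?x ?v (h *\<^sub>R ?v) + DK ?x (h *\<^sub>R - \<Gamma> ?x ?v ?v)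
     + (fderiv (\<lambda>y. \<Gamma> y ?v ?k) ?x (h *\<^sub>R ?v) + \<Gamma> ?x (h *\<^sub>R - \<Gamma> ?x ?v ?v) ?k
     + \<Gamma> ?x ?v (h *\<^sub>R DK ?x ?v)))) (at t within T)"
    unfolding W_def
    by (intro has_derivative_add smooth_on_fderiv_along[where p = p and t = t, OF K_smooth open_U t p' q']
        has_derivative_\<Gamma>[where p = p and t = t, OF t p' q' Kp])
  moreover have "fderiv (\<lambda>y. \<Gamma> y ?v ?k) ?x = fderiv (\<lambda>y. \<Gamma> y ?k ?v) ?x"
    using frechet_derivative_transform_within_open[OF \<Gamma>_differentiable[OF x] open_U x \<Gamma>_sym] by blast
  moreover have "linear (fderiv (\<lambda>y. \<Gamma> y ?k ?v) ?x)"
    by (rule linear_frechet_derivative[OF \<Gamma>_differentiable[OF x]])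
  moreover note linear_cmul[OF smooth_on_linear_fderiv[OF K_smooth x]]
    linear_cmul[OF smooth_on_hess_linear[OF K_smooth x]]
    linear_neg[OF smooth_on_linear_fderiv[OF K_smooth x]]
  ultimately have "(W has_derivative (\<lambda>h. h *\<^sub>R (hess K ?x ?v ?v - DK ?x (\<Gamma> ?x ?v ?v)
     + fderiv (\<lambda>y. \<Gamma> y ?k ?v) ?x ?v - \<Gamma> ?x (\<Gamma> ?x ?v ?v) ?k + \<Gamma> ?x ?v (DK ?x ?v)))) (at t within T)"
    by (simp add: linear_cmul \<Gamma>_simps[OF x] algebra_simps)
  moreover have "hess K ?x ?v ?v - DK ?x (\<Gamma> ?x ?v ?v)
     + fderiv (\<lambda>y. \<Gamma> y ?k ?v) ?x ?v - \<Gamma> ?x (\<Gamma> ?x ?v ?v) ?k + \<Gamma> ?x ?v (DK ?x ?v)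
    = - (\<Gamma> ?x ?v (W t) + (fderiv (\<lambda>x. \<Gamma> x ?v ?v) ?x ?k - fderiv (\<lambda>x. \<Gamma> x ?k ?v) ?x ?v
     + \<Gamma> ?x ?k (\<Gamma> ?x ?v ?v) - \<Gamma> ?x ?v (\<Gamma> ?x ?k ?v)))"
    unfolding W_def killing_affine[OF x]
    using \<Gamma>_sym[OF x, of ?k] \<Gamma>_sym[OF x, of "DK ?x ?v"]
    by (simp add: \<Gamma>_simps[OF x] algebra_simps)
  ultimately show ?thesis by (simp add: has_vector_derivative_def)
qed

end

text \<open>m is a smooth family of local isometries, equal to the identity on U at the parameter
  y0, and its parameter derivative in direction \<xi> is an infinitesimal generator. The Killing
  equation is the derivative at s = 0 of the isometry relation along
  \<open>y0 + s *\<^sub>R \<xi>\<close>, so a family with any Euclidean parameter serves in place of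
  a flow.\<close>

lemma (in coord_metric) killing_field_of_isometries:
  fixes m :: "'f::euclidean_space \<times> 'e \<Rightarrow> 'e"
  assumes m: "smooth_on m W" and W: "open W"
    and m0: "\<And>z. z \<in> U \<Longrightarrow> (y0, z) \<in> W \<and> m (y0, z) = z"
    and iso: "\<And>y z v w. (y, z) \<in> W \<Longrightarrow> z \<in> U \<Longrightarrow>
      g (m (y, z)) (fderiv m (y, z) (0, v)) (fderiv m (y, z) (0, w)) = g z v w"
  shows "killing_field U g (\<lambda>z. fderiv m (y0, z) (\<xi>, 0))"
proof unfold_locales
  have slice: "((\<lambda>z. f (y0, z)) has_derivative (\<lambda>v. fderiv f (y0, z) (0, v))) (at z)"
    if "smooth_on f W" "z \<in> U" for f :: "'f \<times> 'e \<Rightarrow> 'e" and z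
  proof (rule has_derivative_compose[where f = "\<lambda>z. (y0, z)" and f' = "\<lambda>v. (0, v)"])
    show "((\<lambda>z. (y0, z)) has_derivative (\<lambda>v. (0, v))) (at z)" by (auto intro!: derivative_eq_intros)
    show "(f has_derivative fderiv f (y0, z)) (at (y0, z))"
      using smooth_on_has_derivative[OF that(1)] m0[OF that(2)] by blast
  qed
  show "smooth_on (\<lambda>z. fderiv m (y0, z) (\<xi>, 0)) U"
    by (rule smooth_on_slice[OF smooth_on_fderiv[OF m] _ open_U]) (use m0 in blast)
  fix z v w assume z: "z \<in> U"
  have zW: "(y0, z) \<in> W" and mz: "m (y0, z) = z" using m0[OF z] by auto
  \<comment> \<open>Symmetry of second derivatives lets the z-derivative of the generator be read as
    the parameter derivative of the differential of m (y, .), the form in which it arises from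
    \<open>?F\<close>.\<close>
  have D: "fderiv (\<lambda>z. fderiv m (y0, z) (\<xi>, 0)) z v = hess m (y0, z) (0, v) (\<xi>, 0)" for v
    using fderiv_eqI[OF slice[OF smooth_on_fderiv[OF m] z]]
      fderiv_fderiv_commute[OF m W zW] by metis
  have id: "fderiv m (y0, z) (0, v) = v" for v
  proof -
    have "((\<lambda>z. m (y0, z)) has_derivative (\<lambda>v. v)) (at z)"
      by (rule has_derivative_transform_within_open[OF has_derivative_ident open_U z])
         (use m0 in simp)
    from has_derivative_unique[OF slice[OF m z] this] show ?thesis by (rule fun_cong)
  qed
  let ?p = "\<lambda>s::real. (y0 + s *\<^sub>R \<xi>, z)"
  have p: "(?p has_derivative (\<lambda>h. h *\<^sub>R (\<xi>, 0))) (at 0)"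
    by (auto intro!: derivative_eq_intros simp: fun_eq_iff)
  have p0: "?p 0 = (y0, z)" by simp
  have along: "((\<lambda>s. f (?p s)) has_derivative (\<lambda>h. fderiv f (y0, z) (h *\<^sub>R (\<xi>, 0)))) (at 0)"
    if "smooth_on f W" for f :: "'f \<times> 'e \<Rightarrow> 'e"
    using has_derivative_compose[OF p, of f "fderiv f (y0, z)"] smooth_on_has_derivative[OF that zW] by simp
  let ?F = "\<lambda>s. g (m (?p s)) (fderiv m (?p s) (0, v)) (fderiv m (?p s) (0, w))"
  have "(?F has_derivative (\<lambda>h. dg (m (?p 0)) (fderiv m (y0, z) (h *\<^sub>R (\<xi>, 0))) (fderiv m (?p 0) (0, v)) (fderiv m (?p 0) (0, w))
     + g (m (?p 0)) (hess m (y0, z) (0, v) (h *\<^sub>R (\<xi>, 0))) (fderiv m (?p 0) (0, w))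
     + g (m (?p 0)) (fderiv m (?p 0) (0, v)) (hess m (y0, z) (0, w) (h *\<^sub>R (\<xi>, 0))))) (at 0)"
    by (rule has_derivative_metric[where p = "\<lambda>s. m (?p s)" and a = "\<lambda>s. fderiv m (?p s) (0, v)"
          and b = "\<lambda>s. fderiv m (?p s) (0, w)"])
       (simp_all only: p0 mz z UNIV_I along[OF m] along[OF smooth_on_fderiv[OF m]])
  \<comment> \<open>The isometry relation is available only while \<open>?p s\<close> lies in the
    open set W, that is for s near 0; there it makes \<open>?F\<close> constant.\<close>
  moreover have "(?F has_derivative (\<lambda>h. 0)) (at 0)"
  proof -
    have "isCont ?p 0" using p by (rule has_derivative_continuous)
    then have "\<forall>\<^sub>F s in nhds 0. ?p s \<in> W"
      by (rule isCont_eventually_mem[OF _ W]) (use zW in simp)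
    then have "\<forall>\<^sub>F s in at 0. g z v w = ?F s"
      unfolding eventually_at_filter by eventually_elim (use iso z in auto)
    then show ?thesis
      by (rule has_derivative_transform_eventually[OF has_derivative_const])
         (use iso[OF zW z] in simp_all)
  qed
  ultimately have "(\<lambda>h. dg (m (?p 0)) (fderiv m (y0, z) (h *\<^sub>R (\<xi>, 0))) (fderiv m (?p 0) (0, v)) (fderiv m (?p 0) (0, w))
     + g (m (?p 0)) (hess m (y0, z) (0, v) (h *\<^sub>R (\<xi>, 0))) (fderiv m (?p 0) (0, w))
     + g (m (?p 0)) (fderiv m (?p 0) (0, v)) (hess m (y0, z) (0, w) (h *\<^sub>R (\<xi>, 0)))) = (\<lambda>h. 0)"
    by (rule has_derivative_unique)
  from fun_cong[OF this, of 1]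
  show "dg z (fderiv m (y0, z) (\<xi>, 0)) v w
    + g z (fderiv (\<lambda>z. fderiv m (y0, z) (\<xi>, 0)) z v) w
    + g z v (fderiv (\<lambda>z. fderiv m (y0, z) (\<xi>, 0)) z w) = 0"
    by (simp add: mz id D)
qed

section \<open>Tangent vectors and velocities of curves\<close>

lemma charts_atD: "c \<in> charts_at A p \<Longrightarrow> c \<in> A" "c \<in> charts_at A p \<Longrightarrow> p \<in> fst c"
  by (simp_all add: charts_at_def)

lemma charts_atI: "c \<in> A \<Longrightarrow> p \<in> fst c \<Longrightarrow> c \<in> charts_at A p"
  by (simp add: charts_at_def)

lemma charts_at_carrier: "c \<in> charts_at A p \<Longrightarrow> p \<in> manifold_carrier A"
  by (auto simp: charts_at_def manifold_carrier_def)

lemma charts_at_obtain: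
  assumes "p \<in> manifold_carrier A" obtains c where "c \<in> charts_at A p"
  using assms by (auto simp: charts_at_def manifold_carrier_def)

lemma has_derivative_cong_ev:
  assumes "(f has_derivative f') (at x)" "\<forall>\<^sub>F y in nhds x. f y = g y"
  shows "(g has_derivative f') (at x)"
  using assms eventually_nhds_x_imp_x[OF assms(2)]
  by (intro has_derivative_transform_eventually[OF assms(1)]) (auto simp: eventually_at_filter elim: eventually_mono)

lemma tangent_spaceD:
  "v \<in> tangent_space A p \<Longrightarrow> c \<in> charts_at A p \<Longrightarrow> d \<in> charts_at A p \<Longrightarrow> v d = coord_change c d p (v c)"
  unfolding tangent_space_def by blast

lemma tangent_space_outside: "v \<in> tangent_space A p \<Longrightarrow> c \<notin> charts_at A p \<Longrightarrow> v c = 0"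
  unfolding tangent_space_def by blast

lemma tangent_spaceI:
  assumes "\<And>c. c \<notin> charts_at A p \<Longrightarrow> v c = 0"
    "\<And>c d. c \<in> charts_at A p \<Longrightarrow> d \<in> charts_at A p \<Longrightarrow> v d = coord_change c d p (v c)"
  shows "v \<in> tangent_space A p"
  unfolding tangent_space_def using assms by blast

locale manifold =
  fixes A :: "('a::{t2_space, second_countable_topology}, 'e::euclidean_space) atlas"
  assumes atlas: "smooth_atlas A"
begin

lemma chart_open: "c \<in> A \<Longrightarrow> open (fst c)" and chart_image_open: "c \<in> A \<Longrightarrow> open (chart_image c)"
  and chart_homeomorphism: "c \<in> A \<Longrightarrow> homeomorphism (fst c) (chart_image c) (snd c) (chart_inv c)"
  using atlas by (auto simp: smooth_atlas_def)

lemma chart_inv_chart: "c \<in> A \<Longrightarrow> p \<in> fst c \<Longrightarrow> chart_inv c (snd c p) = p"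
  using homeomorphism_apply1[OF chart_homeomorphism] .

lemma chart_chart_inv: "c \<in> A \<Longrightarrow> x \<in> chart_image c \<Longrightarrow> snd c (chart_inv c x) = x"
  using homeomorphism_apply2[OF chart_homeomorphism] .

lemma chart_inv_in: "c \<in> A \<Longrightarrow> x \<in> chart_image c \<Longrightarrow> chart_inv c x \<in> fst c"
  using homeomorphism_image2[OF chart_homeomorphism] by blast

lemma chart_in_image: "p \<in> fst c \<Longrightarrow> snd c p \<in> chart_image c"
  by (simp add: chart_image_def)

lemma chart_inv_isCont: "c \<in> A \<Longrightarrow> x \<in> chart_image c \<Longrightarrow> isCont (chart_inv c) x"
  using homeomorphism_cont2[OF chart_homeomorphism] chart_image_open continuous_on_eq_continuous_at by blast

lemma chart_image_Int:
  assumes "c \<in> A"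
  shows "snd c ` (fst c \<inter> S) = chart_image c \<inter> chart_inv c -` S"
proof (rule Set.set_eqI, rule iffI)
  fix x assume "x \<in> snd c ` (fst c \<inter> S)"
  then obtain p where "p \<in> fst c" "p \<in> S" "x = snd c p" by blast
  then show "x \<in> chart_image c \<inter> chart_inv c -` S"
    by (simp add: chart_in_image chart_inv_chart[OF assms])
next
  fix x assume "x \<in> chart_image c \<inter> chart_inv c -` S"
  then have "snd c (chart_inv c x) = x" "chart_inv c x \<in> fst c \<inter> S"
    by (simp_all add: chart_chart_inv[OF assms] chart_inv_in[OF assms])
  then show "x \<in> snd c ` (fst c \<inter> S)" by (metis imageI)
qed

lemma chart_image_Int_open: "c \<in> A \<Longrightarrow> open S \<Longrightarrow> open (snd c ` (fst c \<inter> S))"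
  unfolding chart_image_Int
  by (rule continuous_open_preimage[OF homeomorphism_cont2[OF chart_homeomorphism] chart_image_open])

lemma carrier_open: "open (manifold_carrier A)"
  unfolding manifold_carrier_def using chart_open by blast

lemma transition_smooth: "c \<in> A \<Longrightarrow> d \<in> A \<Longrightarrow> smooth_on (snd d \<circ> chart_inv c) (snd c ` (fst c \<inter> fst d))"
  using atlas by (auto simp: smooth_atlas_def)

lemma chart_inv_chart_at: "c \<in> charts_at A p \<Longrightarrow> chart_inv c (snd c p) = p"
  by (simp add: charts_at_def chart_inv_chart)

lemma eventually_chart_inv:
  assumes "c \<in> charts_at A p" "\<forall>\<^sub>F q in nhds p. P q"
  shows "\<forall>\<^sub>F x in nhds (snd c p). P (chart_inv c x)"
proof -
  have "filterlim (chart_inv c) (nhds p) (nhds (snd c p))"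
    using chart_inv_isCont[OF charts_atD(1)[OF assms(1)] chart_in_image[OF charts_atD(2)[OF assms(1)]]]
    unfolding continuous_at tendsto_at_iff_tendsto_nhds
    by (simp add: chart_inv_chart_at[OF assms(1)])
  then show ?thesis using assms(2) by (simp add: filterlim_iff)
qed

lemma eventually_chart_image: "c \<in> charts_at A p \<Longrightarrow> \<forall>\<^sub>F x in nhds (snd c p). x \<in> chart_image c"
  by (rule eventually_nhds_in_open) (simp_all add: charts_at_def chart_image_open chart_in_image)

lemma eventually_in_chart: "c \<in> charts_at A p \<Longrightarrow> \<forall>\<^sub>F q in nhds p. q \<in> fst c"
  by (rule eventually_nhds_in_open) (simp_all add: charts_at_def chart_open)

lemma transition_has_derivative:
  assumes "c \<in> charts_at A p" "d \<in> charts_at A p"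
  shows "((snd d \<circ> chart_inv c) has_derivative coord_change c d p) (at (snd c p))"
  unfolding coord_change_def
  using assms by (intro smooth_on_has_derivative[OF transition_smooth]) (auto simp: charts_at_def)

lemma coord_change_linear: "c \<in> charts_at A p \<Longrightarrow> d \<in> charts_at A p \<Longrightarrow> linear (coord_change c d p)"
  using transition_has_derivative has_derivative_linear by blast

lemma coord_change_self:
  assumes "c \<in> charts_at A p"
  shows "coord_change c c p v = v"
proof -
  have "((snd c \<circ> chart_inv c) has_derivative (\<lambda>v. v)) (at (snd c p))"
    by (rule has_derivative_cong_ev[OF has_derivative_ident], rule eventually_mono[OF eventually_chart_image[OF assms]])
       (simp add: chart_chart_inv[OF charts_atD(1)[OF assms]])
  from has_derivative_unique[OF transition_has_derivative[OF assms assms] this] show ?thesis by metis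
qed

text \<open>Chain rule for the transition maps near p. This cocycle law is what makes
  \<open>tangent_of_coords\<close> a compatible family.\<close>

lemma coord_change_trans:
  assumes c: "c \<in> charts_at A p" and d: "d \<in> charts_at A p" and e: "e \<in> charts_at A p"
  shows "coord_change d e p (coord_change c d p v) = coord_change c e p v"
proof -
  have p: "(snd d \<circ> chart_inv c) (snd c p) = snd d p"
    by (simp add: chart_inv_chart_at[OF c])
  have "((\<lambda>x. (snd e \<circ> chart_inv d) ((snd d \<circ> chart_inv c) x)) has_derivative
     (\<lambda>v. coord_change d e p (coord_change c d p v))) (at (snd c p))"
    by (rule has_derivative_compose[OF transition_has_derivative[OF c d]])
       (simp only: p transition_has_derivative[OF d e])
  then have "((snd e \<circ> chart_inv c) has_derivative
     (\<lambda>v. coord_change d e p (coord_change c d p v))) (at (snd c p))"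
    by (rule has_derivative_cong_ev,
        intro eventually_mono[OF eventually_chart_inv[OF c eventually_in_chart[OF d]]])
       (use chart_inv_chart[OF charts_atD(1)[OF d]] in simp)
  from has_derivative_unique[OF this transition_has_derivative[OF c e]] show ?thesis by metis
qed

lemma tangent_of_coords_in: "c \<in> charts_at A p \<Longrightarrow> tangent_of_coords A c p x \<in> tangent_space A p"
  by (rule tangent_spaceI) (simp_all add: tangent_of_coords_def coord_change_trans)

lemma tangent_of_coords_same: "c \<in> charts_at A p \<Longrightarrow> tangent_of_coords A c p x c = x"
  by (simp add: tangent_of_coords_def coord_change_self)

lemma tangent_of_coords_apply:
  "d \<in> charts_at A p \<Longrightarrow> tangent_of_coords A c p x d = coord_change c d p x"
  by (simp add: tangent_of_coords_def)

lemma tangent_eqI: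
  assumes "v \<in> tangent_space A p" "w \<in> tangent_space A p" "c \<in> charts_at A p" "v c = w c"
  shows "v = w"
proof
  fix d show "v d = w d"
  proof (cases "d \<in> charts_at A p")
    case True
    show ?thesis
      by (simp only: tangent_spaceD[OF assms(1,3) True] tangent_spaceD[OF assms(2,3) True] assms(4))
  qed (simp add: tangent_space_outside[OF assms(1)] tangent_space_outside[OF assms(2)])
qed

lemma tangent_of_coords_coords:
  "v \<in> tangent_space A p \<Longrightarrow> c \<in> charts_at A p \<Longrightarrow> tangent_of_coords A c p (v c) = v"
  by (rule tangent_eqI[OF tangent_of_coords_in]) (auto simp: tangent_of_coords_same)

lemma tangent_of_coords_change:
  "c \<in> charts_at A p \<Longrightarrow> d \<in> charts_at A p \<Longrightarrow>
   tangent_of_coords A d p (coord_change c d p x) = tangent_of_coords A c p x"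
  by (rule tangent_eqI[OF tangent_of_coords_in tangent_of_coords_in, of d _ c d])
     (auto simp: tangent_of_coords_same tangent_of_coords_apply)

lemma tangent_space_diff:
  "v \<in> tangent_space A p \<Longrightarrow> w \<in> tangent_space A p \<Longrightarrow> v - w \<in> tangent_space A p"
  by (rule tangent_spaceI)
     (simp_all add: tangent_space_outside[where p = p] linear_diff[OF coord_change_linear]
        tangent_spaceD[symmetric])

lemma tangent_space_add:
  "v \<in> tangent_space A p \<Longrightarrow> w \<in> tangent_space A p \<Longrightarrow> v + w \<in> tangent_space A p"
  by (rule tangent_spaceI)
     (simp_all add: tangent_space_outside[where p = p] linear_add[OF coord_change_linear]
        tangent_spaceD[symmetric])

lemma tangent_space_zero: "0 \<in> tangent_space A p"
  by (rule tangent_spaceI) (simp_all add: linear_0[OF coord_change_linear])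

text \<open>A relation instead of the function \<open>velocity\<close>: it records that the
  derivatives exist in all charts and form a tangent vector, so velocities can be carried through
  maps and products. The set T allows one-sided velocities. At other parameters \<alpha> may leave
  the manifold, but continuity keeps it inside near t.\<close>

definition has_velocity :: "(real \<Rightarrow> 'a) \<Rightarrow> ('a, 'e) tangent \<Rightarrow> real \<Rightarrow> real set \<Rightarrow> bool" where
  "has_velocity \<alpha> v t T \<longleftrightarrow> t \<in> T \<and> \<alpha> t \<in> manifold_carrier A \<and> v \<in> tangent_space A (\<alpha> t) \<and>
     continuous (at t within T) \<alpha> \<and>
     (\<forall>c\<in>charts_at A (\<alpha> t). ((\<lambda>s. snd c (\<alpha> s)) has_vector_derivative v c) (at t within T))"

lemma eventually_curve:
  assumes "continuous (at t within T) \<alpha>" "\<forall>\<^sub>F q in nhds (\<alpha> t). P q"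
  shows "\<forall>\<^sub>F s in at t within T. P (\<alpha> s)"
  using assms by (auto simp: continuous_within filterlim_iff)

lemma has_velocityI:
  assumes c: "c \<in> charts_at A (\<alpha> t)" and cont: "continuous (at t within T) \<alpha>" and t: "t \<in> T"
    and x: "((\<lambda>s. snd c (\<alpha> s)) has_vector_derivative x) (at t within T)"
  shows "has_velocity \<alpha> (tangent_of_coords A c (\<alpha> t) x) t T"
  unfolding has_velocity_def
proof (intro conjI ballI)
  fix d assume d: "d \<in> charts_at A (\<alpha> t)"
  have "((\<lambda>s. (snd d \<circ> chart_inv c) (snd c (\<alpha> s))) has_derivative
      (\<lambda>h. coord_change c d (\<alpha> t) (h *\<^sub>R x))) (at t within T)"
    by (rule has_derivative_compose[OF x[unfolded has_vector_derivative_def] transition_has_derivative[OF c d]])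
  then have "((\<lambda>s. (snd d \<circ> chart_inv c) (snd c (\<alpha> s))) has_vector_derivative coord_change c d (\<alpha> t) x) (at t within T)"
    by (simp add: has_vector_derivative_def linear_cmul[OF coord_change_linear[OF c d]])
  then show "((\<lambda>s. snd d (\<alpha> s)) has_vector_derivative tangent_of_coords A c (\<alpha> t) x d) (at t within T)"
    unfolding has_vector_derivative_def tangent_of_coords_apply[OF d]
  proof (rule has_derivative_transform_eventually)
    show "\<forall>\<^sub>F s in at t within T. (snd d \<circ> chart_inv c) (snd c (\<alpha> s)) = snd d (\<alpha> s)"
      using eventually_curve[OF cont eventually_in_chart[OF c]]
      by eventually_elim (simp add: chart_inv_chart[OF charts_atD(1)[OF c]])
    show "(snd d \<circ> chart_inv c) (snd c (\<alpha> t)) = snd d (\<alpha> t)"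
      by (simp add: chart_inv_chart_at[OF c])
  qed (rule t)
qed (simp_all add: t cont tangent_of_coords_in[OF c] charts_at_carrier[OF c])

lemma has_velocity_tangent: "has_velocity \<alpha> v t T \<Longrightarrow> v \<in> tangent_space A (\<alpha> t)"
  by (simp add: has_velocity_def)

lemma has_velocity_carrier: "has_velocity \<alpha> v t T \<Longrightarrow> \<alpha> t \<in> manifold_carrier A"
  by (simp add: has_velocity_def)

lemma has_velocity_coords:
  "has_velocity \<alpha> v t T \<Longrightarrow> c \<in> charts_at A (\<alpha> t) \<Longrightarrow>
   ((\<lambda>s. snd c (\<alpha> s)) has_vector_derivative v c) (at t within T)"
  by (simp add: has_velocity_def)

lemma has_velocity_unique:
  assumes "has_velocity \<alpha> v t T" "has_velocity \<alpha> w t T" "at t within T \<noteq> bot"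
  shows "v = w"
proof -
  obtain c where c: "c \<in> charts_at A (\<alpha> t)"
    by (rule charts_at_obtain[OF has_velocity_carrier[OF assms(1)]])
  show ?thesis
    by (rule tangent_eqI[OF has_velocity_tangent[OF assms(1)] has_velocity_tangent[OF assms(2)] c])
       (rule vector_derivative_unique_within[OF assms(3) has_velocity_coords[OF assms(1) c]
          has_velocity_coords[OF assms(2) c]])
qed

lemma has_velocity_cong:
  assumes "has_velocity \<alpha> v t T" "\<forall>\<^sub>F s in at t within T. \<alpha> s = \<beta> s" "\<alpha> t = \<beta> t"
  shows "has_velocity \<beta> v t T"
  unfolding has_velocity_def
proof (intro conjI ballI)
  show "continuous (at t within T) \<beta>"
    using assms(1,3) tendsto_cong[OF assms(2), of "\<alpha> t"]
    by (simp add: has_velocity_def continuous_within)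
  fix c assume "c \<in> charts_at A (\<beta> t)"
  then have "((\<lambda>s. snd c (\<alpha> s)) has_derivative (\<lambda>h. h *\<^sub>R v c)) (at t within T)"
    using assms by (auto simp: has_velocity_def has_vector_derivative_def)
  then show "((\<lambda>s. snd c (\<beta> s)) has_vector_derivative v c) (at t within T)"
    unfolding has_vector_derivative_def
    by (rule has_derivative_transform_eventually)
       (use assms(1,3) in \<open>auto simp: has_velocity_def intro: eventually_mono[OF assms(2)]\<close>)
qed (use assms(1,3) in \<open>auto simp: has_velocity_def\<close>)

lemma has_velocity_subset: "has_velocity \<alpha> v t T \<Longrightarrow> S \<subseteq> T \<Longrightarrow> t \<in> S \<Longrightarrow> has_velocity \<alpha> v t S"
  by (auto simp: has_velocity_def intro: continuous_within_subset has_vector_derivative_within_subset)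

text \<open>The curve is a straight line in coordinates. Since every tangent vector is thus a
  velocity, identities between tangent maps can be checked on curves.\<close>

lemma has_velocity_exists:
  assumes v: "v \<in> tangent_space A p" and c: "c \<in> charts_at A p"
  shows "has_velocity (\<lambda>s. chart_inv c (snd c p + s *\<^sub>R v c)) v 0 UNIV"
proof -
  let ?\<alpha> = "\<lambda>s. chart_inv c (snd c p + s *\<^sub>R v c)"
  have 0: "?\<alpha> 0 = p" by (simp add: chart_inv_chart_at[OF c])
  have cont: "isCont (\<lambda>s. snd c p + s *\<^sub>R v c) 0" by (intro continuous_intros)
  have "\<forall>\<^sub>F s in nhds 0. snd c p + s *\<^sub>R v c \<in> chart_image c"
    by (rule isCont_eventually_mem[OF cont])
       (use c in \<open>simp_all add: charts_at_def chart_image_open chart_in_image\<close>)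
  then have ev: "\<forall>\<^sub>F s in nhds 0. snd c p + s *\<^sub>R v c = snd c (?\<alpha> s)"
    by eventually_elim (simp add: chart_chart_inv[OF charts_atD(1)[OF c]])
  have "((\<lambda>s. snd c p + s *\<^sub>R v c) has_derivative (\<lambda>h. h *\<^sub>R v c)) (at 0)"
    by (auto intro!: derivative_eq_intros)
  then have "((\<lambda>s. snd c (?\<alpha> s)) has_derivative (\<lambda>h. h *\<^sub>R v c)) (at 0)"
    by (rule has_derivative_cong_ev[OF _ ev])
  moreover have "isCont ?\<alpha> 0"
    by (rule isCont_o2[OF cont])
       (use c in \<open>simp add: charts_at_def chart_inv_isCont chart_in_image\<close>)
  ultimately have "has_velocity ?\<alpha> (tangent_of_coords A c (?\<alpha> 0) (v c)) 0 UNIV"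
    by (intro has_velocityI) (simp_all only: 0 c has_vector_derivative_def UNIV_I)
  then show ?thesis using tangent_of_coords_coords[OF v c] by (simp only: 0)
qed

text \<open>Pointwise, so that right translations, whose differentiability is derived from the
  multiplication at one point at a time, are covered along with instances of
  \<open>smooth_map\<close>.\<close>

definition differentiable_map_at :: "('a \<Rightarrow> 'a) \<Rightarrow> 'a \<Rightarrow> bool" where
  "differentiable_map_at f p \<longleftrightarrow> p \<in> manifold_carrier A \<and> f p \<in> manifold_carrier A \<and> isCont f p \<and>
     (\<forall>c\<in>charts_at A p. \<forall>d\<in>charts_at A (f p). (snd d \<circ> f \<circ> chart_inv c) differentiable (at (snd c p)))"

lemma smooth_map_differentiable:
  assumes f: "smooth_map A A f" and p: "p \<in> manifold_carrier A"
  shows "differentiable_map_at f p"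
  unfolding differentiable_map_at_def
proof (intro conjI ballI)
  show "f p \<in> manifold_carrier A" using f p by (auto simp: smooth_map_def)
  show "isCont f p"
    using f p carrier_open continuous_on_eq_continuous_at by (auto simp: smooth_map_def)
  fix c d assume "c \<in> charts_at A p" "d \<in> charts_at A (f p)"
  then show "(snd d \<circ> f \<circ> chart_inv c) differentiable (at (snd c p))"
    using f by (intro smooth_on_differentiable[where S = "snd c ` (fst c \<inter> f -` fst d)"])
      (auto simp: smooth_map_def charts_at_def)
qed (rule p)

text \<open>\<open>tangent_map\<close> uses a chart picked by \<open>SOME\<close>. The compatibility
  of v across charts and the chain rule give the same value for every chart at p.\<close>

lemma tangent_map_coords:
  assumes f: "differentiable_map_at f p" and v: "v \<in> tangent_space A p"
    and c: "c \<in> charts_at A p" and d: "d \<in> charts_at A (f p)"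
  shows "tangent_map A A f p v d = fderiv (snd d \<circ> f \<circ> chart_inv c) (snd c p) (v c)"
proof -
  define b where "b = (SOME c. c \<in> charts_at A p)"
  have b: "b \<in> charts_at A p" unfolding b_def using c by (rule someI)
  have p: "(snd c \<circ> chart_inv b) (snd b p) = snd c p"
    by (simp add: chart_inv_chart_at[OF b])
  have "((snd d \<circ> f \<circ> chart_inv c) has_derivative fderiv (snd d \<circ> f \<circ> chart_inv c) (snd c p)) (at (snd c p))"
    using f c d unfolding differentiable_map_at_def frechet_derivative_works by blast
  then have "((\<lambda>x. (snd d \<circ> f \<circ> chart_inv c) ((snd c \<circ> chart_inv b) x)) has_derivative
     (\<lambda>v. fderiv (snd d \<circ> f \<circ> chart_inv c) (snd c p) (coord_change b c p v))) (at (snd b p))"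
    by (intro has_derivative_compose[OF transition_has_derivative[OF b c]]) (simp only: p)
  then have "((snd d \<circ> f \<circ> chart_inv b) has_derivative
     (\<lambda>v. fderiv (snd d \<circ> f \<circ> chart_inv c) (snd c p) (coord_change b c p v))) (at (snd b p))"
    by (rule has_derivative_cong_ev,
        intro eventually_mono[OF eventually_chart_inv[OF b eventually_in_chart[OF c]]])
       (use chart_inv_chart[OF charts_atD(1)[OF c]] in simp)
  from fderiv_eqI[OF this] show ?thesis
    using d tangent_spaceD[OF v b c] by (simp add: tangent_map_def b_def[symmetric])
qed

lemma has_velocity_map:
  assumes \<alpha>: "has_velocity \<alpha> v t T" and f: "differentiable_map_at f (\<alpha> t)"
  shows "has_velocity (\<lambda>s. f (\<alpha> s)) (tangent_map A A f (\<alpha> t) v) t T"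
proof -
  let ?p = "\<alpha> t"
  obtain c where c: "c \<in> charts_at A ?p"
    by (rule charts_at_obtain[OF has_velocity_carrier[OF \<alpha>]])
  have "f ?p \<in> manifold_carrier A" using f by (simp add: differentiable_map_at_def)
  then obtain e where e: "e \<in> charts_at A (f ?p)" by (rule charts_at_obtain)
  have v: "v \<in> tangent_space A ?p" and t: "t \<in> T" and cont: "continuous (at t within T) \<alpha>"
    and dc: "((\<lambda>s. snd c (\<alpha> s)) has_derivative (\<lambda>h. h *\<^sub>R v c)) (at t within T)"
    using \<alpha> c by (auto simp: has_velocity_def has_vector_derivative_def)
  have inv: "chart_inv c (snd c ?p) = ?p" by (simp add: chart_inv_chart_at[OF c])
  have D: "((\<lambda>s. snd d (f (\<alpha> s))) has_vector_derivative tangent_map A A f ?p v d) (at t within T)"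
    if d: "d \<in> charts_at A (f ?p)" for d
  proof -
    have "((snd d \<circ> f \<circ> chart_inv c) has_derivative fderiv (snd d \<circ> f \<circ> chart_inv c) (snd c ?p)) (at (snd c ?p))"
      using f c d unfolding differentiable_map_at_def frechet_derivative_works by blast
    note fd = this
    from has_derivative_compose[OF dc fd]
    have "((\<lambda>s. (snd d \<circ> f \<circ> chart_inv c) (snd c (\<alpha> s))) has_derivative
      (\<lambda>h. h *\<^sub>R tangent_map A A f ?p v d)) (at t within T)"
      using linear_cmul[OF has_derivative_linear[OF fd]]
      by (simp add: tangent_map_coords[OF f v c d])
    then show ?thesis
      unfolding has_vector_derivative_def
    proof (rule has_derivative_transform_eventually)
      show "\<forall>\<^sub>F s in at t within T. (snd d \<circ> f \<circ> chart_inv c) (snd c (\<alpha> s)) = snd d (f (\<alpha> s))"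
        using eventually_curve[OF cont eventually_in_chart[OF c]]
        by eventually_elim (simp add: chart_inv_chart[OF charts_atD(1)[OF c]])
    qed (simp_all add: inv t)
  qed
  have "continuous (at t within T) (\<lambda>s. f (\<alpha> s))"
    by (rule continuous_within_compose3[OF _ cont]) (use f in \<open>simp add: differentiable_map_at_def\<close>)
  from has_velocityI[OF e this t D[OF e]]
  have hv: "has_velocity (\<lambda>s. f (\<alpha> s)) (tangent_of_coords A e (f ?p) (tangent_map A A f ?p v e)) t T" .
  \<comment> \<open>The chart e alone determines a tangent vector; the coordinates of the tangent
    map in any other chart d are shown to arise from it by \<open>coord_change\<close>, again by a
    chain rule.\<close>
  moreover have "tangent_of_coords A e (f ?p) (tangent_map A A f ?p v e) = tangent_map A A f ?p v"
  proof
    fix d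
    show "tangent_of_coords A e (f ?p) (tangent_map A A f ?p v e) d = tangent_map A A f ?p v d"
    proof (cases "d \<in> charts_at A (f ?p)")
      case True
      have fe: "((snd e \<circ> f \<circ> chart_inv c) has_derivative fderiv (snd e \<circ> f \<circ> chart_inv c) (snd c ?p)) (at (snd c ?p))"
        using f c e unfolding differentiable_map_at_def frechet_derivative_works by blast
      have "((\<lambda>x. (snd d \<circ> chart_inv e) ((snd e \<circ> f \<circ> chart_inv c) x)) has_derivative
         (\<lambda>v. coord_change e d (f ?p) (fderiv (snd e \<circ> f \<circ> chart_inv c) (snd c ?p) v))) (at (snd c ?p))"
        by (rule has_derivative_compose[OF fe])
           (simp add: inv transition_has_derivative[OF e True, unfolded o_def] o_def)
      moreover have "\<forall>\<^sub>F x in nhds (snd c ?p). f (chart_inv c x) \<in> fst e"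
      proof (rule eventually_chart_inv[OF c])
        show "\<forall>\<^sub>F q in nhds ?p. f q \<in> fst e"
          using f e by (intro isCont_eventually_mem)
            (simp_all add: differentiable_map_at_def charts_at_def chart_open)
      qed
      then have "\<forall>\<^sub>F x in nhds (snd c ?p). (snd d \<circ> chart_inv e) ((snd e \<circ> f \<circ> chart_inv c) x)
          = (snd d \<circ> f \<circ> chart_inv c) x"
        by eventually_elim (use chart_inv_chart[OF charts_atD(1)[OF e]] in simp)
      ultimately have "((snd d \<circ> f \<circ> chart_inv c) has_derivative
         (\<lambda>v. coord_change e d (f ?p) (fderiv (snd e \<circ> f \<circ> chart_inv c) (snd c ?p) v))) (at (snd c ?p))"
        by (rule has_derivative_cong_ev)
      from fderiv_eqI[OF this] show ?thesis
        by (simp add: tangent_map_coords[OF f v c True] tangent_map_coords[OF f v c e]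
            tangent_of_coords_apply[OF True])
    qed (simp add: tangent_of_coords_def tangent_map_def)
  qed
  ultimately show ?thesis by simp
qed

lemma tangent_map_in:
  assumes f: "differentiable_map_at f p" and v: "v \<in> tangent_space A p"
  shows "tangent_map A A f p v \<in> tangent_space A (f p)"
proof -
  obtain c where c: "c \<in> charts_at A p"
    using f unfolding differentiable_map_at_def by (blast elim: charts_at_obtain)
  have "chart_inv c (snd c p + 0 *\<^sub>R v c) = p" by (simp add: chart_inv_chart_at[OF c])
  with has_velocity_map[OF has_velocity_exists[OF v c], of f] f
  show ?thesis by (auto simp: has_velocity_def)
qed

end

section \<open>Killing fields along geodesics\<close>

lemma christoffel_levi_civita: "christoffel A g c = levi_civita (metric_coords A g c)"
  by (intro ext) (simp add: christoffel_def levi_civita_def)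

locale riemannian_manifold = manifold A
  for A :: "('a::{t2_space, second_countable_topology}, 'e::euclidean_space) atlas" +
  fixes g :: "('a, 'e) metric"
  assumes metric: "riemannian_metric A g"
begin

abbreviation gc :: "('a, 'e) chart \<Rightarrow> 'e \<Rightarrow> 'e \<Rightarrow> 'e \<Rightarrow> real" where "gc \<equiv> metric_coords A g"

lemma chart_metric: "c \<in> A \<Longrightarrow> coord_metric (chart_image c) (gc c)"
  using metric chart_image_open unfolding riemannian_metric_def coord_metric_def by blast

lemma metric_in_chart:
  "c \<in> charts_at A p \<Longrightarrow> v \<in> tangent_space A p \<Longrightarrow> w \<in> tangent_space A p \<Longrightarrow>
   g p v w = gc c (snd c p) (v c) (w c)"
  by (simp add: metric_coords_def chart_inv_chart_at tangent_of_coords_coords)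

lemma metric_coords_change:
  assumes "c \<in> charts_at A p" "d \<in> charts_at A p"
  shows "gc c (snd c p) v w = gc d (snd d p) (coord_change c d p v) (coord_change c d p w)"
  using assms by (simp add: metric_coords_def chart_inv_chart_at tangent_of_coords_change)

text \<open>The coordinate change is an isometry between the two coordinate metrics on the overlap,
  so \<open>\<Gamma>_transform\<close> applies; its differential is surjective because the reverse
  change is a right inverse.\<close>

lemma christoffel_transform:
  assumes c: "c \<in> charts_at A p" and d: "d \<in> charts_at A p"
  shows "coord_change c d p (christoffel A g c (snd c p) v w)
    = christoffel A g d (snd d p) (coord_change c d p v) (coord_change c d p w)
      + hess (snd d \<circ> chart_inv c) (snd c p) v w"
proof -
  let ?U = "snd c ` (fst c \<inter> fst d)" and ?\<phi> = "snd d \<circ> chart_inv c"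
  have cA: "c \<in> A" "p \<in> fst c" and dA: "d \<in> A" "p \<in> fst d" using c d by (auto simp: charts_at_def)
  have "coord_metric ?U (gc c)"
    by (rule coord_metric.coord_metric_subset[OF chart_metric[OF cA(1)] chart_image_Int_open[OF cA(1) chart_open[OF dA(1)]]])
       (auto simp: chart_image_def)
  then interpret U: coord_metric ?U "gc c" .
  have "fderiv ?\<phi> (snd c p) (U.\<Gamma> (snd c p) v w) = levi_civita (gc d) (?\<phi> (snd c p))
     (fderiv ?\<phi> (snd c p) v) (fderiv ?\<phi> (snd c p) w) + hess ?\<phi> (snd c p) v w"
  proof (rule U.\<Gamma>_transform[OF chart_metric[OF dA(1)] transition_smooth[OF cA(1) dA(1)]])
    fix x v w assume "x \<in> ?U"
    then obtain q where q: "x = snd c q" "c \<in> charts_at A q" "d \<in> charts_at A q"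
      using cA dA by (auto simp: charts_at_def)
    show "?\<phi> x \<in> chart_image d"
      using q by (simp add: chart_inv_chart_at chart_in_image charts_atD)
    show "gc c x v w = gc d (?\<phi> x) (fderiv ?\<phi> x v) (fderiv ?\<phi> x w)"
      using metric_coords_change[OF q(2,3)] by (simp add: q(1) chart_inv_chart_at[OF q(2)] coord_change_def)
  next
    show "snd c p \<in> ?U" using cA dA by blast
    show "surj (fderiv ?\<phi> (snd c p))"
      unfolding coord_change_def[symmetric]
      by (rule surjI[of _ "coord_change d c p"]) (simp add: coord_change_trans[OF d c d] coord_change_self[OF d])
  qed
  then show ?thesis
    by (simp add: christoffel_levi_civita coord_change_def chart_inv_chart_at[OF c])
qed

text \<open>In the chart d two inhomogeneous terms appear: a Hessian of the coordinate change from
  differentiating V, and one of opposite sign from the Christoffel symbols. They carry V and the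
  velocity in opposite order and cancel by symmetry of the Hessian.\<close>

lemma covariant_derivative_tangent:
  assumes \<gamma>: "has_velocity \<gamma> (velocity A I \<gamma> t) t I"
    and V: "\<And>s. s \<in> I \<Longrightarrow> V s \<in> tangent_space A (\<gamma> s)"
    and V': "\<And>c. c \<in> charts_at A (\<gamma> t) \<Longrightarrow> ((\<lambda>s. V s c) has_vector_derivative V' c) (at t within I)"
    and nontriv: "at t within I \<noteq> bot"
  shows "covariant_derivative A g I \<gamma> V t \<in> tangent_space A (\<gamma> t)"
proof (rule tangent_spaceI)
  let ?u = "velocity A I \<gamma> t"
  fix c d assume c: "c \<in> charts_at A (\<gamma> t)" and d: "d \<in> charts_at A (\<gamma> t)"
  let ?\<phi> = "snd d \<circ> chart_inv c" and ?U = "snd c ` (fst c \<inter> fst d)" and ?p = "snd c (\<gamma> t)"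
  have t: "t \<in> I" and cont: "continuous (at t within I) \<gamma>" using \<gamma> by (auto simp: has_velocity_def)
  have cA: "c \<in> A" and dA: "d \<in> A" using c d by (auto simp: charts_at_def)
  note sm = transition_smooth[OF cA dA]
  have oU: "open ?U" by (rule chart_image_Int_open[OF cA chart_open[OF dA]])
  have pU: "?p \<in> ?U" using c d by (auto simp: charts_at_def)
  have Dc: "fderiv ?\<phi> ?p = coord_change c d (\<gamma> t)" by (simp add: coord_change_def)
  have "((\<lambda>s. fderiv ?\<phi> (snd c (\<gamma> s)) (V s c)) has_derivative
    (\<lambda>h. hess ?\<phi> ?p (V t c) (h *\<^sub>R ?u c) + fderiv ?\<phi> ?p (h *\<^sub>R V' c))) (at t within I)"
    by (rule smooth_on_fderiv_along[where p = "\<lambda>s. snd c (\<gamma> s)" and t = t, OF sm oU pU t])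
       (use has_velocity_coords[OF \<gamma> c] V'[OF c] in \<open>simp_all add: has_vector_derivative_def\<close>)
  then have "((\<lambda>s. fderiv ?\<phi> (snd c (\<gamma> s)) (V s c)) has_derivative
    (\<lambda>h. h *\<^sub>R (hess ?\<phi> ?p (V t c) (?u c) + coord_change c d (\<gamma> t) (V' c)))) (at t within I)"
    using linear_cmul[OF smooth_on_hess_linear[OF sm pU]] linear_cmul[OF smooth_on_linear_fderiv[OF sm pU]]
    by (simp add: Dc scaleR_add_right)
  moreover have "\<forall>\<^sub>F s in at t within I. s \<in> I" by (simp add: eventually_at_filter)
  then have "\<forall>\<^sub>F s in at t within I. fderiv ?\<phi> (snd c (\<gamma> s)) (V s c) = V s d"
    using eventually_curve[OF cont eventually_in_chart[OF c]]
      eventually_curve[OF cont eventually_in_chart[OF d]]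
  proof eventually_elim
    case (elim s)
    then show ?case
      using tangent_spaceD[OF V[of s], of c d] cA dA by (simp add: coord_change_def charts_at_def)
  qed
  moreover have "fderiv ?\<phi> ?p (V t c) = V t d"
    using tangent_spaceD[OF V[OF t] c d] by (simp add: Dc)
  ultimately have "((\<lambda>s. V s d) has_derivative
    (\<lambda>h. h *\<^sub>R (hess ?\<phi> ?p (V t c) (?u c) + coord_change c d (\<gamma> t) (V' c)))) (at t within I)"
    by (rule has_derivative_transform_eventually[OF _ _ _ t])
  then have "((\<lambda>s. V s d) has_vector_derivative
      hess ?\<phi> ?p (V t c) (?u c) + coord_change c d (\<gamma> t) (V' c)) (at t within I)"
    by (simp add: has_vector_derivative_def)
  note vd = vector_derivative_within[OF nontriv this] vector_derivative_within[OF nontriv V'[OF c]]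
  have h: "hess ?\<phi> ?p (V t c) (?u c) = hess ?\<phi> ?p (?u c) (V t c)"
    by (rule fderiv_fderiv_commute[OF sm oU pU])
  show "covariant_derivative A g I \<gamma> V t d = coord_change c d (\<gamma> t) (covariant_derivative A g I \<gamma> V t c)"
    using christoffel_transform[OF c d, of "?u c" "V t c"]
      tangent_spaceD[OF has_velocity_tangent[OF \<gamma>] c d, symmetric] tangent_spaceD[OF V[OF t] c d, symmetric]
    by (simp add: covariant_derivative_def c d vd h linear_add[OF coord_change_linear[OF c d]])
qed (simp add: covariant_derivative_def)

definition killing_vector_field :: "('a \<Rightarrow> ('a, 'e) tangent) \<Rightarrow> bool" where
  "killing_vector_field K \<longleftrightarrow> (\<forall>p\<in>manifold_carrier A. K p \<in> tangent_space A p) \<and>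
     (\<forall>c\<in>A. killing_field (chart_image c) (gc c) (\<lambda>x. K (chart_inv c x) c))"

section \<open>Killing fields along a fixed geodesic\<close>

context
  fixes I :: "real set" and \<gamma> :: "real \<Rightarrow> 'a"
  assumes geod: "geodesic A g I \<gamma>" and nontrivial: "\<And>t. t \<in> I \<Longrightarrow> at t within I \<noteq> bot"
begin

abbreviation u where "u \<equiv> velocity A I \<gamma>"

lemma geodesic_carrier: "t \<in> I \<Longrightarrow> \<gamma> t \<in> manifold_carrier A"
  using geod by (auto simp: geodesic_def differentiable_curve_def)

lemma geodesic_velocity_tangent: "t \<in> I \<Longrightarrow> u t \<in> tangent_space A (\<gamma> t)"
  using geod by (auto simp: geodesic_def differentiable_field_along_def)

lemma geodesic_has_velocity:
  assumes "t \<in> I" shows "has_velocity \<gamma> (u t) t I"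
  unfolding has_velocity_def
proof (intro conjI ballI)
  show "continuous (at t within I) \<gamma>"
    using geod assms by (auto simp: geodesic_def differentiable_curve_def continuous_on_eq_continuous_within)
  fix c assume "c \<in> charts_at A (\<gamma> t)"
  then show "((\<lambda>s. snd c (\<gamma> s)) has_vector_derivative u t c) (at t within I)"
    using geod assms by (simp add: geodesic_def differentiable_curve_def velocity_def vector_derivative_works[symmetric])
qed (simp_all add: assms geodesic_carrier geodesic_velocity_tangent)

lemma geodesic_velocity_derivative:
  assumes t: "t \<in> I" and c: "c \<in> charts_at A (\<gamma> t)"
  shows "((\<lambda>s. u s c) has_vector_derivative - levi_civita (gc c) (snd c (\<gamma> t)) (u t c) (u t c)) (at t within I)"
proof -
  have "((\<lambda>s. u s c) has_vector_derivative vector_derivative (\<lambda>s. u s c) (at t within I)) (at t within I)"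
    using geod t c by (simp add: geodesic_def differentiable_field_along_def vector_derivative_works[symmetric])
  moreover have "covariant_derivative A g I \<gamma> u t c = 0"
    using geod t by (simp add: geodesic_def)
  then have "vector_derivative (\<lambda>s. u s c) (at t within I) = - levi_civita (gc c) (snd c (\<gamma> t)) (u t c) (u t c)"
    using c by (simp add: covariant_derivative_def christoffel_levi_civita eq_neg_iff_add_eq_0)
  ultimately show ?thesis by simp
qed

lemma eventually_geodesic_chart:
  "t \<in> I \<Longrightarrow> c \<in> charts_at A (\<gamma> t) \<Longrightarrow> \<forall>\<^sub>F s in at t within I. s \<in> I \<and> c \<in> charts_at A (\<gamma> s)"
  using eventually_curve[OF _ eventually_in_chart, of t I \<gamma> c] geodesic_has_velocity[of t]
  by (auto simp: has_velocity_def eventually_at_filter charts_at_def elim: eventually_mono)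

context
  fixes K :: "'a \<Rightarrow> ('a, 'e) tangent"
  assumes K: "killing_vector_field K"
begin

lemma killing_chart: "c \<in> A \<Longrightarrow> killing_field (chart_image c) (gc c) (\<lambda>x. K (chart_inv c x) c)"
  using K by (simp add: killing_vector_field_def)

lemma killing_tangent: "p \<in> manifold_carrier A \<Longrightarrow> K p \<in> tangent_space A p"
  using K by (simp add: killing_vector_field_def)

text \<open>Noether's theorem: the derivative is computed at each t in some chart around \<gamma> t,
  while the momentum itself does not depend on the chart; a zero derivative on an interval forces
  constancy.\<close>

lemma geodesic_momentum_constant:
  assumes "is_interval I" "s \<in> I" "t \<in> I"
  shows "g (\<gamma> s) (u s) (K (\<gamma> s)) = g (\<gamma> t) (u t) (K (\<gamma> t))"
proof -
  have "((\<lambda>s. g (\<gamma> s) (u s) (K (\<gamma> s))) has_derivative (\<lambda>h. 0)) (at t within I)" if t: "t \<in> I" for t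
  proof -
    obtain c where c: "c \<in> charts_at A (\<gamma> t)" by (rule charts_at_obtain[OF geodesic_carrier[OF t]])
    interpret killing_field "chart_image c" "gc c" "\<lambda>x. K (chart_inv c x) c"
      by (rule killing_chart[OF charts_atD(1)[OF c]])
    have e: "gc c (snd c (\<gamma> s)) (u s c) (K (chart_inv c (snd c (\<gamma> s))) c) = g (\<gamma> s) (u s) (K (\<gamma> s))"
      if "s \<in> I" "c \<in> charts_at A (\<gamma> s)" for s
      using metric_in_chart[OF that(2) geodesic_velocity_tangent[OF that(1)] killing_tangent[OF geodesic_carrier[OF that(1)]]]
      by (simp add: chart_inv_chart_at[OF that(2)])
    have "((\<lambda>s. gc c (snd c (\<gamma> s)) (u s c) (K (chart_inv c (snd c (\<gamma> s))) c)) has_vector_derivative 0) (at t within I)"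
      by (rule geodesic_momentum_derivative[OF _ t has_velocity_coords[OF geodesic_has_velocity[OF t] c]
            geodesic_velocity_derivative[OF t c]])
         (rule chart_in_image[OF charts_atD(2)[OF c]])
    then have "((\<lambda>s. gc c (snd c (\<gamma> s)) (u s c) (K (chart_inv c (snd c (\<gamma> s))) c)) has_derivative (\<lambda>h. 0)) (at t within I)"
      by (simp add: has_vector_derivative_def)
    then show ?thesis
    proof (rule has_derivative_transform_eventually)
      show "\<forall>\<^sub>F s in at t within I. gc c (snd c (\<gamma> s)) (u s c) (K (chart_inv c (snd c (\<gamma> s))) c) = g (\<gamma> s) (u s) (K (\<gamma> s))"
        using eventually_geodesic_chart[OF t c] by eventually_elim (simp add: e)
    qed (simp_all add: e t c)
  qed
  then show ?thesis
    using has_derivative_zero_unique[OF is_interval_convex[OF assms(1)]] assms(2,3) by blast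
qed

text \<open>As \<gamma>' is parallel, the covariant derivative of J is minus that of K along
  \<gamma>; as R(u, u)u = 0, the curvature term of J is minus that of K. The Jacobi equation for J
  is therefore the negative of the one that \<open>killing_jacobi\<close> gives for K.\<close>

theorem velocity_minus_killing_jacobi: "jacobi_field A g I \<gamma> (\<lambda>t. u t - K (\<gamma> t))"
proof -
  let ?J = "\<lambda>t. u t - K (\<gamma> t)" and ?Kc = "\<lambda>c x. K (chart_inv c x) c"
  \<comment> \<open>Coordinates in the chart c of the covariant derivative of K along
    \<gamma>.\<close>
  define W where "W c s = fderiv (?Kc c) (snd c (\<gamma> s)) (u s c)
      + levi_civita (gc c) (snd c (\<gamma> s)) (u s c) (?Kc c (snd c (\<gamma> s)))" for c s
  have J_in: "?J t \<in> tangent_space A (\<gamma> t)" if "t \<in> I" for t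
    using that by (intro tangent_space_diff geodesic_velocity_tangent killing_tangent geodesic_carrier)
  have J_der: "((\<lambda>s. ?J s c) has_vector_derivative
      - levi_civita (gc c) (snd c (\<gamma> t)) (u t c) (u t c) - fderiv (?Kc c) (snd c (\<gamma> t)) (u t c)) (at t within I)"
    if t: "t \<in> I" and c: "c \<in> charts_at A (\<gamma> t)" for t c
  proof -
    interpret killing_field "chart_image c" "gc c" "?Kc c"
      by (rule killing_chart[OF charts_atD(1)[OF c]])
    have "((\<lambda>s. ?Kc c (snd c (\<gamma> s))) has_vector_derivative fderiv (?Kc c) (snd c (\<gamma> t)) (u t c)) (at t within I)"
      by (rule killing_along_curve[OF _ has_velocity_coords[OF geodesic_has_velocity[OF t] c]])
         (rule chart_in_image[OF charts_atD(2)[OF c]])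
    then have "((\<lambda>s. u s c - ?Kc c (snd c (\<gamma> s))) has_derivative (\<lambda>h. h *\<^sub>R
      (- levi_civita (gc c) (snd c (\<gamma> t)) (u t c) (u t c) - fderiv (?Kc c) (snd c (\<gamma> t)) (u t c)))) (at t within I)"
      using has_vector_derivative_diff[OF geodesic_velocity_derivative[OF t c]]
      by (simp add: has_vector_derivative_def)
    then have "((\<lambda>s. ?J s c) has_derivative (\<lambda>h. h *\<^sub>R
      (- levi_civita (gc c) (snd c (\<gamma> t)) (u t c) (u t c) - fderiv (?Kc c) (snd c (\<gamma> t)) (u t c)))) (at t within I)"
    proof (rule has_derivative_transform_eventually)
      show "\<forall>\<^sub>F s in at t within I. u s c - ?Kc c (snd c (\<gamma> s)) = ?J s c"
        using eventually_geodesic_chart[OF t c] by eventually_elim (simp add: chart_inv_chart_at)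
    qed (simp_all add: chart_inv_chart_at c t)
    then show ?thesis by (simp add: has_vector_derivative_def)
  qed
  have DJ: "covariant_derivative A g I \<gamma> ?J t c = - W c t" if t: "t \<in> I" and c: "c \<in> charts_at A (\<gamma> t)" for t c
  proof -
    interpret killing_field "chart_image c" "gc c" "?Kc c"
      by (rule killing_chart[OF charts_atD(1)[OF c]])
    have x: "snd c (\<gamma> t) \<in> chart_image c" by (rule chart_in_image[OF charts_atD(2)[OF c]])
    show ?thesis
      using c vector_derivative_within[OF nontrivial[OF t] J_der[OF t c]]
      by (simp add: covariant_derivative_def W_def christoffel_levi_civita
          \<Gamma>_simps[OF x] chart_inv_chart_at[OF c])
  qed
  \<comment> \<open>Coordinates in the chart c of R(K, u)u, arranged as in
    \<open>killing_jacobi\<close>.\<close>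
  define R where "R c t = (fderiv (\<lambda>x. levi_civita (gc c) x (u t c) (u t c)) (snd c (\<gamma> t)) (K (\<gamma> t) c)
      - fderiv (\<lambda>x. levi_civita (gc c) x (K (\<gamma> t) c) (u t c)) (snd c (\<gamma> t)) (u t c)
      + levi_civita (gc c) (snd c (\<gamma> t)) (K (\<gamma> t) c) (levi_civita (gc c) (snd c (\<gamma> t)) (u t c) (u t c))
      - levi_civita (gc c) (snd c (\<gamma> t)) (u t c) (levi_civita (gc c) (snd c (\<gamma> t)) (K (\<gamma> t) c) (u t c)))" for c t
  have DJ_der: "((\<lambda>s. covariant_derivative A g I \<gamma> ?J s c) has_vector_derivative
      levi_civita (gc c) (snd c (\<gamma> t)) (u t c) (W c t) + R c t) (at t within I)"
    if t: "t \<in> I" and c: "c \<in> charts_at A (\<gamma> t)" for t c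
  proof -
    interpret killing_field "chart_image c" "gc c" "?Kc c"
      by (rule killing_chart[OF charts_atD(1)[OF c]])
    have x: "snd c (\<gamma> t) \<in> chart_image c" by (rule chart_in_image[OF charts_atD(2)[OF c]])
    have "(W c has_vector_derivative - (\<Gamma> (snd c (\<gamma> t)) (u t c) (W c t) + R c t)) (at t within I)"
      using killing_jacobi[where p = "\<lambda>s. snd c (\<gamma> s)" and q = "\<lambda>s. u s c", OF x t
          has_velocity_coords[OF geodesic_has_velocity[OF t] c] geodesic_velocity_derivative[OF t c]]
      by (simp only: W_def[symmetric] R_def chart_inv_chart_at[OF c])
        (simp only: W_def[of c t] chart_inv_chart_at[OF c])
    from has_vector_derivative_minus[OF this]
    have "((\<lambda>s. - W c s) has_vector_derivative (\<Gamma> (snd c (\<gamma> t)) (u t c) (W c t) + R c t)) (at t within I)"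
      by (simp only: minus_minus)
    then show ?thesis
      unfolding has_vector_derivative_def
    proof (rule has_derivative_transform_eventually)
      show "\<forall>\<^sub>F s in at t within I. - W c s = covariant_derivative A g I \<gamma> ?J s c"
        using eventually_geodesic_chart[OF t c] by eventually_elim (simp add: DJ)
    qed (simp_all add: DJ t c)
  qed
  show ?thesis
    unfolding jacobi_field_def differentiable_field_along_def
  proof (intro conjI ballI)
    fix t assume t: "t \<in> I"
    show "?J t \<in> tangent_space A (\<gamma> t)" by (rule J_in[OF t])
    show "covariant_derivative A g I \<gamma> ?J t \<in> tangent_space A (\<gamma> t)"
      by (rule covariant_derivative_tangent[OF geodesic_has_velocity[OF t] J_in J_der[OF t] nontrivial[OF t]])
    fix c assume c: "c \<in> charts_at A (\<gamma> t)"
    show "(\<lambda>s. ?J s c) differentiable at t within I"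
      using J_der[OF t c] by (rule differentiableI_vector)
    show "(\<lambda>s. covariant_derivative A g I \<gamma> ?J s c) differentiable at t within I"
      using DJ_der[OF t c] by (rule differentiableI_vector)
  next
    fix t assume t: "t \<in> I"
    show "covariant_derivative A g I \<gamma> (covariant_derivative A g I \<gamma> ?J) t
        + curvature A g (\<gamma> t) (?J t) (u t) (u t) = 0"
    proof
      fix c
      show "(covariant_derivative A g I \<gamma> (covariant_derivative A g I \<gamma> ?J) t
        + curvature A g (\<gamma> t) (?J t) (u t) (u t)) c = 0 c"
      proof (cases "c \<in> charts_at A (\<gamma> t)")
        case c: True
        interpret killing_field "chart_image c" "gc c" "?Kc c"
          by (rule killing_chart[OF charts_atD(1)[OF c]])
        have x: "snd c (\<gamma> t) \<in> chart_image c" by (rule chart_in_image[OF charts_atD(2)[OF c]])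
        have "curvature A g (\<gamma> t) (?J t) (u t) (u t) c = - R c t"
          using c linear_diff[OF linear_frechet_derivative[OF \<Gamma>_differentiable[OF x]]]
            bilinear_lsub[OF bilinear_family_fderiv[OF open_U x \<Gamma>_bilinear \<Gamma>_differentiable[OF x]]]
          by (simp add: curvature_def curvature_coords_def christoffel_levi_civita R_def \<Gamma>_simps[OF x])
        then show ?thesis
          using c by (simp add: covariant_derivative_def[of A g I \<gamma> "covariant_derivative A g I \<gamma> ?J"]
              vector_derivative_within[OF nontrivial[OF t] DJ_der[OF t c]] christoffel_levi_civita
              DJ[OF t c] \<Gamma>_simps[OF x])
      qed (simp add: covariant_derivative_def curvature_def)
    qed
  qed
qed

end

end

end

section \<open>Left-invariant metrics on Lie groups\<close>

lemma (in coord_metric) killing_field_cong: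
  assumes "killing_field U g K" "\<And>x. x \<in> U \<Longrightarrow> K x = K' x"
  shows "killing_field U g K'"
proof -
  interpret K: killing_field U g K by (rule assms(1))
  have "fderiv K x = fderiv K' x" if "x \<in> U" for x
    by (rule frechet_derivative_transform_within_open[OF smooth_on_differentiable[OF K.K_smooth that] open_U that assms(2)])
  moreover have "smooth_on K' U"
    using smooth_on_cong[of U K K'] open_U assms(2) K.K_smooth by blast
  ultimately show ?thesis
    using K.killing assms(2) by unfold_locales simp_all
qed

lemma interval_nontrivial:
  fixes I :: "real set"
  assumes "is_interval I" "x \<in> I" "y \<in> I" "x \<noteq> y" "t \<in> I"
  shows "at t within I \<noteq> bot"
proof -
  have "I \<noteq> {z}" for z using assms(2-4) by auto
  then have "t islimpt I"
    by (rule connected_imp_perfect[OF is_interval_connected[OF assms(1)] assms(5)])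
  then show ?thesis by (simp add: trivial_limit_within)
qed

section \<open>Curves with shifted parameter or zero velocity\<close>

context manifold begin

lemma has_velocity_shift:
  assumes \<alpha>: "has_velocity \<alpha> v (r + k) T" and S: "r \<in> S" "\<And>r. r \<in> S \<Longrightarrow> r + k \<in> T"
  shows "has_velocity (\<lambda>r. \<alpha> (r + k)) v r S"
  unfolding has_velocity_def
proof (intro conjI ballI)
  have sub: "(\<lambda>r. r + k) ` S \<subseteq> T" using S by auto
  show "continuous (at r within S) (\<lambda>r. \<alpha> (r + k))"
  proof (rule continuous_within_compose2[where g = \<alpha>])
    show "continuous (at r within S) (\<lambda>r. r + k)" by (intro continuous_intros)
    show "continuous (at (r + k) within (\<lambda>r. r + k) ` S) \<alpha>"
      using \<alpha> by (auto simp: has_velocity_def intro: continuous_within_subset[OF _ sub])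
  qed
  fix c assume "c \<in> charts_at A (\<alpha> (r + k))"
  then have D: "((\<lambda>s. snd c (\<alpha> s)) has_derivative (\<lambda>h. h *\<^sub>R v c)) (at (r + k) within (\<lambda>r. r + k) ` S)"
    by (intro has_derivative_subset[OF _ sub])
       (rule has_velocity_coords[OF \<alpha>, unfolded has_vector_derivative_def])
  have "((\<lambda>r. r + k) has_derivative (\<lambda>h. h)) (at r within S)"
    by (auto intro!: derivative_eq_intros)
  from has_derivative_in_compose[OF this D]
  show "((\<lambda>s. snd c (\<alpha> (s + k))) has_vector_derivative v c) (at r within S)"
    unfolding has_vector_derivative_def .
qed (use \<alpha> S in \<open>auto simp: has_velocity_def\<close>)

text \<open>Near each r the curve stays in one chart, where its coordinates have zero derivative on
  the convex set \<open>?B\<close> and so are constant. Connectedness of S turns local constancy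
  into global constancy.\<close>

lemma zero_velocity_constant:
  assumes S: "is_interval S" and \<beta>: "\<And>r. r \<in> S \<Longrightarrow> has_velocity \<beta> 0 r S" and st: "s \<in> S" "t \<in> S"
  shows "\<beta> s = \<beta> t"
proof (rule connected_local_const[OF is_interval_connected[OF S] st], intro ballI)
  fix r assume r: "r \<in> S"
  obtain c where c: "c \<in> charts_at A (\<beta> r)" by (rule charts_at_obtain[OF has_velocity_carrier[OF \<beta>[OF r]]])
  have "continuous (at r within S) \<beta>" using \<beta>[OF r] by (simp add: has_velocity_def)
  from eventually_curve[OF this eventually_in_chart[OF c]]
  obtain e where e: "e > 0" "\<And>s. s \<in> S \<Longrightarrow> s \<noteq> r \<Longrightarrow> dist s r < e \<Longrightarrow> \<beta> s \<in> fst c"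
    unfolding eventually_at by auto
  let ?B = "S \<inter> ball r e"
  have cs: "c \<in> charts_at A (\<beta> s)" if "s \<in> ?B" for s
    using e(2)[of s] that c by (cases "s = r") (auto simp: charts_at_def dist_commute)
  have "\<exists>k. \<forall>s\<in>?B. snd c (\<beta> s) = k"
  proof (rule has_derivative_zero_constant)
    show "convex ?B" by (intro convex_Int is_interval_convex[OF S] convex_ball)
    fix s assume s: "s \<in> ?B"
    then have "has_velocity \<beta> 0 s ?B" by (intro has_velocity_subset[OF \<beta>]) auto
    from has_velocity_coords[OF this cs[OF s]]
    show "((\<lambda>s. snd c (\<beta> s)) has_derivative (\<lambda>h. 0)) (at s within ?B)"
      by (simp add: has_vector_derivative_def)
  qed
  then have "\<beta> r = \<beta> s" if "s \<in> ?B" for s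
    using chart_inv_chart_at[OF cs[OF that]] chart_inv_chart_at[OF c] r e(1) that
    by (metis IntI centre_in_ball)
  then show "\<forall>\<^sub>F b in at r within S. \<beta> r = \<beta> b"
    unfolding eventually_at using e(1) by (intro exI[of _ e]) (auto simp: dist_commute)
qed

end

context riemannian_manifold begin

lemma metric_nondegenerate:
  assumes p: "p \<in> manifold_carrier A" and v: "v \<in> tangent_space A p" and w: "w \<in> tangent_space A p"
    and eq: "\<And>z. z \<in> tangent_space A p \<Longrightarrow> g p v z = g p w z"
  shows "v = w"
proof -
  obtain c where c: "c \<in> charts_at A p" by (rule charts_at_obtain[OF p])
  interpret coord_metric "chart_image c" "gc c" by (rule chart_metric[OF charts_atD(1)[OF c]])
  have "gc c (snd c p) (v c) z = gc c (snd c p) (w c) z" for z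
    using eq[OF tangent_of_coords_in[OF c, of z]]
      metric_in_chart[OF c v tangent_of_coords_in[OF c]] metric_in_chart[OF c w tangent_of_coords_in[OF c]]
    by (simp add: tangent_of_coords_same[OF c])
  then have "v c = w c" by (rule g_nondegenerate[OF chart_in_image[OF charts_atD(2)[OF c]]])
  then show ?thesis by (rule tangent_eqI[OF v w c])
qed

text \<open>An isometry preserves inner products, so a vector in the kernel of its differential is
  orthogonal to everything and hence zero.\<close>

lemma isometry_tangent_map_inj:
  assumes f: "riemannian_isometry A g f" and p: "p \<in> manifold_carrier A"
    and v: "v \<in> tangent_space A p" and z: "tangent_map A A f p v = 0"
  shows "v = 0"
proof (rule metric_nondegenerate[OF p v tangent_space_zero])
  fix w assume w: "w \<in> tangent_space A p"
  have fp: "f p \<in> manifold_carrier A" using f p by (auto simp: riemannian_isometry_def smooth_map_def)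
  obtain c where c: "c \<in> charts_at A p" by (rule charts_at_obtain[OF p])
  interpret C: coord_metric "chart_image c" "gc c" by (rule chart_metric[OF charts_atD(1)[OF c]])
  obtain d where d: "d \<in> charts_at A (f p)" by (rule charts_at_obtain[OF fp])
  interpret D: coord_metric "chart_image d" "gc d" by (rule chart_metric[OF charts_atD(1)[OF d]])
  have fd: "differentiable_map_at f p"
    using f by (intro smooth_map_differentiable[OF _ p]) (simp add: riemannian_isometry_def)
  have "g p v w = g (f p) 0 (tangent_map A A f p w)"
    using f p v w z by (metis riemannian_isometry_def)
  also have "\<dots> = 0"
    using metric_in_chart[OF d tangent_space_zero tangent_map_in[OF fd w]]
      D.g_simps(9)[OF chart_in_image[OF charts_atD(2)[OF d]]] by simp
  also have "0 = g p 0 w"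
    using metric_in_chart[OF c tangent_space_zero w]
      C.g_simps(9)[OF chart_in_image[OF charts_atD(2)[OF c]]] by simp
  finally show "g p v w = g p 0 w" .
qed

end

locale left_invariant_lie_group = riemannian_manifold A g
  for A :: "('a::{t2_space, second_countable_topology}, 'e::euclidean_space) atlas" and g +
  fixes G :: "'a monoid"
  assumes lie: "lie_group G A" and left_inv: "left_invariant_metric G A g"
begin

sublocale group G using lie by (simp add: lie_group_def)

lemma carrier_eq: "manifold_carrier A = carrier G" using lie by (simp add: lie_group_def)

abbreviation mul (infixl "\<cdot>" 70) where "x \<cdot> y \<equiv> x \<otimes>\<^bsub>G\<^esub> y"
abbreviation L where "L \<equiv> left_translation G"
abbreviation R where "R \<equiv> right_translation G"
abbreviation T where "T \<equiv> tangent_space A"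
abbreviation TM where "TM \<equiv> tangent_map A A"

section \<open>The group multiplication in coordinates\<close>

lemma prod_atlas_carrier: "manifold_carrier (prod_atlas A A) = carrier G \<times> carrier G"
  unfolding carrier_eq[symmetric] manifold_carrier_def prod_atlas_def by force

lemma mult_isCont: "x \<in> carrier G \<Longrightarrow> y \<in> carrier G \<Longrightarrow> isCont (\<lambda>(x, y). x \<cdot> y) (x, y)"
  using lie carrier_open unfolding lie_group_def smooth_map_def prod_atlas_carrier
  by (metis carrier_eq continuous_on_eq_continuous_at mem_Sigma_iff open_Times)

text \<open>Coordinates of those pairs whose product falls into the chart e; only there does
  \<open>mult_coords\<close> represent the multiplication.\<close>

definition mult_domain :: "('a, 'e) chart \<Rightarrow> ('a, 'e) chart \<Rightarrow> ('a, 'e) chart \<Rightarrow> ('e \<times> 'e) set" where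
  "mult_domain c d e = {(y, z). y \<in> chart_image c \<and> z \<in> chart_image d \<and> chart_inv c y \<cdot> chart_inv d z \<in> fst e}"

definition mult_coords :: "('a, 'e) chart \<Rightarrow> ('a, 'e) chart \<Rightarrow> ('a, 'e) chart \<Rightarrow> 'e \<times> 'e \<Rightarrow> 'e" where
  "mult_coords c d e = (\<lambda>(y, z). snd e (chart_inv c y \<cdot> chart_inv d z))"

lemma chart_inv_carrier: "c \<in> A \<Longrightarrow> y \<in> chart_image c \<Longrightarrow> chart_inv c y \<in> carrier G"
  unfolding carrier_eq[symmetric] by (rule charts_at_carrier[OF charts_atI[OF _ chart_inv_in]])

lemma mult_domain_open:
  assumes c: "c \<in> A" and d: "d \<in> A" and e: "e \<in> A"
  shows "open (mult_domain c d e)"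
proof -
  let ?h = "\<lambda>u. chart_inv c (fst u) \<cdot> chart_inv d (snd u)"
  have "isCont ?h u" if "u \<in> chart_image c \<times> chart_image d" for u
  proof -
    have 1: "isCont (\<lambda>u. (chart_inv c (fst u), chart_inv d (snd u))) u"
      using that c d by (auto intro!: continuous_intros isCont_o2[OF _ chart_inv_isCont])
    have 2: "isCont (\<lambda>(x, y). x \<cdot> y) (chart_inv c (fst u), chart_inv d (snd u))"
      using that c d by (intro mult_isCont chart_inv_carrier) auto
    show ?thesis using isCont_o2[OF 1 2] by simp
  qed
  then have "open ((chart_image c \<times> chart_image d) \<inter> ?h -` fst e)"
    by (intro continuous_open_preimage continuous_at_imp_continuous_on ballI open_Times
        chart_image_open chart_open c d e)
  also have "(chart_image c \<times> chart_image d) \<inter> ?h -` fst e = mult_domain c d e"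
    by (auto simp: mult_domain_def)
  finally show ?thesis .
qed

lemma mult_coords_smooth:
  assumes c: "c \<in> A" and d: "d \<in> A" and e: "e \<in> A"
  shows "smooth_on (mult_coords c d e) (mult_domain c d e)"
proof -
  let ?c = "(fst c \<times> fst d, map_prod (snd c) (snd d))" and ?m = "\<lambda>(x, y). x \<cdot> y"
  have inj: "inj_on (map_prod (snd c) (snd d)) (fst c \<times> fst d)"
    by (intro map_prod_inj_on inj_on_inverseI[where g = "chart_inv c"] inj_on_inverseI[where g = "chart_inv d"])
       (simp_all add: chart_inv_chart c d)
  \<comment> \<open>\<open>chart_inv\<close> of the product chart is \<open>inv_into\<close> on a
    product of domains; injectivity identifies it with the pair of the two inverses.\<close>
  have inv: "chart_inv ?c (y, z) = (chart_inv c y, chart_inv d z)"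
    if "y \<in> chart_image c" "z \<in> chart_image d" for y z
    unfolding chart_inv_def fst_conv snd_conv
  proof (rule inv_into_f_eq[OF inj])
    show "(inv_into (fst c) (snd c) y, inv_into (fst d) (snd d) z) \<in> fst c \<times> fst d"
      using that chart_inv_in c d by (simp add: chart_inv_def)
    show "map_prod (snd c) (snd d) (inv_into (fst c) (snd c) y, inv_into (fst d) (snd d) z) = (y, z)"
      using that chart_chart_inv c d by (simp add: chart_inv_def)
  qed
  have "?c \<in> prod_atlas A A" unfolding prod_atlas_def using c d by blast
  then have "smooth_on (snd e \<circ> ?m \<circ> chart_inv ?c) (snd ?c ` (fst ?c \<inter> ?m -` fst e))"
    using lie e unfolding lie_group_def smooth_map_def by blast
  moreover have "mult_domain c d e \<subseteq> snd ?c ` (fst ?c \<inter> ?m -` fst e)"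
  proof
    fix u assume "u \<in> mult_domain c d e"
    then obtain y z where u: "u = (y, z)" "y \<in> chart_image c" "z \<in> chart_image d"
      "chart_inv c y \<cdot> chart_inv d z \<in> fst e" by (auto simp: mult_domain_def)
    then have "u = snd ?c (chart_inv c y, chart_inv d z)"
      using chart_chart_inv c d by simp
    then show "u \<in> snd ?c ` (fst ?c \<inter> ?m -` fst e)"
      using u chart_inv_in c d by (intro image_eqI[where x = "(chart_inv c y, chart_inv d z)"]) auto
  qed
  ultimately have "smooth_on (snd e \<circ> ?m \<circ> chart_inv ?c) (mult_domain c d e)"
    by (rule smooth_on_subset)
  then show ?thesis
    by (subst smooth_on_cong[OF mult_domain_open[OF c d e], of _ "snd e \<circ> ?m \<circ> chart_inv ?c"])
       (auto simp: mult_coords_def mult_domain_def inv)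
qed

lemma mult_domain_mem:
  "c \<in> charts_at A x \<Longrightarrow> d \<in> charts_at A y \<Longrightarrow> e \<in> charts_at A (x \<cdot> y) \<Longrightarrow>
   (snd c x, snd d y) \<in> mult_domain c d e"
  by (simp add: mult_domain_def chart_inv_chart_at chart_in_image charts_atD)

lemma mult_coords_has_derivative:
  assumes "c \<in> charts_at A x" "d \<in> charts_at A y" "e \<in> charts_at A (x \<cdot> y)"
  shows "(mult_coords c d e has_derivative fderiv (mult_coords c d e) (snd c x, snd d y)) (at (snd c x, snd d y))"
  by (rule smooth_on_has_derivative[OF mult_coords_smooth mult_domain_mem[OF assms]])
     (rule charts_atD(1)[OF assms(1)] charts_atD(1)[OF assms(2)] charts_atD(1)[OF assms(3)])+

text \<open>The differential of a right translation is the partial derivative of the multiplication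
  in the first factor; left translations give the second. The product rule for curves rests on this
  splitting.\<close>

lemma right_translation_coords:
  assumes c: "c \<in> charts_at A x" and d: "d \<in> charts_at A y" and e: "e \<in> charts_at A (x \<cdot> y)"
  shows "((snd e \<circ> R y \<circ> chart_inv c) has_derivative
    (\<lambda>v. fderiv (mult_coords c d e) (snd c x, snd d y) (v, 0))) (at (snd c x))"
proof -
  have "((\<lambda>z. (z, snd d y)) has_derivative (\<lambda>v. (v, 0))) (at (snd c x))"
    by (auto intro!: derivative_eq_intros)
  from has_derivative_compose[OF this mult_coords_has_derivative[OF assms]]
  show ?thesis
    by (simp add: mult_coords_def right_translation_def chart_inv_chart_at[OF d] o_def)
qed

lemma left_translation_coords:
  assumes c: "c \<in> charts_at A x" and d: "d \<in> charts_at A y" and e: "e \<in> charts_at A (x \<cdot> y)"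
  shows "((snd e \<circ> L x \<circ> chart_inv d) has_derivative
    (\<lambda>v. fderiv (mult_coords c d e) (snd c x, snd d y) (0, v))) (at (snd d y))"
proof -
  have "((\<lambda>z. (snd c x, z)) has_derivative (\<lambda>v. (0, v))) (at (snd d y))"
    by (auto intro!: derivative_eq_intros)
  from has_derivative_compose[OF this mult_coords_has_derivative[OF assms]]
  show ?thesis
    by (simp add: mult_coords_def left_translation_def chart_inv_chart_at[OF c] o_def)
qed

lemma left_isometry: "x \<in> carrier G \<Longrightarrow> riemannian_isometry A g (L x)"
  using left_inv by (simp add: left_invariant_metric_def)

lemma left_differentiable:
  assumes "x \<in> carrier G" "y \<in> carrier G" shows "differentiable_map_at (L x) y"
  using left_isometry[OF assms(1)] assms(2)
  by (intro smooth_map_differentiable) (simp_all add: riemannian_isometry_def carrier_eq)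

lemma right_differentiable:
  assumes x: "x \<in> carrier G" and y: "y \<in> carrier G"
  shows "differentiable_map_at (R y) x"
  unfolding differentiable_map_at_def
proof (intro conjI ballI)
  show "x \<in> manifold_carrier A" "R y x \<in> manifold_carrier A"
    using x y by (simp_all add: carrier_eq right_translation_def)
  have "isCont (\<lambda>x. (x, y)) x" by (intro continuous_intros)
  from isCont_o2[OF this mult_isCont[OF x y]]
  show "isCont (R y) x" by (simp add: right_translation_def)
  obtain d where d: "d \<in> charts_at A y" using y charts_at_obtain carrier_eq by metis
  fix c e assume c: "c \<in> charts_at A x" and "e \<in> charts_at A (R y x)"
  then have "e \<in> charts_at A (x \<cdot> y)" by (simp add: right_translation_def)
  from right_translation_coords[OF c d this]
  show "(snd e \<circ> R y \<circ> chart_inv c) differentiable at (snd c x)"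
    by (rule differentiableI)
qed

lemma has_velocity_right:
  "has_velocity \<alpha> v t S \<Longrightarrow> y \<in> carrier G \<Longrightarrow> has_velocity (\<lambda>s. \<alpha> s \<cdot> y) (TM (R y) (\<alpha> t) v) t S"
  using has_velocity_map[of \<alpha> v t S "R y"] right_differentiable has_velocity_carrier carrier_eq
  by (simp add: right_translation_def[of G y, THEN fun_cong])

lemma has_velocity_left:
  "has_velocity \<alpha> v t S \<Longrightarrow> x \<in> carrier G \<Longrightarrow> has_velocity (\<lambda>s. x \<cdot> \<alpha> s) (TM (L x) (\<alpha> t) v) t S"
  using has_velocity_map[of \<alpha> v t S "L x"] left_differentiable has_velocity_carrier carrier_eq
  by (simp add: left_translation_def[of G x, THEN fun_cong])

text \<open>Leibniz rule: by linearity the differential of the multiplication at (v, w) is the sum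
  of its values at (v, 0) and (0, w), which are the differentials of right translation by \<beta> t
  and left translation by \<alpha> t.\<close>

lemma has_velocity_mult:
  assumes \<alpha>: "has_velocity \<alpha> v t S" and \<beta>: "has_velocity \<beta> w t S"
  shows "has_velocity (\<lambda>s. \<alpha> s \<cdot> \<beta> s) (TM (R (\<beta> t)) (\<alpha> t) v + TM (L (\<alpha> t)) (\<beta> t) w) t S"
proof -
  let ?x = "\<alpha> t" and ?y = "\<beta> t" and ?u = "TM (R (\<beta> t)) (\<alpha> t) v + TM (L (\<alpha> t)) (\<beta> t) w"
  have x: "?x \<in> carrier G" and y: "?y \<in> carrier G"
    using has_velocity_carrier[OF \<alpha>] has_velocity_carrier[OF \<beta>] by (simp_all add: carrier_eq)
  have xy: "?x \<cdot> ?y \<in> manifold_carrier A" using x y by (simp add: carrier_eq)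
  obtain c where c: "c \<in> charts_at A ?x" by (rule charts_at_obtain[OF has_velocity_carrier[OF \<alpha>]])
  obtain d where d: "d \<in> charts_at A ?y" by (rule charts_at_obtain[OF has_velocity_carrier[OF \<beta>]])
  obtain e where e: "e \<in> charts_at A (?x \<cdot> ?y)" by (rule charts_at_obtain[OF xy])
  have t: "t \<in> S" and ca: "continuous (at t within S) \<alpha>" and cb: "continuous (at t within S) \<beta>"
    using \<alpha> \<beta> by (auto simp: has_velocity_def)
  have u: "?u \<in> T (?x \<cdot> ?y)"
    using tangent_map_in[OF right_differentiable[OF x y] has_velocity_tangent[OF \<alpha>]]
      tangent_map_in[OF left_differentiable[OF x y] has_velocity_tangent[OF \<beta>]]
    by (intro tangent_space_add) (simp_all add: right_translation_def left_translation_def)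
  have cont: "continuous (at t within S) (\<lambda>s. \<alpha> s \<cdot> \<beta> s)"
    using continuous_within_compose3[OF mult_isCont[OF x y] continuous_Pair[OF ca cb]] by simp
  let ?D = "fderiv (mult_coords c d e) (snd c ?x, snd d ?y)"
  note D = mult_coords_has_derivative[OF c d e]
  have "((\<lambda>s. (snd c (\<alpha> s), snd d (\<beta> s))) has_derivative (\<lambda>h. (h *\<^sub>R v c, h *\<^sub>R w d))) (at t within S)"
    using has_velocity_coords[OF \<alpha> c] has_velocity_coords[OF \<beta> d]
    by (intro has_derivative_Pair) (simp_all add: has_vector_derivative_def)
  from has_derivative_compose[OF this D]
  have "((\<lambda>s. mult_coords c d e (snd c (\<alpha> s), snd d (\<beta> s))) has_derivative
      (\<lambda>h. ?D (h *\<^sub>R (v c, w d)))) (at t within S)" by simp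
  also have "(\<lambda>h. ?D (h *\<^sub>R (v c, w d))) = (\<lambda>h. h *\<^sub>R ?u e)"
  proof
    fix h :: real
    have "?u e = ?D (v c, 0) + ?D (0, w d)"
      using tangent_map_coords[OF right_differentiable[OF x y] has_velocity_tangent[OF \<alpha>] c]
        tangent_map_coords[OF left_differentiable[OF x y] has_velocity_tangent[OF \<beta>] d]
        fderiv_eqI[OF right_translation_coords[OF c d e]] fderiv_eqI[OF left_translation_coords[OF c d e]] e
      by (simp add: right_translation_def[of G, THEN fun_cong] left_translation_def[of G, THEN fun_cong])
    also have "\<dots> = ?D (v c, w d)"
      using linear_add[OF has_derivative_linear[OF D], of "(v c, 0)" "(0, w d)"] by simp
    finally show "?D (h *\<^sub>R (v c, w d)) = h *\<^sub>R ?u e"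
      using linear_cmul[OF has_derivative_linear[OF D], of h "(v c, w d)"] by simp
  qed
  finally have "((\<lambda>s. snd e (\<alpha> s \<cdot> \<beta> s)) has_derivative (\<lambda>h. h *\<^sub>R ?u e)) (at t within S)"
  proof (rule has_derivative_transform_eventually)
    show "\<forall>\<^sub>F s in at t within S. mult_coords c d e (snd c (\<alpha> s), snd d (\<beta> s)) = snd e (\<alpha> s \<cdot> \<beta> s)"
      using eventually_curve[OF ca eventually_in_chart[OF c]] eventually_curve[OF cb eventually_in_chart[OF d]]
      by eventually_elim (use c d in \<open>simp add: mult_coords_def charts_at_def chart_inv_chart\<close>)
  qed (simp_all add: mult_coords_def chart_inv_chart_at[OF c] chart_inv_chart_at[OF d] t)
  then have "has_velocity (\<lambda>s. \<alpha> s \<cdot> \<beta> s) (tangent_of_coords A e (?x \<cdot> ?y) (?u e)) t S"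
    by (intro has_velocityI e cont t) (simp add: has_vector_derivative_def)
  then show ?thesis by (simp only: tangent_of_coords_coords[OF u e])
qed

end

section \<open>Right-invariant vector fields\<close>

context left_invariant_lie_group begin

lemma isometry_metric:
  "riemannian_isometry A g f \<Longrightarrow> p \<in> manifold_carrier A \<Longrightarrow> v \<in> T p \<Longrightarrow> w \<in> T p \<Longrightarrow>
   g (f p) (TM f p v) (TM f p w) = g p v w"
  by (simp add: riemannian_isometry_def)

definition right_field :: "('a, 'e) tangent \<Rightarrow> 'a \<Rightarrow> ('a, 'e) tangent" where
  "right_field \<xi> x = TM (R x) \<one>\<^bsub>G\<^esub> \<xi>"

lemma right_field_in:
  assumes "\<xi> \<in> T \<one>\<^bsub>G\<^esub>" "x \<in> carrier G"
  shows "right_field \<xi> x \<in> T x"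
  using tangent_map_in[OF right_differentiable[OF one_closed assms(2)] assms(1)] assms(2)
  by (simp add: right_field_def right_translation_def[of G, THEN fun_cong])

lemma curve_at_one:
  assumes "\<xi> \<in> T \<one>\<^bsub>G\<^esub>"
  obtains \<alpha> where "has_velocity \<alpha> \<xi> 0 UNIV" "\<alpha> 0 = \<one>\<^bsub>G\<^esub>"
proof -
  have "\<one>\<^bsub>G\<^esub> \<in> manifold_carrier A" by (simp add: carrier_eq)
  then obtain c where c: "c \<in> charts_at A \<one>\<^bsub>G\<^esub>" by (rule charts_at_obtain)
  show ?thesis
    by (rule that[OF has_velocity_exists[OF assms c]]) (simp add: chart_inv_chart_at[OF c])
qed

lemma has_velocity_eventually_carrier:
  assumes "has_velocity \<alpha> v t S"
  shows "\<forall>\<^sub>F s in at t within S. \<alpha> s \<in> carrier G"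
proof (rule eventually_curve[where P = "\<lambda>q. q \<in> carrier G"])
  show "continuous (at t within S) \<alpha>" using assms by (simp add: has_velocity_def)
  show "\<forall>\<^sub>F q in nhds (\<alpha> t). q \<in> carrier G"
    using carrier_open has_velocity_carrier[OF assms] by (simp add: eventually_nhds_in_open carrier_eq)
qed

text \<open>Associativity read on a curve \<alpha> with velocity \<xi> at the identity: its two
  bracketings have the two sides as velocities. As \<alpha> is known to lie in the group only for s
  near 0, the curves are compared eventually.\<close>

lemma right_field_right_invariant:
  assumes \<xi>: "\<xi> \<in> T \<one>\<^bsub>G\<^esub>" and x: "x \<in> carrier G" and y: "y \<in> carrier G"
  shows "TM (R y) x (right_field \<xi> x) = right_field \<xi> (x \<cdot> y)"
proof -
  obtain \<alpha> where \<alpha>: "has_velocity \<alpha> \<xi> 0 UNIV" "\<alpha> 0 = \<one>\<^bsub>G\<^esub>" by (rule curve_at_one[OF \<xi>])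
  have xy: "x \<cdot> y \<in> carrier G" using x y by simp
  have "has_velocity (\<lambda>s. \<alpha> s \<cdot> x \<cdot> y) (TM (R y) x (right_field \<xi> x)) 0 UNIV"
    using has_velocity_right[OF has_velocity_right[OF \<alpha>(1) x] y] x by (simp add: \<alpha>(2) right_field_def)
  moreover have  "\<forall>\<^sub>F s in at 0. \<alpha> s \<cdot> x \<cdot> y = \<alpha> s \<cdot> (x \<cdot> y)"
    using has_velocity_eventually_carrier[OF \<alpha>(1)] by eventually_elim (simp add: m_assoc x y)
  ultimately have "has_velocity (\<lambda>s. \<alpha> s \<cdot> (x \<cdot> y)) (TM (R y) x (right_field \<xi> x)) 0 UNIV"
    by (rule has_velocity_cong) (simp add: \<alpha>(2) x y)
  moreover have "has_velocity (\<lambda>s. \<alpha> s \<cdot> (x \<cdot> y)) (right_field \<xi> (x \<cdot> y)) 0 UNIV"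
    using has_velocity_right[OF \<alpha>(1) xy] by (simp add: \<alpha>(2) right_field_def)
  ultimately show ?thesis by (rule has_velocity_unique) simp
qed

text \<open>Right translation by the inverse of q moves v to the identity, and translating back
  recovers it. This supplies both the field K and the right-invariant test fields at \<gamma>
  \<tau>.\<close>

lemma right_field_surj:
  assumes q: "q \<in> carrier G" and v: "v \<in> T q"
  obtains \<xi> where "\<xi> \<in> T \<one>\<^bsub>G\<^esub>" "right_field \<xi> q = v"
proof -
  have "q \<in> manifold_carrier A" using q by (simp add: carrier_eq)
  then obtain c where c: "c \<in> charts_at A q" by (rule charts_at_obtain)
  define \<alpha> where "\<alpha> = (\<lambda>s. chart_inv c (snd c q + s *\<^sub>R v c))"
  have \<alpha>: "has_velocity \<alpha> v 0 UNIV" unfolding \<alpha>_def by (rule has_velocity_exists[OF v c])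
  have \<alpha>0: "\<alpha> 0 = q" by (simp add: \<alpha>_def chart_inv_chart_at[OF c])
  let ?\<xi> = "TM (R (inv\<^bsub>G\<^esub> q)) q v"
  have \<beta>: "has_velocity (\<lambda>s. \<alpha> s \<cdot> inv\<^bsub>G\<^esub> q) ?\<xi> 0 UNIV"
    using has_velocity_right[OF \<alpha>, of "inv\<^bsub>G\<^esub> q"] q by (simp add: \<alpha>0)
  have \<xi>: "?\<xi> \<in> T \<one>\<^bsub>G\<^esub>"
    using has_velocity_tangent[OF \<beta>] q by (simp add: \<alpha>0)
  have "has_velocity (\<lambda>s. \<alpha> s \<cdot> inv\<^bsub>G\<^esub> q \<cdot> q) (right_field ?\<xi> q) 0 UNIV"
    using has_velocity_right[OF \<beta> q] q by (simp add: \<alpha>0 right_field_def)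
  moreover have  "\<forall>\<^sub>F s in at 0. \<alpha> s \<cdot> inv\<^bsub>G\<^esub> q \<cdot> q = \<alpha> s"
    using has_velocity_eventually_carrier[OF \<alpha>] by eventually_elim (simp add: m_assoc q)
  ultimately have "has_velocity \<alpha> (right_field ?\<xi> q) 0 UNIV"
    by (rule has_velocity_cong) (simp add: \<alpha>0 q)
  then have "right_field ?\<xi> q = v" by (rule has_velocity_unique[OF _ \<alpha>]) simp
  with \<xi> show ?thesis by (rule that)
qed

text \<open>In charts the multiplication is a family of left translations with the left factor as
  parameter, so \<open>killing_field_of_isometries\<close> applies, with y0 the coordinates of the
  identity in the chart b. The derivative in this parameter is the differential of right
  translation, that is \<open>right_field\<close>.\<close>

lemma right_field_killing:
  assumes \<xi>: "\<xi> \<in> T \<one>\<^bsub>G\<^esub>"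
  shows "killing_vector_field (right_field \<xi>)"
  unfolding killing_vector_field_def
proof (intro conjI ballI)
  show "right_field \<xi> p \<in> T p" if "p \<in> manifold_carrier A" for p
    using that by (intro right_field_in[OF \<xi>]) (simp add: carrier_eq)
  fix c assume c: "c \<in> A"
  have "\<one>\<^bsub>G\<^esub> \<in> manifold_carrier A" by (simp add: carrier_eq)
  then obtain b where b: "b \<in> charts_at A \<one>\<^bsub>G\<^esub>" by (rule charts_at_obtain)
  have bA: "b \<in> A" by (rule charts_atD(1)[OF b])
  interpret coord_metric "chart_image c" "gc c" by (rule chart_metric[OF c])
  let ?m = "mult_coords b c c" and ?W = "mult_domain b c c" and ?y = "snd b \<one>\<^bsub>G\<^esub>"
  have ch: "chart_inv c z \<in> carrier G" "c \<in> charts_at A (chart_inv c z)" "snd c (chart_inv c z) = z"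
    if "z \<in> chart_image c" for z
    using that by (simp_all add: c chart_inv_carrier charts_atI chart_inv_in chart_chart_inv)
  show "killing_field (chart_image c) (gc c) (\<lambda>x. right_field \<xi> (chart_inv c x) c)"
  proof (rule killing_field_cong[OF killing_field_of_isometries[OF mult_coords_smooth[OF bA c c] mult_domain_open[OF bA c c]]])
    fix z assume z: "z \<in> chart_image c"
    show "(?y, z) \<in> ?W \<and> ?m (?y, z) = z"
      using mult_domain_mem[OF b ch(2)[OF z], of c] ch[OF z]
      by (simp add: mult_coords_def chart_inv_chart_at[OF b])
    have c1: "c \<in> charts_at A (\<one>\<^bsub>G\<^esub> \<cdot> chart_inv c z)" using ch[OF z] by simp
    have "right_field \<xi> (chart_inv c z) c
      = fderiv (snd c \<circ> R (chart_inv c z) \<circ> chart_inv b) ?y (\<xi> b)"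
      unfolding right_field_def
      by (rule tangent_map_coords[OF right_differentiable[OF one_closed ch(1)[OF z]] \<xi> b])
         (use c1 in \<open>simp add: right_translation_def\<close>)
    then show "fderiv ?m (?y, z) (\<xi> b, 0) = right_field \<xi> (chart_inv c z) c"
      using fderiv_eqI[OF right_translation_coords[OF b ch(2)[OF z] c1]] ch(3)[OF z] by simp
  next
    fix y z v w assume W: "(y, z) \<in> ?W" and z: "z \<in> chart_image c"
    define a p where "a = chart_inv b y" and "p = chart_inv c z"
    have y: "y \<in> chart_image b" using W by (simp add: mult_domain_def)
    have a: "a \<in> carrier G" "b \<in> charts_at A a" "snd b a = y"
      using y by (simp_all add: a_def bA chart_inv_carrier charts_atI chart_inv_in chart_chart_inv)
    have p: "p \<in> carrier G" "c \<in> charts_at A p" "snd c p = z" using ch[OF z] by (simp_all add: p_def)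
    have ap: "c \<in> charts_at A (a \<cdot> p)"
      using W c by (simp add: mult_domain_def a_def p_def charts_atI)
    have Lap: "L a p = a \<cdot> p" by (simp add: left_translation_def)
    have pm: "p \<in> manifold_carrier A" using p by (simp add: carrier_eq)
    let ?t = "tangent_of_coords A c p"
    have L: "TM (L a) p (?t v) c = fderiv ?m (y, z) (0, v)" for v
      using tangent_map_coords[OF left_differentiable[OF a(1) p(1)] tangent_of_coords_in[OF p(2)] p(2)] ap
        fderiv_eqI[OF left_translation_coords[OF a(2) p(2) ap]]
      by (simp add: Lap a(3) p(3) tangent_of_coords_same[OF p(2)])
    have L_in: "TM (L a) p (?t v) \<in> T (a \<cdot> p)" for v
      using tangent_map_in[OF left_differentiable[OF a(1) p(1)] tangent_of_coords_in[OF p(2)]] by (simp add: Lap)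
    have "gc c z v w = g p (?t v) (?t w)"
      using metric_in_chart[OF p(2) tangent_of_coords_in[OF p(2)] tangent_of_coords_in[OF p(2)]]
      by (simp add: p(3) tangent_of_coords_same[OF p(2)])
    also have "\<dots> = g (a \<cdot> p) (TM (L a) p (?t v)) (TM (L a) p (?t w))"
      using isometry_metric[OF left_isometry[OF a(1)] pm tangent_of_coords_in[OF p(2)]
          tangent_of_coords_in[OF p(2)]] by (simp add: Lap)
    also have "\<dots> = gc c (?m (y, z)) (fderiv ?m (y, z) (0, v)) (fderiv ?m (y, z) (0, w))"
    proof -
      have "?m (y, z) = snd c (a \<cdot> p)" by (simp add: mult_coords_def a_def p_def)
      then show ?thesis using metric_in_chart[OF ap L_in L_in] by (simp only: L)
    qed
    finally show "gc c (?m (y, z)) (fderiv ?m (y, z) (0, v)) (fderiv ?m (y, z) (0, w)) = gc c z v w" ..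
  qed
qed

lemma inv_differentiable: "x \<in> carrier G \<Longrightarrow> differentiable_map_at (\<lambda>x. inv\<^bsub>G\<^esub> x) x"
  using lie by (intro smooth_map_differentiable) (simp_all add: lie_group_def carrier_eq)

text \<open>The quotient of two integral curves of a right-invariant field has zero velocity.\<close>

lemma integral_curve_increment:
  assumes I: "is_interval I" and \<xi>: "\<xi> \<in> T \<one>\<^bsub>G\<^esub>"
    and \<gamma>: "\<And>t. t \<in> I \<Longrightarrow> has_velocity \<gamma> (right_field \<xi> (\<gamma> t)) t I"
    and ab: "a \<in> I" "b \<in> I" "a + k \<in> I" "b + k \<in> I" "a < b"
  shows "inv\<^bsub>G\<^esub> (\<gamma> a) \<cdot> \<gamma> (a + k) = inv\<^bsub>G\<^esub> (\<gamma> b) \<cdot> \<gamma> (b + k)"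
proof (rule zero_velocity_constant[where S = "{a..b}" and \<beta> = "\<lambda>r. inv\<^bsub>G\<^esub> (\<gamma> r) \<cdot> \<gamma> (r + k)"])
  show S: "is_interval {a..b}" by (rule is_interval_cc)
  show "a \<in> {a..b}" "b \<in> {a..b}" using ab(5) by auto
  have rI: "r \<in> I" "r + k \<in> I" if "r \<in> {a..b}" for r
    using that ab mem_is_interval_1_I[OF I ab(1,2), of r] mem_is_interval_1_I[OF I ab(3,4), of "r + k"] by auto
  have \<gamma>G: "\<gamma> r \<in> carrier G" if "r \<in> I" for r
    using has_velocity_carrier[OF \<gamma>[OF that]] by (simp add: carrier_eq)
  fix r assume r: "r \<in> {a..b}"
  let ?S = "{a..b}" and ?x = "\<gamma> r" and ?y = "\<gamma> (r + k)"
  have x: "?x \<in> carrier G" and y: "?y \<in> carrier G" using rI[OF r] \<gamma>G by auto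
  have 1: "has_velocity \<gamma> (right_field \<xi> ?x) r ?S"
    by (rule has_velocity_subset[OF \<gamma>[OF rI(1)[OF r]]]) (use rI r in auto)
  have 2: "has_velocity (\<lambda>r. \<gamma> (r + k)) (right_field \<xi> ?y) r ?S"
    by (rule has_velocity_shift[OF \<gamma>[OF rI(2)[OF r]] r rI(2)])
  let ?b = "\<lambda>r. inv\<^bsub>G\<^esub> (\<gamma> r) \<cdot> \<gamma> (r + k)"
  \<comment> \<open>Only the existence of a velocity w is taken from the product rule; its value is
    extracted below from \<gamma>(s) b(s) = \<gamma>(s + k), which avoids computing the differential
    of inversion.\<close>
  obtain w where b: "has_velocity ?b w r ?S"
    using has_velocity_mult[OF has_velocity_map[OF 1 inv_differentiable[OF x]] 2] by blast
  have bG: "?b r \<in> carrier G" using x y by simp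
  have eq: "\<gamma> s \<cdot> ?b s = \<gamma> (s + k)" if "s \<in> ?S" for s
    using \<gamma>G[OF rI(1)[OF that]] \<gamma>G[OF rI(2)[OF that]] by (simp add: m_assoc[symmetric])
  have "\<forall>\<^sub>F s in at r within ?S. \<gamma> s \<cdot> ?b s = \<gamma> (s + k)"
    using eq by (simp add: eventually_at_filter)
  from has_velocity_cong[OF has_velocity_mult[OF 1 b] this eq[OF r]]
  have 3: "has_velocity (\<lambda>r. \<gamma> (r + k))
      (TM (R (?b r)) ?x (right_field \<xi> ?x) + TM (L ?x) (?b r) w) r ?S" .
  \<comment> \<open>By right invariance the first Leibniz term is already the full velocity of
    \<gamma>(r + k), so the second one, the left translate of w, vanishes.\<close>
  have 4: "TM (R (?b r)) ?x (right_field \<xi> ?x) = right_field \<xi> ?y"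
    using right_field_right_invariant[OF \<xi> x bG] eq[OF r] by simp
  have "at r within ?S \<noteq> bot"
    by (rule interval_nontrivial[OF S, of a b]) (use ab(5) r in auto)
  then have "right_field \<xi> ?y + TM (L ?x) (?b r) w = right_field \<xi> ?y"
    by (rule has_velocity_unique[OF 3[unfolded 4] 2])
  then have "TM (L ?x) (?b r) w = 0" by simp
  then have "w = 0"
    by (rule isometry_tangent_map_inj[OF left_isometry[OF x], rotated 2])
       (use bG has_velocity_tangent[OF b] in \<open>simp_all add: carrier_eq\<close>)
  with b show "has_velocity ?b 0 r ?S" by simp
qed

text \<open>Left velocities at different times become derivatives of curves through the identity,
  which can be compared through their increments. The set S admits one-sided increments at the
  endpoints of I.\<close>

lemma left_velocity_has_velocity:
  assumes \<gamma>: "has_velocity \<gamma> (velocity A I \<gamma> t) t I" and S: "0 \<in> S" "\<And>k. k \<in> S \<Longrightarrow> t + k \<in> I"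
  shows "has_velocity (\<lambda>k. inv\<^bsub>G\<^esub> (\<gamma> t) \<cdot> \<gamma> (t + k)) (left_velocity G A I \<gamma> t) 0 S"
proof -
  have G: "inv\<^bsub>G\<^esub> (\<gamma> t) \<in> carrier G" using has_velocity_carrier[OF \<gamma>] by (simp add: carrier_eq)
  have "has_velocity \<gamma> (velocity A I \<gamma> t) (0 + t) I" using \<gamma> by simp
  from has_velocity_left[OF has_velocity_shift[OF this, of S] G] S
  show ?thesis by (simp add: left_velocity_def add.commute)
qed

text \<open>By \<open>integral_curve_increment\<close> the increment over a duration k does not
  depend on the starting time, so neither does its derivative at k = 0.\<close>

lemma left_velocity_integral_curve:
  assumes I: "is_interval I" and \<xi>: "\<xi> \<in> T \<one>\<^bsub>G\<^esub>"
    and \<gamma>: "\<And>t. t \<in> I \<Longrightarrow> has_velocity \<gamma> (velocity A I \<gamma> t) t I"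
    and u: "\<And>t. t \<in> I \<Longrightarrow> velocity A I \<gamma> t = right_field \<xi> (\<gamma> t)"
    and ab: "a \<in> I" "b \<in> I" "a < b"
  shows "left_velocity G A I \<gamma> a = left_velocity G A I \<gamma> b"
proof -
  have \<gamma>': "has_velocity \<gamma> (right_field \<xi> (\<gamma> t)) t I" if "t \<in> I" for t
    using \<gamma>[OF that] u[OF that] by simp
  have step: "left_velocity G A I \<gamma> s = left_velocity G A I \<gamma> t"
    if st: "s < t" "s \<in> I" "t \<in> I" and S: "is_interval S" "0 \<in> S" "l \<in> S" "l \<noteq> 0"
      "\<And>k. k \<in> S \<Longrightarrow> s + k \<in> I" "\<And>k. k \<in> S \<Longrightarrow> t + k \<in> I" for s t l S
  proof -
    have eq: "inv\<^bsub>G\<^esub> (\<gamma> s) \<cdot> \<gamma> (s + k) = inv\<^bsub>G\<^esub> (\<gamma> t) \<cdot> \<gamma> (t + k)" if "k \<in> S" for k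
      by (rule integral_curve_increment[OF I \<xi> \<gamma>' st(2,3) S(5)[OF that] S(6)[OF that] st(1)])
    then have "\<forall>\<^sub>F k in at 0 within S. inv\<^bsub>G\<^esub> (\<gamma> s) \<cdot> \<gamma> (s + k) = inv\<^bsub>G\<^esub> (\<gamma> t) \<cdot> \<gamma> (t + k)"
      by (auto simp: eventually_at_filter)
    from has_velocity_cong[OF left_velocity_has_velocity[OF \<gamma>[OF st(2)] S(2,5)] this eq[OF S(2)]]
    have "has_velocity (\<lambda>k. inv\<^bsub>G\<^esub> (\<gamma> t) \<cdot> \<gamma> (t + k)) (left_velocity G A I \<gamma> s) 0 S" .
    from has_velocity_unique[OF this left_velocity_has_velocity[OF \<gamma>[OF st(3)] S(2,6)]
        interval_nontrivial[OF S(1,2,3) S(4)[symmetric] S(2)]]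
    show ?thesis .
  qed
  \<comment> \<open>Only one-sided increments are available at the endpoints of \<open>I\<close>, so both \<open>a\<close> and \<open>b\<close> are
    compared with an interior point.\<close>
  define m where "m = (a + b) / 2"
  have m: "a < m" "m < b" using ab(3) by (simp_all add: m_def field_simps)
  have ivl: "r \<in> I" if "a \<le> r" "r \<le> b" for r by (rule mem_is_interval_1_I[OF I ab(1,2) that])
  \<comment> \<open>Since m is the midpoint, forward increments up to m - a carry m exactly to b,
    and backward increments down to m - b carry it exactly to a; both stay in I.\<close>
  have "left_velocity G A I \<gamma> a = left_velocity G A I \<gamma> m"
    by (rule step[where S = "{0..m - a}" and l = "m - a"])
       (use ab m in \<open>auto intro!: ivl is_interval_cc simp: m_def field_simps\<close>)
  also have "\<dots> = left_velocity G A I \<gamma> b"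
    by (rule step[where S = "{m - b..0}" and l = "m - b"])
       (use ab m in \<open>auto intro!: ivl is_interval_cc simp: m_def field_simps\<close>)
  finally show ?thesis .
qed

text \<open>\<open>transport\<close> is the common core of the two cases of the theorem: for K with
  initial value \<gamma>' 0, the pairing with any right-invariant field is the same at both ends.
  Combined with momentum conservation, \<gamma>' \<tau> and K (\<gamma> \<tau>) pair equally with
  every vector there. Nonconstancy of the left velocity is what makes J nontrivial.\<close>

theorem conjugate_if_momentum_transported:
  assumes I: "is_interval I" "0 \<in> I" "\<tau> \<in> I" "\<tau> > 0" and geod: "geodesic A g I \<gamma>"
    and nonconst: "\<not> left_velocity G A I \<gamma> constant_on I"
    and transport: "\<And>\<xi>. \<xi> \<in> T \<one>\<^bsub>G\<^esub> \<Longrightarrow> velocity A I \<gamma> 0 = right_field \<xi> (\<gamma> 0) \<Longrightarrow>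
      (\<And>\<eta>. \<eta> \<in> T \<one>\<^bsub>G\<^esub> \<Longrightarrow> g (\<gamma> 0) (velocity A I \<gamma> 0) (right_field \<eta> (\<gamma> 0))
         = g (\<gamma> \<tau>) (right_field \<xi> (\<gamma> \<tau>)) (right_field \<eta> (\<gamma> \<tau>)))"
  shows "conjugate_along A g I \<gamma> 0 \<tau>"
proof -
  have nontriv: "at t within I \<noteq> bot" if "t \<in> I" for t
    using interval_nontrivial[OF I(1,2,3) _ that] I(4) by simp
  have \<gamma>v: "has_velocity \<gamma> (velocity A I \<gamma> t) t I" if "t \<in> I" for t
    by (rule geodesic_has_velocity[OF geod nontriv that])
  have \<gamma>G: "\<gamma> t \<in> carrier G" if "t \<in> I" for t
    using has_velocity_carrier[OF \<gamma>v[OF that]] by (simp add: carrier_eq)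
  obtain \<xi> where \<xi>: "\<xi> \<in> T \<one>\<^bsub>G\<^esub>" "right_field \<xi> (\<gamma> 0) = velocity A I \<gamma> 0"
    by (rule right_field_surj[OF \<gamma>G[OF I(2)] has_velocity_tangent[OF \<gamma>v[OF I(2)]]])
  let ?J = "\<lambda>t. velocity A I \<gamma> t - right_field \<xi> (\<gamma> t)"
  have J: "jacobi_field A g I \<gamma> ?J"
    by (rule velocity_minus_killing_jacobi[OF geod nontriv right_field_killing[OF \<xi>(1)]])
  have "velocity A I \<gamma> \<tau> = right_field \<xi> (\<gamma> \<tau>)"
  proof (rule metric_nondegenerate)
    fix z assume "z \<in> T (\<gamma> \<tau>)"
    then obtain \<eta> where \<eta>: "\<eta> \<in> T \<one>\<^bsub>G\<^esub>" "right_field \<eta> (\<gamma> \<tau>) = z"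
      by (rule right_field_surj[OF \<gamma>G[OF I(3)]])
    have "g (\<gamma> \<tau>) (velocity A I \<gamma> \<tau>) z = g (\<gamma> 0) (velocity A I \<gamma> 0) (right_field \<eta> (\<gamma> 0))"
      unfolding \<eta>(2)[symmetric]
      by (rule geodesic_momentum_constant[OF geod nontriv right_field_killing[OF \<eta>(1)] I(1,3,2)])
    also have "\<dots> = g (\<gamma> \<tau>) (right_field \<xi> (\<gamma> \<tau>)) z"
      using transport[OF \<xi>(1) \<xi>(2)[symmetric] \<eta>(1)] by (simp add: \<eta>(2))
    finally show "g (\<gamma> \<tau>) (velocity A I \<gamma> \<tau>) z = g (\<gamma> \<tau>) (right_field \<xi> (\<gamma> \<tau>)) z" .
  qed (use \<gamma>G[OF I(3)] has_velocity_tangent[OF \<gamma>v[OF I(3)]] right_field_in[OF \<xi>(1)] in \<open>simp_all add: carrier_eq\<close>)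
  moreover have "\<exists>t\<in>I. ?J t \<noteq> 0"
  proof (rule ccontr)
    assume "\<not> (\<exists>t\<in>I. ?J t \<noteq> 0)"
    then have u: "velocity A I \<gamma> t = right_field \<xi> (\<gamma> t)" if "t \<in> I" for t using that by simp
    have less: "left_velocity G A I \<gamma> s = left_velocity G A I \<gamma> t" if "s \<in> I" "t \<in> I" "s < t" for s t
      by (rule left_velocity_integral_curve[OF I(1) \<xi>(1) \<gamma>v u that])
    have "left_velocity G A I \<gamma> t = left_velocity G A I \<gamma> 0" if "t \<in> I" for t
      by (rule linorder_cases[of t 0])
         (erule less[OF that I(2)] less[OF I(2) that, symmetric] | simp)+
    then show False using nonconst unfolding constant_on_def by blast
  qed
  ultimately show ?thesis
    unfolding conjugate_along_def using J \<xi>(2) by (intro exI[of _ ?J]) simp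
qed

end

theorem theorem4p1:
  fixes G :: "'a::{t2_space, second_countable_topology} monoid"
    and A :: "('a, 'e::euclidean_space) atlas"
    and g :: "('a, 'e) metric"
    and I :: "real set" and \<gamma> :: "real \<Rightarrow> 'a" and \<tau> :: real
  assumes "lie_group G A"
    and "left_invariant_metric G A g"
    and "is_interval I" "0 \<in> I" "\<tau> \<in> I" "\<tau> > 0"
    and "geodesic A g I \<gamma>"
    and "\<not> left_velocity G A I \<gamma> constant_on I"
  shows "(riemannian_isometry A g (right_translation G (inv\<^bsub>G\<^esub> (\<gamma> 0) \<otimes>\<^bsub>G\<^esub> \<gamma> \<tau>))
            \<longrightarrow> conjugate_along A g I \<gamma> 0 \<tau>)
       \<and> (\<gamma> \<tau> = \<gamma> 0 \<longrightarrow> conjugate_along A g I \<gamma> 0 \<tau>)"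
proof -
  interpret left_invariant_lie_group A g G
    using assms(1,2) by unfold_locales (simp_all add: lie_group_def left_invariant_metric_def)
  have "\<gamma> ` I \<subseteq> manifold_carrier A"
    using assms(7) by (simp add: geodesic_def differentiable_curve_def)
  then have p: "\<gamma> 0 \<in> carrier G" and q: "\<gamma> \<tau> \<in> carrier G"
    using assms(4,5) by (auto simp: carrier_eq)
  note conj = conjugate_if_momentum_transported[OF assms(3-8)]
  show ?thesis
  proof (intro conjI impI)
    \<comment> \<open>Both sides of the transport condition are then the same inner product, as the
      field \<xi> takes the value \<gamma>' 0 at this point.\<close>
    assume "\<gamma> \<tau> = \<gamma> 0"
    then show "conjugate_along A g I \<gamma> 0 \<tau>" by (intro conj) simp
  next
    let ?h = "inv\<^bsub>G\<^esub> (\<gamma> 0) \<otimes>\<^bsub>G\<^esub> \<gamma> \<tau>"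
    assume R: "riemannian_isometry A g (right_translation G ?h)"
    have h: "?h \<in> carrier G" using p q by simp
    have ph: "\<gamma> 0 \<otimes>\<^bsub>G\<^esub> ?h = \<gamma> \<tau>" using p q by (simp add: m_assoc[symmetric])
    show "conjugate_along A g I \<gamma> 0 \<tau>"
    proof (rule conj)
      fix \<xi> \<eta> assume \<xi>: "\<xi> \<in> T \<one>\<^bsub>G\<^esub>" "velocity A I \<gamma> 0 = right_field \<xi> (\<gamma> 0)" and \<eta>: "\<eta> \<in> T \<one>\<^bsub>G\<^esub>"
      \<comment> \<open>Right translation by \<open>?h\<close> sends \<gamma> 0 to \<gamma> \<tau>.
        The isometry preserves the pairing, and right invariance turns the pushed-forward vectors
        into the values of the same fields at \<gamma> \<tau>.\<close>
      have "g (\<gamma> 0) (right_field \<xi> (\<gamma> 0)) (right_field \<eta> (\<gamma> 0))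
        = g (right_translation G ?h (\<gamma> 0)) (TM (right_translation G ?h) (\<gamma> 0) (right_field \<xi> (\<gamma> 0)))
            (TM (right_translation G ?h) (\<gamma> 0) (right_field \<eta> (\<gamma> 0)))"
        using R right_field_in[OF \<xi>(1) p] right_field_in[OF \<eta> p] p
        by (simp add: riemannian_isometry_def carrier_eq)
      then show "g (\<gamma> 0) (velocity A I \<gamma> 0) (right_field \<eta> (\<gamma> 0))
         = g (\<gamma> \<tau>) (right_field \<xi> (\<gamma> \<tau>)) (right_field \<eta> (\<gamma> \<tau>))"
        unfolding \<xi>(2) right_field_right_invariant[OF \<xi>(1) p h] right_field_right_invariant[OF \<eta> p h] ph
        by (simp add: right_translation_def ph)
    qed
  qed
qed

end
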